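(* In the DMM model with $w$ processors and a $w \times m$ matrix with $w = m$, the sorting problem can be solved in $O(m \log m)$ time, and the partition problem can be solved in $O(m)$ time.
   Context: DMM model: data of size $n = wm$ is stored as a $w \times m$ matrix $\mathcal{M}$, each row being a memory bank. There are $w$ processors that proceed synchronously in discrete time steps; in each step each processor may access (read or write) one memory cell of any row, or skip, and performing computation on a constant number of items takes unit time. Algorithms must satisfy the Conflict Avoidance Condition: in each time step at most one processor accesses any given row. Time is the number of time steps. Sorting problem: $\mathcal{M}$ contains items from a totally ordered universe, and the goal is to rearrange them so that $\mathcal{M}$ is sorted in row-major order (reading rows first to last, each left to right, gives a nondecreasing sequence). Partition problem: $\mathcal{M}$ contains $wm$ labeled items whose labels consist of exactly $m$ copies of each integer in $[w]$; the goal is to rearrange the items so that every item with label $i$ is in row $i$. *)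

theory Defs
  imports Complex_Main "HOL-Library.Landau_Symbols" "HOL-Library.Multiset"
begin

text \<open>
  A DMM program is one piece of code, executed synchronously by all processors; its text is
  independent of the size of the machine and of the input.  It therefore names only a constant
  number of registers, and its expressions have constant size.  Every instruction takes one time
  step.  Rows, columns, processors and labels are numbered from 0, so the label set \<open>[w]\<close> is
  \<open>{0..<w}\<close>.
\<close>

datatype exp =
    Const nat
  | Reg nat
  | Proc_Id
  | Num_Banks
  | Num_Cols
  | Label nat
  | Add exp exp
  | Sub exp exp
  | Mul exp exp
  | Div exp exp
  | Mod exp exp

datatype test =
    Less exp exp
  | Item_Less nat nat
  | Is_Item nat
  | Neg test
  | Conj test test

datatype instr =
    Skip
  | Assign nat exp
  | Copy nat nat
  | Read nat exp exp  \<comment> \<open>target register, row, column\<close>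
  | Write exp exp nat  \<comment> \<open>row, column, source register\<close>
  | Cond test "instr list" "instr list"
  | While test "instr list"

text \<open>
  Memory cells and registers hold an item or an integer.  Items are atomic: they can be copied, and
  inspected only through \<^const>\<open>Item_Less\<close> and \<^const>\<open>Label\<close>.
\<close>

datatype 'a cell = Item 'a | Word nat

type_synonym 'a memory = "nat \<Rightarrow> nat \<Rightarrow> 'a cell"
type_synonym 'a regs = "nat \<Rightarrow> 'a cell"

text \<open>The instructions still to be executed, and the registers; \<open>[]\<close> means halted.\<close>
type_synonym 'a proc = "instr list \<times> 'a regs"

type_synonym 'a config = "'a memory \<times> (nat \<Rightarrow> 'a proc)"

record 'a dmm =
  banks :: nat
  cols :: nat
  item_less :: "'a \<Rightarrow> 'a \<Rightarrow> bool"
  item_label :: "'a \<Rightarrow> nat"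

fun eval :: "'a dmm \<Rightarrow> nat \<Rightarrow> 'a regs \<Rightarrow> exp \<Rightarrow> nat" where
  "eval D p R (Const n) = n"
| "eval D p R (Reg r) = (case R r of Word n \<Rightarrow> n | Item _ \<Rightarrow> 0)"
| "eval D p R Proc_Id = p"
| "eval D p R Num_Banks = banks D"
| "eval D p R Num_Cols = cols D"
| "eval D p R (Label r) = (case R r of Item x \<Rightarrow> item_label D x | Word _ \<Rightarrow> 0)"
| "eval D p R (Add a b) = eval D p R a + eval D p R b"
| "eval D p R (Sub a b) = eval D p R a - eval D p R b"
| "eval D p R (Mul a b) = eval D p R a * eval D p R b"
| "eval D p R (Div a b) = eval D p R a div eval D p R b"
| "eval D p R (Mod a b) = eval D p R a mod eval D p R b"

fun holds :: "'a dmm \<Rightarrow> nat \<Rightarrow> 'a regs \<Rightarrow> test \<Rightarrow> bool" where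
  "holds D p R (Less a b) \<longleftrightarrow> eval D p R a < eval D p R b"
| "holds D p R (Item_Less r s) \<longleftrightarrow>
     (case (R r, R s) of (Item x, Item y) \<Rightarrow> item_less D x y | _ \<Rightarrow> False)"
| "holds D p R (Is_Item r) \<longleftrightarrow> (case R r of Item _ \<Rightarrow> True | Word _ \<Rightarrow> False)"
| "holds D p R (Neg b) \<longleftrightarrow> \<not> holds D p R b"
| "holds D p R (Conj b c) \<longleftrightarrow> holds D p R b \<and> holds D p R c"

text \<open>The cell accessed (read or written) by processor \<open>p\<close> in the current step, if any.\<close>
fun accesses :: "'a dmm \<Rightarrow> nat \<Rightarrow> 'a proc \<Rightarrow> (nat \<times> nat) option" where
  "accesses D p (Read r i j # cs, R) = Some (eval D p R i, eval D p R j)"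
| "accesses D p (Write i j r # cs, R) = Some (eval D p R i, eval D p R j)"
| "accesses D p (_, R) = None"

fun step_proc :: "'a dmm \<Rightarrow> 'a memory \<Rightarrow> nat \<Rightarrow> 'a proc \<Rightarrow> 'a proc" where
  "step_proc D M p ([], R) = ([], R)"
| "step_proc D M p (Skip # cs, R) = (cs, R)"
| "step_proc D M p (Assign r a # cs, R) = (cs, R(r := Word (eval D p R a)))"
| "step_proc D M p (Copy r s # cs, R) = (cs, R(r := R s))"
| "step_proc D M p (Read r i j # cs, R) = (cs, R(r := M (eval D p R i) (eval D p R j)))"
| "step_proc D M p (Write i j r # cs, R) = (cs, R)"
| "step_proc D M p (Cond b xs ys # cs, R) = ((if holds D p R b then xs else ys) @ cs, R)"
| "step_proc D M p (While b xs # cs, R) =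
     (if holds D p R b then xs @ While b xs # cs else cs, R)"

fun write_proc :: "'a dmm \<Rightarrow> nat \<Rightarrow> 'a proc \<Rightarrow> 'a memory \<Rightarrow> 'a memory" where
  "write_proc D p (Write i j r # cs, R) M =
     (let a = eval D p R i in M(a := (M a)(eval D p R j := R r)))"
| "write_proc D p (_, R) M = M"

text \<open>
  All reads see the memory before the step.  The order in which the writes are folded is immaterial
  in the absence of conflicts.
\<close>
definition step :: "'a dmm \<Rightarrow> 'a config \<Rightarrow> 'a config" where
  "step D C = (fold (\<lambda>p. write_proc D p (snd C p)) [0..<banks D] (fst C),
               \<lambda>p. step_proc D (fst C) p (snd C p))"

definition init :: "'a dmm \<Rightarrow> instr list \<Rightarrow> (nat \<Rightarrow> nat \<Rightarrow> 'a) \<Rightarrow> 'a config" where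
  "init D P A = (\<lambda>i j. if i < banks D \<and> j < cols D then Item (A i j) else Word 0,
                 \<lambda>p. (P, \<lambda>r. Word 0))"

definition run :: "'a dmm \<Rightarrow> instr list \<Rightarrow> (nat \<Rightarrow> nat \<Rightarrow> 'a) \<Rightarrow> nat \<Rightarrow> 'a config" where
  "run D P A t = (step D ^^ t) (init D P A)"

definition conflict_free :: "'a dmm \<Rightarrow> 'a config \<Rightarrow> bool" where
  "conflict_free D C \<longleftrightarrow>
     (\<forall>p < banks D. \<forall>q < banks D. \<forall>i j j'.
        accesses D p (snd C p) = Some (i, j) \<and> accesses D q (snd C q) = Some (i, j')
        \<longrightarrow> p = q)"

text \<open>
  The matrix occupies the first \<open>cols D\<close> cells of each bank.  As work space a bank has a
  constant factor \<open>c\<close> more cells.  Integers are machine words of \<open>O(log n)\<close> bits,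
  i.e. bounded polynomially in the data size \<open>n\<close>.
\<close>
definition within_resources :: "nat \<Rightarrow> 'a dmm \<Rightarrow> 'a config \<Rightarrow> bool" where
  "within_resources c D C \<longleftrightarrow>
     (\<forall>p < banks D. \<forall>i j. accesses D p (snd C p) = Some (i, j)
        \<longrightarrow> i < banks D \<and> j < c * cols D) \<and>
     (\<forall>p < banks D. \<forall>r n. snd (snd C p) r = Word n \<longrightarrow> n \<le> c * (banks D * cols D) ^ c) \<and>
     (\<forall>i j n. fst C i j = Word n \<longrightarrow> n \<le> c * (banks D * cols D) ^ c)"

text \<open>
  On input \<open>A\<close>, program \<open>P\<close> runs legally, has halted after at most \<open>t\<close> steps,
  and leaves the matrix \<open>B\<close> in place of \<open>A\<close>.
\<close>
definition computes_within ::
  "nat \<Rightarrow> 'a dmm \<Rightarrow> instr list \<Rightarrow> nat \<Rightarrow> (nat \<Rightarrow> nat \<Rightarrow> 'a) \<Rightarrow> (nat \<Rightarrow> nat \<Rightarrow> 'a) \<Rightarrow> bool" where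
  "computes_within c D P t A B \<longleftrightarrow>
     (\<forall>s. conflict_free D (run D P A s) \<and> within_resources c D (run D P A s)) \<and>
     (\<forall>p < banks D. fst (snd (run D P A t) p) = []) \<and>
     (\<forall>i < banks D. \<forall>j < cols D. fst (run D P A t) i j = Item (B i j))"

definition row_major :: "nat \<Rightarrow> nat \<Rightarrow> (nat \<Rightarrow> nat \<Rightarrow> 'a) \<Rightarrow> 'a list" where
  "row_major w m A = concat (map (\<lambda>i. map (A i) [0..<m]) [0..<w])"

definition rearrangement :: "nat \<Rightarrow> nat \<Rightarrow> (nat \<Rightarrow> nat \<Rightarrow> 'a) \<Rightarrow> (nat \<Rightarrow> nat \<Rightarrow> 'a) \<Rightarrow> bool" where
  "rearrangement w m A B \<longleftrightarrow> mset (row_major w m B) = mset (row_major w m A)"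

text \<open>Sorting items can only be compared; they carry no labels.\<close>
definition sort_dmm :: "nat \<Rightarrow> nat \<Rightarrow> 'a::linorder dmm" where
  "sort_dmm w m = \<lparr>banks = w, cols = m, item_less = (<), item_label = (\<lambda>_. 0)\<rparr>"

definition sorts_within ::
  "nat \<Rightarrow> instr list \<Rightarrow> nat \<Rightarrow> nat \<Rightarrow> nat \<Rightarrow> (nat \<Rightarrow> nat \<Rightarrow> 'a::linorder) \<Rightarrow> bool" where
  "sorts_within c P w m t A \<longleftrightarrow>
     (\<exists>B. computes_within c (sort_dmm w m) P t A B \<and> rearrangement w m A B \<and>
          sorted (row_major w m B))"

text \<open>Labeled items have no order of their own; only their labels can be inspected.\<close>
definition partition_dmm :: "nat \<Rightarrow> nat \<Rightarrow> ('a \<Rightarrow> nat) \<Rightarrow> 'a dmm" where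
  "partition_dmm w m label =
     \<lparr>banks = w, cols = m, item_less = (\<lambda>_ _. False), item_label = label\<rparr>"

definition partition_input :: "nat \<Rightarrow> nat \<Rightarrow> ('a \<Rightarrow> nat) \<Rightarrow> (nat \<Rightarrow> nat \<Rightarrow> 'a) \<Rightarrow> bool" where
  "partition_input w m label A \<longleftrightarrow>
     (\<forall>i < w. \<forall>j < m. label (A i j) < w) \<and>
     (\<forall>l < w. card {(i, j). i < w \<and> j < m \<and> label (A i j) = l} = m)"

definition partitions_within ::
  "nat \<Rightarrow> instr list \<Rightarrow> nat \<Rightarrow> nat \<Rightarrow> nat \<Rightarrow> ('a \<Rightarrow> nat) \<Rightarrow> (nat \<Rightarrow> nat \<Rightarrow> 'a) \<Rightarrow> bool" where
  "partitions_within c P w m t label A \<longleftrightarrow>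
     (\<exists>B. computes_within c (partition_dmm w m label) P t A B \<and> rearrangement w m A B \<and>
          (\<forall>i < w. \<forall>j < m. label (B i j) = i))"

end

theory Submission
  imports Defs
begin

text \<open>
  Both parts use the same algorithm, which moves items between banks independently of the data; only
  the local sort of a row differs (merge sort in \<open>O(m log m)\<close>, counting sort by label in \<open>O(m)\<close>).  Partitioning is sorting by label, because
  every label occurs exactly \<open>m\<close> times.

  Let \<open>q = 2\<^sup>n\<close> with \<open>q\<^sup>2 \<le> m < 4q\<^sup>2\<close> and \<open>N = q\<^sup>2\<close>.  The items are stored in the first
  \<open>N\<close> banks, in rows of length \<open>L = 32N\<close>, padded with words that count as \<open>+\<infinity>\<close>.  The rows form
  \<open>q\<close> groups of \<open>q\<close> rows.  Sorting the rows and dealing each of them cyclically to the rows of its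
  group, and then sorting and dealing across the groups, makes the numbers of items above any
  threshold in two rows differ by at most \<open>2q\<close>, and by at most twice the number of groups that are not
  constant.  Reading the sorted matrix column by column and writing it row by row leaves at most
  two groups that are not constant, so that a second round leaves a difference of at most 4.
  After reading column by column once more, the unsorted part is shorter than half a row, and
  is sorted by sorting the rows and then the rows shifted by half a row.

  All these movements are conflict-free if each processor sends one item per step in the right
  order.  The processors stay synchronous because the local sorts take a time that does not depend
  on the data.
\<close>

section \<open>Oblivious sorting of a matrix by row sorts and deals\<close>

text \<open>The moves between banks do not look at the items, and every move is preceded by sorting
  the rows. Under a threshold, which turns items into zeros and ones, the numbers of ones per row
  after a move therefore depend only on those before it. The analysis is about these numbers alone;
  the order of the items returns when the threshold is taken to be \<open>le x\<close>.

  The factor 32 is chosen for three reasons. The relayout makes one row out of 32 columns and thus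
  one group out of \<open>32 * q\<close>, more than the spread of \<open>2 * q\<close> columns after
  the first deals, which hence touches at most two groups. The later spread of 4 columns is an
  eighth of a row's 32, so of two mixed neighbours the first has few ones and the second many, as
  the half-row shift requires. And \<open>m < 4 * N\<close> gives \<open>m * m < 16 * N * N\<close>,
  half the capacity \<open>N * L\<close>, so that padding fills the end of the matrix.

  With \<open>q\<close> a power of two, \<open>L\<close> is one as well, and merge sort never meets
  an incomplete block.\<close>

lemma inj_on_shift_mod: "inj_on (\<lambda>t. (s + t) mod q) {u..<u + q :: nat}"
proof (rule linorder_inj_onI')
  fix t t' assume *: "t \<in> {u..<u + q}" "t' \<in> {u..<u + q}" "t < t'"
  show "(s + t) mod q \<noteq> (s + t') mod q"
  proof
    assume "(s + t) mod q = (s + t') mod q"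
    then have "q dvd (s + t') - (s + t)" using * mod_eq_dvd_iff_nat[of "s + t" "s + t'" q] by simp
    then show False using * by (auto dest!: dvd_imp_le)
  qed
qed

lemma bij_betw_shift_mod:
  assumes "0 < (q::nat)" shows "bij_betw (\<lambda>t. (s + t) mod q) {u..<u + q} {..<q}"
  unfolding bij_betw_def
proof (intro conjI inj_on_shift_mod card_subset_eq)
  show "card ((\<lambda>t. (s + t) mod q) ` {u..<u + q}) = card {..<q}"
    by (simp add: card_image inj_on_shift_mod)
qed (use assms in auto)

lemma bij_betw_add_mod: "0 < (q::nat) \<Longrightarrow> bij_betw (\<lambda>t. (s + t) mod q) {..<q} {..<q}"
  using bij_betw_shift_mod[of q s 0] by (simp add: lessThan_atLeast0)

lemma card_residue_block:
  assumes "r < q" shows "card {t \<in> {u..<u + q}. (s + t) mod q = (r::nat)} = 1"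
proof -
  have bij: "bij_betw (\<lambda>t. (s + t) mod q) {u..<u + q} {..<q}"
    using assms by (intro bij_betw_shift_mod) auto
  then have "r \<in> (\<lambda>t. (s + t) mod q) ` {u..<u + q}"
    using assms bij_betw_imp_surj_on[OF bij] by simp
  then obtain t where t: "t \<in> {u..<u + q}" "(s + t) mod q = r" by blast
  then have "{t \<in> {u..<u + q}. (s + t) mod q = r} = {t}"
    using inj_on_shift_mod[of s q u] unfolding inj_on_def by blast
  then show ?thesis by simp
qed

lemma card_residue_multiple:
  assumes "r < q" shows "card {t \<in> {u..<u + q * k}. (s + t) mod q = (r::nat)} = k"
proof (induction k)
  case (Suc k)
  have "{t \<in> {u..<u + q * Suc k}. (s + t) mod q = r} =
      {t \<in> {u..<u + q * k}. (s + t) mod q = r} \<union>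
      {t \<in> {u + q * k..<u + q * k + q}. (s + t) mod q = r}" by auto
  moreover have "card \<dots> = card {t \<in> {u..<u + q * k}. (s + t) mod q = r} +
      card {t \<in> {u + q * k..<u + q * k + q}. (s + t) mod q = r}"
    by (rule card_Un_disjoint) auto
  ultimately show ?case using Suc card_residue_block[OF assms] by simp
qed simp

lemma card_interval_mono:
  assumes "a \<le> (b::nat)"
  shows "card {t \<in> {u..<u + a}. P t} \<le> card {t \<in> {u..<u + b}. P t}"
  using assms by (intro card_mono) auto

text \<open>An interval of length \<open>x\<close> contains \<open>x div q\<close> full periods and
  is contained in one more; full periods are counted exactly.\<close>

lemma card_residue:
  assumes "r < q"
  shows "x div q \<le> card {t \<in> {u..<u + x}. (s + t) mod q = (r::nat)}"
    and "card {t \<in> {u..<u + x}. (s + t) mod q = r} \<le> x div q + 1"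
proof -
  have "q * (x div q) \<le> x" by (rule times_div_less_eq_dividend)
  from card_interval_mono[OF this] show "x div q \<le> card {t \<in> {u..<u + x}. (s + t) mod q = r}"
    using card_residue_multiple[OF assms] by metis
  have "x \<le> q * (x div q + 1)" using assms dividend_less_times_div[of q x] by simp
  from card_interval_mono[OF this]
  show "card {t \<in> {u..<u + x}. (s + t) mod q = r} \<le> x div q + 1"
    using card_residue_multiple[OF assms] by metis
qed

text \<open>
  A sorted row with \<open>x\<close> ones has them in its last \<open>x\<close> places; this many of them are dealt to row \<open>r\<close>
  if dealing starts with row \<open>s\<close>.
\<close>
definition share :: "nat \<Rightarrow> nat \<Rightarrow> nat \<Rightarrow> nat \<Rightarrow> nat \<Rightarrow> nat" where
  "share L q s r x = card {t \<in> {L - x..<L}. (s + t) mod q = r}"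

lemma share:
  assumes "r < q" "x \<le> L"
  shows "x div q \<le> share L q s r x" "share L q s r x \<le> x div q + 1"
proof -
  have "L - x + x = L" using assms(2) by simp
  then show "x div q \<le> share L q s r x" "share L q s r x \<le> x div q + 1"
    using card_residue[OF assms(1), where u = "L - x" and x = x and s = s] by (simp_all only: share_def)
qed

text \<open>Without rounding the share does not depend on the starting row \<open>s\<close>. This is
  why groups that are constant contribute nothing to the final imbalance.\<close>

lemma share_exact:
  assumes "r < q" "q * k \<le> L"
  shows "share L q s r (q * k) = k"
  using card_residue_multiple[OF assms(1), of "L - q * k" k s] assms(2) by (simp add: share_def)

text \<open>The first deal leaves the rows of a group within \<open>q\<close> of each other, so what
  one group hands to any row in the second deal varies by at most 2. Groups outside \<open>S\<close>
  hand over exactly the same number everywhere. Summing over the groups leaves twice the size of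
  \<open>S\<close>.\<close>

lemma two_deals_balance:
  fixes c0 c1 c2 :: "nat \<Rightarrow> nat \<Rightarrow> nat"
  assumes q: "0 < q" and L: "L = q * k"
    and c0: "\<And>a b. a < q \<Longrightarrow> b < q \<Longrightarrow> c0 a b \<le> L"
    and c1: "\<And>a b. a < q \<Longrightarrow> b < q \<Longrightarrow> c1 a b = (\<Sum>b'<q. share L q b' b (c0 a b'))"
    and c1_le: "\<And>a b. a < q \<Longrightarrow> b < q \<Longrightarrow> c1 a b \<le> L"
    and c2: "\<And>a b. a < q \<Longrightarrow> b < q \<Longrightarrow> c2 a b = (\<Sum>a'<q. share L q a' a (c1 a' b))"
    and clean: "\<And>a. a < q \<Longrightarrow> a \<notin> S \<Longrightarrow> (\<forall>b<q. c0 a b = 0) \<or> (\<forall>b<q. c0 a b = L)"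
    and S: "finite S"
  obtains d where "\<And>a b. a < q \<Longrightarrow> b < q \<Longrightarrow> d \<le> c2 a b \<and> c2 a b \<le> d + 2 * card S"
proof -
  have "\<exists>lo. \<forall>r<q. \<forall>b<q. lo \<le> share L q a r (c1 a b) \<and>
      share L q a r (c1 a b) \<le> lo + (if a \<in> S then 2 else 0)" if a: "a < q" for a
  proof (cases "a \<in> S")
    case True
    define s where "s = (\<Sum>b<q. c0 a b div q)"
    have "s \<le> c1 a b \<and> c1 a b \<le> s + q" if "b < q" for b
    proof
      show "s \<le> c1 a b" unfolding s_def c1[OF a that]
        by (intro sum_mono share) (use a that c0 in auto)
      have "c1 a b \<le> (\<Sum>b<q. c0 a b div q + 1)" unfolding c1[OF a that]
        by (intro sum_mono share) (use a that c0 in auto)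
      also have "\<dots> = s + q" unfolding s_def by (subst sum.distrib) simp
      finally show "c1 a b \<le> s + q" .
    qed
    \<comment> \<open>A range of length \<open>q\<close> allows two consecutive quotients; the
      rounding inside \<open>share\<close> adds one more value, hence the 2.\<close>
    then have "s div q \<le> c1 a b div q \<and> c1 a b div q \<le> s div q + 1" if "b < q" for b
      using that q div_le_mono[of s "c1 a b" q] div_le_mono[of "c1 a b" "s + q" q] by simp
    note div = this
    show ?thesis
    proof (intro exI[of _ "s div q"] allI impI)
      fix r b assume "r < q" "b < q"
      then show "s div q \<le> share L q a r (c1 a b) \<and>
          share L q a r (c1 a b) \<le> s div q + (if a \<in> S then 2 else 0)"
        using share[of r q "c1 a b" L a] c1_le[OF a] div[of b] True by simp
    qed
  next
    case False
    \<comment> \<open>A constant group has counts 0 or \<open>q * k\<close>. Both are divisible by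
      \<open>q\<close>, so neither deal rounds.\<close>
    have "\<exists>v. \<forall>b<q. c1 a b = q * v \<and> q * v \<le> L"
    proof (cases "\<forall>b<q. c0 a b = 0")
      case True
      then have "\<forall>b<q. c1 a b = q * 0" using c1 a share_exact[of _ q 0 L] by simp
      then show ?thesis by (intro exI[of _ 0]) auto
    next
      case False
      with clean[OF a \<open>a \<notin> S\<close>] have "\<forall>b<q. c0 a b = q * k" using L by blast
      then have "\<forall>b<q. c1 a b = q * k" using c1 a share_exact[of _ q k L] L by simp
      then show ?thesis using L by auto
    qed
    then obtain v where "\<forall>b<q. c1 a b = q * v \<and> q * v \<le> L" by blast
    then show ?thesis using share_exact[of _ q v L a] False by (intro exI[of _ v]) simp
  qed
  then obtain lo where lo: "\<And>a r b. a < q \<Longrightarrow> r < q \<Longrightarrow> b < q \<Longrightarrow>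
      lo a \<le> share L q a r (c1 a b) \<and> share L q a r (c1 a b) \<le> lo a + (if a \<in> S then 2 else 0)"
    by metis
  show thesis
  proof (rule that[of "\<Sum>a<q. lo a"])
    fix a b assume *: "a < q" "b < q"
    have "c2 a b \<le> (\<Sum>a'<q. lo a' + (if a' \<in> S then 2 else 0))"
      unfolding c2[OF *] by (rule sum_mono) (use lo * in auto)
    also have "\<dots> = (\<Sum>a'<q. lo a') + 2 * card ({..<q} \<inter> S)"
      by (simp add: sum.distrib sum.If_cases)
    also have "\<dots> \<le> (\<Sum>a'<q. lo a') + 2 * card S"
      using S by (simp add: card_mono)
    finally show "(\<Sum>a<q. lo a) \<le> c2 a b \<and> c2 a b \<le> (\<Sum>a<q. lo a) + 2 * card S"
      unfolding c2[OF *] using lo * by (auto intro: sum_mono)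
  qed
qed

section \<open>Sorted rows under thresholds\<close>

definition row_sorted :: "('c \<Rightarrow> 'c \<Rightarrow> bool) \<Rightarrow> nat \<Rightarrow> (nat \<Rightarrow> 'c) \<Rightarrow> bool" where
  "row_sorted le L x \<longleftrightarrow> (\<forall>t t'. t \<le> t' \<longrightarrow> t' < L \<longrightarrow> le (x t) (x t'))"

definition row_mset :: "nat \<Rightarrow> (nat \<Rightarrow> 'c) \<Rightarrow> 'c multiset" where
  "row_mset L x = (\<Sum>t<L. {#x t#})"

definition cnt :: "('c \<Rightarrow> bool) \<Rightarrow> nat \<Rightarrow> (nat \<Rightarrow> 'c) \<Rightarrow> nat" where
  "cnt f L x = card {t. t < L \<and> f (x t)}"

text \<open>These predicates are the thresholds of the 0-1 principle: the elements satisfying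
  \<open>f\<close> are the ones.\<close>

definition upward :: "('c \<Rightarrow> 'c \<Rightarrow> bool) \<Rightarrow> ('c \<Rightarrow> bool) \<Rightarrow> bool" where
  "upward le f \<longleftrightarrow> (\<forall>x y. le x y \<longrightarrow> f x \<longrightarrow> f y)"

lemma cnt_eq_sum: "cnt f L x = (\<Sum>t<L. of_bool (f (x t)))"
  by (simp add: cnt_def Int_def lessThan_def)

lemma size_filter_sum: "finite A \<Longrightarrow> size (filter_mset f (\<Sum>t\<in>A. {#x t#})) = (\<Sum>t\<in>A. of_bool (f (x t)))"
  by (induction A rule: finite_induct) auto

lemma cnt_row_mset: "cnt f L x = size (filter_mset f (row_mset L x))"
  by (simp only: cnt_eq_sum row_mset_def size_filter_sum finite_lessThan)

lemma cnt_cong_mset: "row_mset L x = row_mset L y \<Longrightarrow> cnt f L x = cnt f L y"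
  by (simp add: cnt_row_mset)

lemma cnt_le: "cnt f L x \<le> L"
  unfolding cnt_def using card_mono[of "{..<L}" "{t. t < L \<and> f (x t)}"] by auto

text \<open>An upward closed set of positions is a final segment, so its size determines where it
  begins.\<close>

lemma upper_set_eq:
  assumes up: "\<And>t t'. t \<le> t' \<Longrightarrow> t' < L \<Longrightarrow> P t \<Longrightarrow> P t'" and "t < L"
  shows "P t \<longleftrightarrow> L - card {t. t < L \<and> P t} \<le> (t::nat)"
proof
  assume "P t"
  then have "{t..<L} \<subseteq> {t. t < L \<and> P t}" using up by auto
  then have "card {t..<L} \<le> card {t. t < L \<and> P t}" by (intro card_mono) auto
  then show "L - card {t. t < L \<and> P t} \<le> t" by simp
next
  assume *: "L - card {t. t < L \<and> P t} \<le> t"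
  show "P t"
  proof (rule ccontr)
    assume "\<not> P t"
    then have "{t. t < L \<and> P t} \<subseteq> {Suc t..<L}"
      using up[of _ t] assms(2) by (auto simp: not_less_eq_eq[symmetric])
    then have "card {t. t < L \<and> P t} \<le> card {Suc t..<L}" by (intro card_mono) auto
    then show False using * assms(2) by simp
  qed
qed

lemma row_sorted_upward:
  assumes "row_sorted le L x" "upward le f" "t < L"
  shows "f (x t) \<longleftrightarrow> L - cnt f L x \<le> t"
  unfolding cnt_def
  by (rule upper_set_eq[where P = "\<lambda>t. f (x t)"])
    (use assms in \<open>auto simp: row_sorted_def upward_def\<close>)

text \<open>\<open>X\<close> is the matrix with sorted rows. It is only required to exist because
  elements that are equivalent under \<open>le\<close> may end up in any order. The arrival column
  is the time \<open>t\<close> of sending, so only the target row \<open>H p t\<close> and the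
  source column \<open>G p t\<close> have to be chosen.\<close>

definition dealt :: "('c \<Rightarrow> 'c \<Rightarrow> bool) \<Rightarrow> nat \<Rightarrow> nat \<Rightarrow> (nat \<Rightarrow> nat \<Rightarrow> nat) \<Rightarrow> (nat \<Rightarrow> nat \<Rightarrow> nat) \<Rightarrow>
    (nat \<Rightarrow> nat \<Rightarrow> 'c) \<Rightarrow> (nat \<Rightarrow> nat \<Rightarrow> 'c) \<Rightarrow> bool" where
  "dealt le N L H G Y Y' \<longleftrightarrow> (\<exists>X. (\<forall>p<N. row_sorted le L (X p) \<and> row_mset L (X p) = row_mset L (Y p)) \<and>
     (\<forall>p<N. \<forall>t<L. Y' (H p t) t = X p (G p t)))"

text \<open>For fixed \<open>t\<close> the targets permute the rows, which allows reindexing one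
  column at a time. The summand \<open>\<phi>\<close> is general so as to serve both for multisets
  of items and for the number of ones arriving in a given row.\<close>

lemma dealt_sum:
  fixes \<phi> :: "'c \<Rightarrow> nat \<Rightarrow> 'm :: comm_monoid_add"
  assumes "\<forall>p<N. \<forall>t<L. Y' (H p t) t = X p (G p t)"
    and "\<And>t. t < L \<Longrightarrow> bij_betw (\<lambda>p. H p t) {..<N} {..<N}"
  shows "(\<Sum>r<N. \<Sum>t<L. \<phi> (Y' r t) r) = (\<Sum>p<N. \<Sum>t<L. \<phi> (X p (G p t)) (H p t))"
proof -
  have "(\<Sum>r<N. \<phi> (Y' r t) r) = (\<Sum>p<N. \<phi> (X p (G p t)) (H p t))" if "t < L" for t
    using sum.reindex_bij_betw[OF assms(2)[OF that], of "\<lambda>r. \<phi> (Y' r t) r"] assms(1) that by simp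
  then show ?thesis
    by (subst (1 2) sum.swap) simp
qed

lemma dealt_mset:
  assumes d: "dealt le N L H G Y Y'"
    and H: "\<And>t. t < L \<Longrightarrow> bij_betw (\<lambda>p. H p t) {..<N} {..<N}"
    and G: "\<And>p. p < N \<Longrightarrow> bij_betw (G p) {..<L} {..<L}"
  shows "(\<Sum>p<N. row_mset L (Y' p)) = (\<Sum>p<N. row_mset L (Y p))"
proof -
  obtain X where X: "\<forall>p<N. row_sorted le L (X p) \<and> row_mset L (X p) = row_mset L (Y p)"
    and Y': "\<forall>p<N. \<forall>t<L. Y' (H p t) t = X p (G p t)"
    using d unfolding dealt_def by blast
  have "(\<Sum>p<N. row_mset L (Y' p)) = (\<Sum>p<N. \<Sum>t<L. {#X p (G p t)#})"
    unfolding row_mset_def using Y' H by (rule dealt_sum[where \<phi> = "\<lambda>x _. {#x#}"])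
  also have "\<dots> = (\<Sum>p<N. row_mset L (X p))"
    unfolding row_mset_def
    by (intro sum.cong refl sum.reindex_bij_betw[OF G, of _ "\<lambda>t. {#X _ t#}"]) auto
  finally show ?thesis using X by simp
qed

text \<open>In a sorted row, being a one is a condition on the position. The right-hand side
  therefore mentions the old matrix only through its counts.\<close>

lemma dealt_cnt:
  assumes d: "dealt le N L H G Y Y'" and f: "upward le f" and r: "r < N"
    and H: "\<And>t. t < L \<Longrightarrow> bij_betw (\<lambda>p. H p t) {..<N} {..<N}"
    and G: "\<And>p. p < N \<Longrightarrow> bij_betw (G p) {..<L} {..<L}"
  shows "cnt f L (Y' r) = (\<Sum>p<N. card {t. t < L \<and> H p t = r \<and> L - cnt f L (Y p) \<le> G p t})"
proof -
  obtain X where X: "\<forall>p<N. row_sorted le L (X p) \<and> row_mset L (X p) = row_mset L (Y p)"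
    and Y': "\<forall>p<N. \<forall>t<L. Y' (H p t) t = X p (G p t)"
    using d unfolding dealt_def by blast
  have "cnt f L (Y' r) = (\<Sum>r'<N. if r' = r then \<Sum>t<L. of_bool (f (Y' r t)) else 0)"
    using r by (simp add: cnt_eq_sum)
  also have "\<dots> = (\<Sum>r'<N. \<Sum>t<L. of_bool (f (Y' r' t) \<and> r' = r))"
    by (intro sum.cong) auto
  also have "\<dots> = (\<Sum>p<N. \<Sum>t<L. of_bool (f (X p (G p t)) \<and> H p t = r))"
    using Y' H by (rule dealt_sum[where \<phi> = "\<lambda>x r'. of_bool (f x \<and> r' = r)"])
  also have "\<dots> = (\<Sum>p<N. card {t. t < L \<and> H p t = r \<and> L - cnt f L (Y p) \<le> G p t})"
  proof (rule sum.cong[OF refl])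
    fix p assume p: "p \<in> {..<N}"
    have "f (X p (G p t)) \<longleftrightarrow> L - cnt f L (Y p) \<le> G p t" if "t < L" for t
      using X p that G[of p] row_sorted_upward[OF _ f, of L "X p" "G p t"]
      by (auto simp: bij_betw_def cnt_cong_mset[of L "X p" "Y p"])
    then have "(\<Sum>t<L. of_bool (f (X p (G p t)) \<and> H p t = r)) =
        (\<Sum>t<L. of_bool (H p t = r \<and> L - cnt f L (Y p) \<le> G p t) :: nat)"
      by (intro sum.cong) auto
    also have "\<dots> = card {t. t < L \<and> H p t = r \<and> L - cnt f L (Y p) \<le> G p t}"
      by (simp add: Int_def lessThan_def)
    finally show "(\<Sum>t<L. of_bool (f (X p (G p t)) \<and> H p t = r)) =
      card {t. t < L \<and> H p t = r \<and> L - cnt f L (Y p) \<le> G p t}" .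
  qed
  finally show ?thesis .
qed

lemma sum_pairs: "(\<Sum>p<k * l. g p) = (\<Sum>a<k. \<Sum>b<l. g (a * l + b :: nat) :: 'm :: comm_monoid_add)"
proof -
  have "(\<Sum>p<k * l. g p) = (\<Sum>a<k. sum g {a * l..<a * l + l})"
    by (rule sum.nat_group[symmetric])
  also have "\<dots> = (\<Sum>a<k. \<Sum>b<l. g (a * l + b))"
  proof (rule sum.cong[OF refl])
    fix a
    show "sum g {a * l..<a * l + l} = (\<Sum>b<l. g (a * l + b))"
      using sum.shift_bounds_nat_ivl[of g 0 "a * l" l]
      by (simp add: lessThan_atLeast0 add.commute)
  qed
  finally show ?thesis .
qed

lemma pair_less:
  assumes "a < k" "b < l" shows "a * l + b < k * (l::nat)"
proof -
  have "a * l + b < Suc a * l" using assms by simp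
  also have "\<dots> \<le> k * l" using assms by (intro mult_le_mono1) simp
  finally show ?thesis .
qed

section \<open>The permutations behind the deals and the relayout\<close>

definition deal_within :: "nat \<Rightarrow> nat \<Rightarrow> nat \<Rightarrow> nat" where
  "deal_within q p t = p div q * q + (p mod q + t) mod q"

definition deal_across :: "nat \<Rightarrow> nat \<Rightarrow> nat \<Rightarrow> nat" where
  "deal_across q p t = (p + q * t) mod (q * q)"

text \<open>Source column of processor \<open>p\<close> at time \<open>t\<close>; column
  \<open>j\<close> goes to row \<open>j div 32\<close>. The offset \<open>32 * p\<close> staggers
  the processors, so that at any time they send to different rows.\<close>

definition relayout :: "nat \<Rightarrow> nat \<Rightarrow> nat \<Rightarrow> nat" where
  "relayout L p t = (32 * p + t) mod L"

lemma bij_betw_endo: "finite A \<Longrightarrow> inj_on f A \<Longrightarrow> f ` A \<subseteq> A \<Longrightarrow> bij_betw f A A"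
  by (simp add: bij_betw_def endo_inj_surj)

lemma pair_div_mod: "b < (q::nat) \<Longrightarrow> (a * q + b) div q = a \<and> (a * q + b) mod q = b"
  by simp

lemma pair_eq_iff:
  assumes "b < q" "b' < q" shows "a * q + b = a' * q + b' \<longleftrightarrow> a = a' \<and> b = (b'::nat)"
  using pair_div_mod[OF assms(1), of a] pair_div_mod[OF assms(2), of a'] by metis

lemma deal_within_pair: "b < q \<Longrightarrow> deal_within q (a * q + b) t = a * q + (b + t) mod q"
  by (simp add: deal_within_def)

lemma deal_across_pair:
  assumes "b < q" shows "deal_across q (a * q + b) t = (a + t) mod q * q + b"
proof -
  have "deal_across q (a * q + b) t = (b + q * (a + t)) mod (q * q)"
    by (simp add: deal_across_def algebra_simps)
  also have "\<dots> = q * ((b + q * (a + t)) div q mod q) + (b + q * (a + t)) mod q"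
    by (rule mod_mult2_eq)
  also have "\<dots> = (a + t) mod q * q + b" using assms by simp
  finally show ?thesis .
qed

lemma bij_betw_deal_within: "bij_betw (\<lambda>p. deal_within q p t) {..<q * q} {..<q * q}"
proof (rule bij_betw_endo)
  have pair: "p div q < q \<and> p mod q < q" if "p < q * q" for p
    using that by (cases "q = 0") (auto simp: less_mult_imp_div_less)
  show "(\<lambda>p. deal_within q p t) ` {..<q * q} \<subseteq> {..<q * q}"
    using pair by (auto simp: deal_within_def intro!: pair_less mod_less_divisor intro: gr0I)
  show "inj_on (\<lambda>p. deal_within q p t) {..<q * q}"
  proof (rule inj_onI)
    fix p p' assume *: "p \<in> {..<q * q}" "p' \<in> {..<q * q}" "deal_within q p t = deal_within q p' t"
    then have "0 < q" by (cases q) auto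
    then have 1: "p div q = p' div q" "(p mod q + t) mod q = (p' mod q + t) mod q"
      using *(3) pair_eq_iff[of "(p mod q + t) mod q" q "(p' mod q + t) mod q" "p div q" "p' div q"]
      by (simp_all add: deal_within_def)
    have "p mod q = p' mod q"
      using inj_onD[OF inj_on_shift_mod[of t q 0], of "p mod q" "p' mod q"] 1(2) \<open>0 < q\<close>
      by (simp add: add.commute)
    with 1(1) show "p = p'" by (metis div_mult_mod_eq)
  qed
qed simp

lemma bij_betw_deal_across: "bij_betw (\<lambda>p. deal_across q p t) {..<q * q} {..<q * q}"
proof (cases "q = 0")
  case False
  then show ?thesis using bij_betw_add_mod[of "q * q" "q * t"]
    by (simp add: deal_across_def add.commute)
qed (simp add: bij_betw_def)

lemma bij_betw_relayout: "0 < L \<Longrightarrow> bij_betw (relayout L p) {..<L} {..<L}"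
  unfolding relayout_def by (rule bij_betw_add_mod)

lemma relayout_div: "relayout (32 * N) p t div 32 = (t div 32 + p) mod N"
  by (simp add: relayout_def mod_mult2_eq add.commute)

lemma bij_betw_relayout_div: "0 < N \<Longrightarrow> bij_betw (\<lambda>p. relayout (32 * N) p t div 32) {..<N} {..<N}"
  unfolding relayout_div by (rule bij_betw_add_mod)

lemma card_reindex:
  assumes "bij_betw g {..<L} {..<L::nat}"
  shows "card {t. t < L \<and> P (g t)} = card {j. j < L \<and> P j}"
proof (rule bij_betw_same_card)
  show "bij_betw g {t. t < L \<and> P (g t)} {j. j < L \<and> P j}"
    using assms unfolding bij_betw_def inj_on_def by (auto simp: image_iff)
qed

text \<open>With \<open>c\<close> counting the ones, the rows are zeros, then at most two mixed
  rows, then ones. If two rows are mixed, then after sorting the ones of the first lie in its second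
  half and the zeros of the next in its first half, so both lie in a single row of the shifted
  matrix.\<close>

definition near_sorted :: "nat \<Rightarrow> nat \<Rightarrow> (nat \<Rightarrow> nat) \<Rightarrow> bool" where
  "near_sorted N L c \<longleftrightarrow> (\<forall>r r'. r < r' \<longrightarrow> r' < N \<longrightarrow>
     c r = 0 \<or> c r' = L \<or> (r' = Suc r \<and> 2 * c r \<le> L \<and> L \<le> 2 * c r'))"

section \<open>Effect of the moves on the numbers of ones\<close>

context
  fixes le :: "'c \<Rightarrow> 'c \<Rightarrow> bool" and q L :: nat
  assumes q: "0 < q" and L: "L = 32 * (q * q)"
begin

abbreviation dealt_within where "dealt_within \<equiv> dealt le (q * q) L (deal_within q) (\<lambda>p t. t)"
abbreviation dealt_across where "dealt_across \<equiv> dealt le (q * q) L (deal_across q) (\<lambda>p t. t)"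
abbreviation relaid where "relaid \<equiv> dealt le (q * q) L (\<lambda>p t. relayout L p t div 32) (relayout L)"

lemma cnt_deal_within:
  assumes "dealt_within Y Y'" "upward le f" "a < q" "b < q"
  shows "cnt f L (Y' (a * q + b)) = (\<Sum>b'<q. share L q b' b (cnt f L (Y (a * q + b'))))"
proof -
  have "cnt f L (Y' (a * q + b)) = (\<Sum>p<q*q. card {t. t < L \<and> deal_within q p t = a * q + b \<and>
      L - cnt f L (Y p) \<le> t})"
    by (rule dealt_cnt[OF assms(1,2) pair_less[OF assms(3,4)] bij_betw_deal_within]) (simp add: bij_betw_def)
  also have "\<dots> = (\<Sum>a'<q. if a' = a then \<Sum>b'<q. share L q b' b (cnt f L (Y (a * q + b'))) else 0)"
    unfolding sum_pairs
  proof (rule sum.cong[OF refl])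
    fix a'
    have "card {t. t < L \<and> deal_within q (a' * q + b') t = a * q + b \<and> L - cnt f L (Y (a' * q + b')) \<le> t} =
      (if a' = a then share L q b' b (cnt f L (Y (a * q + b'))) else 0)" if "b' < q" for b'
    proof -
      have "deal_within q (a' * q + b') t = a * q + b \<longleftrightarrow> a' = a \<and> (b' + t) mod q = b" for t
        using pair_eq_iff[of "(b' + t) mod q" q b a' a] q assms(4) deal_within_pair[OF that] by simp
      then show ?thesis by (auto simp: share_def intro!: arg_cong[where f = card])
    qed
    then show "(\<Sum>b'<q. card {t. t < L \<and> deal_within q (a' * q + b') t = a * q + b \<and>
          L - cnt f L (Y (a' * q + b')) \<le> t}) =
        (if a' = a then \<Sum>b'<q. share L q b' b (cnt f L (Y (a * q + b'))) else 0)"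
      by simp
  qed
  finally show ?thesis using assms(3) by simp
qed

lemma cnt_deal_across:
  assumes "dealt_across Y Y'" "upward le f" "a < q" "b < q"
  shows "cnt f L (Y' (a * q + b)) = (\<Sum>a'<q. share L q a' a (cnt f L (Y (a' * q + b))))"
proof -
  have "cnt f L (Y' (a * q + b)) = (\<Sum>p<q*q. card {t. t < L \<and> deal_across q p t = a * q + b \<and>
      L - cnt f L (Y p) \<le> t})"
    by (rule dealt_cnt[OF assms(1,2) pair_less[OF assms(3,4)] bij_betw_deal_across]) (simp add: bij_betw_def)
  also have "\<dots> = (\<Sum>a'<q. \<Sum>b'<q. if b' = b then share L q a' a (cnt f L (Y (a' * q + b))) else 0)"
    unfolding sum_pairs
  proof (intro sum.cong refl)
    fix a' b' assume "b' \<in> {..<q}"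
    then have "deal_across q (a' * q + b') t = a * q + b \<longleftrightarrow> b' = b \<and> (a' + t) mod q = a" for t
      using pair_eq_iff[of b' q b "(a' + t) mod q" a] assms(4) deal_across_pair[of b' q] by auto
    then show "card {t. t < L \<and> deal_across q (a' * q + b') t = a * q + b \<and>
        L - cnt f L (Y (a' * q + b')) \<le> t} =
      (if b' = b then share L q a' a (cnt f L (Y (a' * q + b))) else 0)"
      by (auto simp: share_def intro!: arg_cong[where f = card])
  qed
  finally show ?thesis using assms(4) by simp
qed

text \<open>Since \<open>relayout L p\<close> permutes the columns, the stagger disappears from the
  count: row \<open>r\<close> receives the same block of 32 columns from every row.\<close>

lemma cnt_relayout:
  assumes "relaid Y Y'" "upward le f" "r < q * q"
  shows "cnt f L (Y' r) = (\<Sum>p<q*q. card {j. j < L \<and> j div 32 = r \<and> L - cnt f L (Y p) \<le> j})"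
proof -
  have "cnt f L (Y' r) = (\<Sum>p<q*q. card {t. t < L \<and> relayout L p t div 32 = r \<and>
      L - cnt f L (Y p) \<le> relayout L p t})"
    using bij_betw_relayout[of L] bij_betw_relayout_div[of "q * q"] q unfolding L
    by (intro dealt_cnt[OF assms(1)[unfolded L] assms(2,3)]) auto
  also have "\<dots> = (\<Sum>p<q*q. card {j. j < L \<and> j div 32 = r \<and> L - cnt f L (Y p) \<le> j})"
    using bij_betw_relayout[of L] q L
    by (intro sum.cong refl card_reindex[where P = "\<lambda>j. j div 32 = r \<and> L - cnt f L (Y _) \<le> j"]) auto
  finally show ?thesis .
qed

lemma relayout_full:
  assumes "relaid Y Y'" "upward le f" "r < q * q"
    and "\<And>p. p < q * q \<Longrightarrow> d \<le> cnt f L (Y p)" "L \<le> d + 32 * r"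
  shows "cnt f L (Y' r) = L"
proof -
  have "{j. j < L \<and> j div 32 = r \<and> L - cnt f L (Y p) \<le> j} = {32 * r..<32 * r + 32}" if "p < q * q" for p
    using assms(3,5) assms(4)[OF that] L by auto
  then show ?thesis unfolding cnt_relayout[OF assms(1-3)] using L by simp
qed

lemma relayout_empty:
  assumes "relaid Y Y'" "upward le f" "r < q * q"
    and "\<And>p. p < q * q \<Longrightarrow> cnt f L (Y p) \<le> d" "32 * r + 32 + d \<le> L"
  shows "cnt f L (Y' r) = 0"
proof -
  have "{j. j < L \<and> j div 32 = r \<and> L - cnt f L (Y p) \<le> j} = {}" if "p < q * q" for p
    using assms(5) assms(4)[OF that] by auto
  then show ?thesis unfolding cnt_relayout[OF assms(1-3)] by simp
qed

text \<open>The ones of every sorted row begin no earlier than the last 4 of the 32 columns that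
  form row \<open>r\<close>, which gives at most \<open>4 * q * q\<close> of
  \<open>L = 32 * q * q\<close>. \<open>relayout_many\<close> is the mirror image.\<close>

lemma relayout_few:
  assumes "relaid Y Y'" "upward le f" "r < q * q"
    and "\<And>p. p < q * q \<Longrightarrow> cnt f L (Y p) \<le> d" "32 * r + 28 + d \<le> L"
  shows "2 * cnt f L (Y' r) \<le> L"
proof -
  have "card {j. j < L \<and> j div 32 = r \<and> L - cnt f L (Y p) \<le> j} \<le> 4" if "p < q * q" for p
  proof -
    have "{j. j < L \<and> j div 32 = r \<and> L - cnt f L (Y p) \<le> j} \<subseteq> {32 * r + 28..<32 * r + 32}"
      using assms(5) assms(4)[OF that] by auto
    from card_mono[OF _ this] show ?thesis by simp
  qed
  then have "cnt f L (Y' r) \<le> (\<Sum>p<q*q. 4)"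
    unfolding cnt_relayout[OF assms(1-3)] by (intro sum_mono) auto
  then show ?thesis using L by simp
qed

lemma relayout_many:
  assumes "relaid Y Y'" "upward le f" "r < q * q"
    and "\<And>p. p < q * q \<Longrightarrow> d \<le> cnt f L (Y p)" "L \<le> d + 32 * r + 4"
  shows "L \<le> 2 * cnt f L (Y' r)"
proof -
  have "28 \<le> card {j. j < L \<and> j div 32 = r \<and> L - cnt f L (Y p) \<le> j}" if "p < q * q" for p
  proof -
    have "{32 * r + 4..<32 * r + 32} \<subseteq> {j. j < L \<and> j div 32 = r \<and> L - cnt f L (Y p) \<le> j}"
      using assms(3,5) assms(4)[OF that] L by auto
    from card_mono[OF _ this] show ?thesis by simp
  qed
  then have "(\<Sum>p<q*q. 28) \<le> cnt f L (Y' r)"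
    unfolding cnt_relayout[OF assms(1-3)] by (intro sum_mono) auto
  then show ?thesis using L by simp
qed

lemma deals_balance:
  assumes d1: "dealt_within Y0 Y1"
    and d2: "dealt_across Y1 Y2"
    and f: "upward le f"
    and clean: "\<And>a. a < q \<Longrightarrow> a \<notin> S \<Longrightarrow>
      (\<forall>b<q. cnt f L (Y0 (a * q + b)) = 0) \<or> (\<forall>b<q. cnt f L (Y0 (a * q + b)) = L)"
    and S: "finite S"
  obtains d where "\<And>p. p < q * q \<Longrightarrow> d \<le> cnt f L (Y2 p) \<and> cnt f L (Y2 p) \<le> d + 2 * card S"
proof -
  have k: "L = q * (32 * q)" using L by simp
  show thesis
  proof (rule two_deals_balance[OF q, of L "32 * q" "\<lambda>a b. cnt f L (Y0 (a * q + b))"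
        "\<lambda>a b. cnt f L (Y1 (a * q + b))" "\<lambda>a b. cnt f L (Y2 (a * q + b))" S,
        OF k cnt_le cnt_deal_within[OF d1 f] cnt_le cnt_deal_across[OF d2 f] clean S])
    fix d
    assume d: "\<And>a b. a < q \<Longrightarrow> b < q \<Longrightarrow>
      d \<le> cnt f L (Y2 (a * q + b)) \<and> cnt f L (Y2 (a * q + b)) \<le> d + 2 * card S"
    show thesis
    proof (rule that[of d])
      fix p assume "p < q * q"
      then have "p div q < q" "p mod q < q" using q by (auto simp: less_mult_imp_div_less)
      from d[OF this] show "d \<le> cnt f L (Y2 p) \<and> cnt f L (Y2 p) \<le> d + 2 * card S" by simp
    qed
  qed
qed

theorem six_deals_near_sorted:
  assumes d1: "dealt_within Y0 Y1"
    and d2: "dealt_across Y1 Y2"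
    and d3: "relaid Y2 Y3"
    and d4: "dealt_within Y3 Y4"
    and d5: "dealt_across Y4 Y5"
    and d6: "relaid Y5 Y6"
    and f: "upward le f"
  shows "near_sorted (q * q) L (\<lambda>r. cnt f L (Y6 r))"
proof -
  obtain d where d: "\<And>p. p < q * q \<Longrightarrow> d \<le> cnt f L (Y2 p) \<and> cnt f L (Y2 p) \<le> d + 2 * card {..<q}"
    by (rule deals_balance[OF d1 d2 f, of "{..<q}"]) auto
  \<comment> \<open>All columns from \<open>L - d\<close> on are ones and all before
    \<open>L - d - 2 * q\<close> are zeros. A group of rows receives \<open>32 * q\<close>
    consecutive columns, and \<open>a1\<close> is the group that would contain column
    \<open>L - d\<close>; the mixed columns reach back at most into the group before it.\<close>
  define a1 where "a1 = (L - d) div (32 * q)"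
  have "(\<forall>b<q. cnt f L (Y3 (a * q + b)) = 0) \<or> (\<forall>b<q. cnt f L (Y3 (a * q + b)) = L)"
    if a: "a < q" "a \<notin> {a1 - 1, a1}" for a
  proof (cases "a1 < a")
    case True
    have "L - d < 32 * q * (a1 + 1)"
      unfolding a1_def using q dividend_less_times_div[of "32 * q" "L - d"] by simp
    also have "\<dots> \<le> 32 * q * a" using True by (intro mult_le_mono2) simp
    finally have "L \<le> d + 32 * (a * q + b)" for b by (simp add: algebra_simps)
    then have "\<forall>b<q. cnt f L (Y3 (a * q + b)) = L"
      using d a(1) by (intro allI impI relayout_full[OF d3 f, of _ d] pair_less) auto
    then show ?thesis ..
  next
    case False
    then have "a + 2 \<le> a1" using a(2) by auto
    then have "32 * q * (a + 2) \<le> 32 * q * a1" by (rule mult_le_mono2)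
    also have "\<dots> \<le> L - d" unfolding a1_def by (rule times_div_less_eq_dividend)
    finally have *: "32 * (a * q) + 64 * q \<le> L - d" by (simp add: algebra_simps)
    have "32 * (a * q + b) + 32 + (d + 2 * card {..<q}) \<le> L" if "b < q" for b
      using * that q by simp
    then have "\<forall>b<q. cnt f L (Y3 (a * q + b)) = 0"
      using d a(1) by (intro allI impI relayout_empty[OF d3 f, of _ "d + 2 * card {..<q}"] pair_less) auto
    then show ?thesis ..
  qed
  then obtain e where e: "\<And>p. p < q * q \<Longrightarrow>
      e \<le> cnt f L (Y5 p) \<and> cnt f L (Y5 p) \<le> e + 2 * card {a1 - 1, a1}"
    by (rule deals_balance[OF d4 d5 f, of "{a1 - 1, a1}"]) blast+
  have "card {a1 - 1, a1} \<le> 2" by (simp add: card_insert_if)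
  then have e: "e \<le> cnt f L (Y5 p)" "cnt f L (Y5 p) \<le> e + 4" if "p < q * q" for p
    using e[OF that] by auto
  have "cnt f L (Y6 r) = 0 \<or> cnt f L (Y6 r') = L \<or>
      (r' = Suc r \<and> 2 * cnt f L (Y6 r) \<le> L \<and> L \<le> 2 * cnt f L (Y6 r'))"
    if r: "r < r'" "r' < q * q" for r r'
  proof -
    have "r < q * q" using r by simp
    have 1: "L < 32 * r + 32 + (e + 4)" if "cnt f L (Y6 r) \<noteq> 0"
      using relayout_empty[OF d6 f \<open>r < q * q\<close> e(2)] that by (meson not_le)
    have 2: "e + 32 * r' < L" if "cnt f L (Y6 r') \<noteq> L"
      using relayout_full[OF d6 f r(2) e(1)] that by (meson not_le)
    have "r' = Suc r \<and> 2 * cnt f L (Y6 r) \<le> L \<and> L \<le> 2 * cnt f L (Y6 r')"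
      if "cnt f L (Y6 r) \<noteq> 0" "cnt f L (Y6 r') \<noteq> L"
    proof -
      \<comment> \<open>The mixed columns lie between \<open>L - e - 4\<close> and
        \<open>L - e\<close>. By 1 and 2 this window ends beyond \<open>32 * r'\<close> but starts
        before \<open>32 * r + 32\<close>, so it straddles the boundary of two adjacent rows. Row
        \<open>r\<close> then has ones in at most 4 of its columns, and row \<open>r'\<close> zeros
        in at most 4.\<close>
      have r': "r' = Suc r" using 1 2 that r(1) by linarith
      have "2 * cnt f L (Y6 r) \<le> L"
        by (rule relayout_few[OF d6 f \<open>r < q * q\<close> e(2)]) (use 2 that r' in simp_all)
      moreover have "L \<le> 2 * cnt f L (Y6 r')"
        by (rule relayout_many[OF d6 f r(2) e(1)]) (use 1 that r' in simp_all)
      ultimately show ?thesis using r' by simp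
    qed
    then show ?thesis by blast
  qed
  then show ?thesis unfolding near_sorted_def by blast
qed

end

text \<open>
  The rows \<open>X'\<close> are the sorted rows shifted by half a row.  The second half of the last row of \<open>X\<close> is
  left out, since it holds nothing but padding (\<open>none\<close> in the proof of \<open>merged_prefix\<close>).
\<close>
definition shift_merge :: "nat \<Rightarrow> nat \<Rightarrow> (nat \<Rightarrow> nat \<Rightarrow> 'c) \<Rightarrow> (nat \<Rightarrow> nat \<Rightarrow> 'c) \<Rightarrow> nat \<Rightarrow> 'c" where
  "shift_merge L W X X' k = (if k < W then X 0 k else X' ((k - W) div L) ((k - W) mod L))"

section \<open>Sorting the rest by rows shifted by half a row\<close>

context
  fixes le :: "'c \<Rightarrow> 'c \<Rightarrow> bool" and L N W :: nat and X X' :: "nat \<Rightarrow> nat \<Rightarrow> 'c"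
  assumes N: "0 < N" and L: "L = 32 * N" and W: "W = 16 * N"
    and X: "\<And>p. p < N \<Longrightarrow> row_sorted le L (X p)"
    and near: "\<And>f. upward le f \<Longrightarrow> near_sorted N L (\<lambda>p. cnt f L (X p))"
    and X': "\<And>p. Suc p < N \<Longrightarrow> row_sorted le L (X' p) \<and>
      row_mset L (X' p) = row_mset L (\<lambda>t. if t < W then X p (W + t) else X (Suc p) (t - W))"
begin

abbreviation merged where "merged \<equiv> shift_merge L W X X'"

lemma half: "L = W + W" "0 < W"
  using N L W by auto

lemma sum_halves: "(\<Sum>t<L. g t) = (\<Sum>t<W. g t) + (\<Sum>t<W. g (W + t :: nat) :: 'm :: comm_monoid_add)"
proof -
  have "(\<Sum>t<L. g t) = sum g {0..<W} + sum g {W..<W + W}"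
    using half by (simp add: lessThan_atLeast0 sum.atLeastLessThan_concat)
  also have "sum g {W..<W + W} = (\<Sum>t<W. g (W + t))"
    using sum.shift_bounds_nat_ivl[of g 0 W W] by (simp add: lessThan_atLeast0 add.commute)
  finally show ?thesis by (simp add: lessThan_atLeast0)
qed

lemma row_mset_shifted:
  "row_mset L (\<lambda>t. if t < W then X p (W + t) else X (Suc p) (t - W)) =
   (\<Sum>t<W. {#X p (W + t)#}) + row_mset W (X (Suc p))"
  unfolding row_mset_def sum_halves by simp

lemma row_mset_halves: "row_mset L x = row_mset W x + (\<Sum>t<W. {#x (W + t)#})"
  unfolding row_mset_def sum_halves by simp

lemma cnt_lower_half:
  assumes "p < N" "upward le f"
  shows "cnt f W (X p) = cnt f L (X p) - W"
proof -
  have "{t. t < W \<and> f (X p t)} = {L - cnt f L (X p)..<W}"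
    using row_sorted_upward[OF X[OF assms(1)] assms(2)] half by auto
  then have "cnt f W (X p) = W - (L - cnt f L (X p))" by (simp add: cnt_def)
  then show ?thesis using half cnt_le[of f L "X p"] by simp
qed

text \<open>Ones fill a sorted row from the right: the second half of row \<open>p\<close> takes as
  many as fit, and the first half of the next row only what exceeds \<open>W\<close>.\<close>

lemma cnt_shifted:
  assumes "Suc p < N" "upward le f"
  shows "cnt f L (X' p) = min (cnt f L (X p)) W + (cnt f L (X (Suc p)) - W)"
proof -
  have "cnt f L (X' p) = size (filter_mset f (\<Sum>t<W. {#X p (W + t)#})) + cnt f W (X (Suc p))"
    using X'[OF assms(1)] by (simp add: cnt_row_mset row_mset_shifted)
  moreover have "cnt f L (X p) = cnt f W (X p) + size (filter_mset f (\<Sum>t<W. {#X p (W + t)#}))"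
    by (simp add: cnt_row_mset row_mset_halves)
  ultimately show ?thesis
    using cnt_lower_half[OF _ assms(2), of p] cnt_lower_half[OF assms] assms(1) by simp
qed

text \<open>Within a run the rows are sorted, so only the seams between runs matter. A one just
  before a seam forces enough ones in the adjacent rows, by near-sortedness, for the whole next
  shifted row to consist of ones.\<close>

lemma merged_step:
  assumes f: "upward le f" and k: "Suc k < N * L - W" and fk: "f (merged k)"
  shows "f (merged (Suc k))"
proof -
  let ?c = "\<lambda>p. cnt f L (X p)"
  have near': "?c r = 0 \<or> ?c r' = L \<or> (r' = Suc r \<and> ?c r \<le> W \<and> W \<le> ?c r')"
    if "r < r'" "r' < N" for r r'
  proof -
    have "?c r = 0 \<or> ?c r' = L \<or> (r' = Suc r \<and> 2 * ?c r \<le> L \<and> L \<le> 2 * ?c r')"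
      using near[OF f] that unfolding near_sorted_def by blast
    then show ?thesis using half by linarith
  qed
  have NL: "N * L - W = W + (N - 1) * L"
    using half N by (cases N) auto
  consider (a) "Suc k < W" | (b) "Suc k = W" | (c) "W \<le> k" by linarith
  then show ?thesis
  proof cases
    case a
    then have "le (X 0 k) (X 0 (Suc k))" using X[of 0] N half by (simp add: row_sorted_def)
    then show ?thesis using f fk a by (simp add: shift_merge_def upward_def)
  next
    case b
    then have "1 < N" using k NL by (cases "N = 1") (use N in auto)
    have "W < ?c 0"
      using fk b row_sorted_upward[OF X f, of 0 k] N half by (simp add: shift_merge_def)
    then have "?c 1 = L" using near'[of 0 1] \<open>1 < N\<close> by auto
    then have "cnt f L (X' 0) = L"
      using cnt_shifted[OF _ f, of 0] \<open>1 < N\<close> \<open>W < ?c 0\<close> half by simp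
    then have "f (X' 0 0)"
      using row_sorted_upward[of le L "X' 0" f 0] X'[of 0] f \<open>1 < N\<close> half by simp
    then show ?thesis using b by (simp add: shift_merge_def)
  next
    case c
    define i where "i = k - W"
    have i: "Suc i < (N - 1) * L" using k c NL by (simp add: i_def)
    have m: "merged k = X' (i div L) (i mod L)" "merged (Suc k) = X' (Suc i div L) (Suc i mod L)"
      using c by (simp_all add: shift_merge_def i_def Suc_diff_le)
    show ?thesis
    proof (cases "Suc (i mod L) = L")
      case False
      have p: "Suc (i div L) < N" using less_mult_imp_div_less[of i "N - 1" L] i by simp
      have "i mod L < L" using half by simp
      then have "Suc i div L = i div L" "Suc i mod L = Suc (i mod L)"
        using False by (simp_all add: div_Suc mod_Suc)
      then show ?thesis
        using X'[OF p] f fk False \<open>i mod L < L\<close> unfolding m row_sorted_def upward_def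
        by (metis Suc_lessI le_Suc_eq order_refl)
    next
      case True
      define p where "p = i div L"
      have nxt: "Suc i div L = Suc p" "Suc i mod L = 0"
        using True by (simp_all add: div_Suc mod_Suc p_def)
      have p: "Suc (Suc p) < N"
        using i less_mult_imp_div_less[of "Suc i" "N - 1" L] nxt(1) by simp
      have "i mod L = L - 1" using True by linarith
      then have "f (X' p (L - 1))" using fk by (simp only: m(1) p_def)
      then have "0 < cnt f L (X' p)"
        using half by (auto simp: cnt_def card_gt_0_iff intro!: exI[of _ "L - 1"])
      then have "0 < ?c p \<or> W < ?c (Suc p)"
        using cnt_shifted[OF _ f, of p] p by auto
      then have "?c (Suc (Suc p)) = L \<and> W \<le> ?c (Suc p)"
        using near'[of p "Suc (Suc p)"] near'[of p "Suc p"] near'[of "Suc p" "Suc (Suc p)"] p half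
        by auto
      then have "cnt f L (X' (Suc p)) = L"
        using cnt_shifted[OF p f] half by simp
      then have "f (X' (Suc p) 0)"
        using row_sorted_upward[of le L "X' (Suc p)" f 0] X'[OF p] f half by simp
      then show ?thesis by (simp add: m(2) nxt)
    qed
  qed
qed

lemma merged_upward:
  assumes "upward le f" "k \<le> k'" "k' < N * L - W" "f (merged k)"
  shows "f (merged k')"
  using assms(2,3)
proof (induction rule: dec_induct)
  case (step n)
  then show ?case using merged_step[OF assms(1)] by simp
qed (simp add: assms(4))

lemma merged_sorted:
  assumes "reflp le" "transp le"
  shows "row_sorted le (N * L - W) merged"
  unfolding row_sorted_def
proof (intro allI impI)
  fix k k' assume "k \<le> k'" "k' < N * L - W"
  \<comment> \<open>The 0-1 principle in reverse: the threshold \<open>le (merged k)\<close> holds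
    at \<open>k\<close> by reflexivity and hence at every later position.\<close>
  moreover have "upward le (le (merged k))" using assms(2) by (auto simp: upward_def dest: transpD)
  ultimately show "le (merged k) (merged k')"
    using merged_upward[of "le (merged k)" k k'] assms(1) by (auto dest: reflpD)
qed

lemma merged_mset:
  "row_mset (N * L - W) merged + (\<Sum>t<W. {#X (N - 1) (W + t)#}) = (\<Sum>p<N. row_mset L (X p))"
proof -
  obtain n where n: "N = Suc n" using N by (cases N) auto
  have NL: "N * L - W = W + n * L" using half n by simp
  have "row_mset (W + n * L) merged =
      sum (\<lambda>k. {#merged k#}) {0..<W} + sum (\<lambda>k. {#merged k#}) {W..<W + n * L}"
    by (simp add: row_mset_def lessThan_atLeast0 sum.atLeastLessThan_concat)
  also have "sum (\<lambda>k. {#merged k#}) {0..<W} = row_mset W (X 0)"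
    by (simp add: row_mset_def lessThan_atLeast0 shift_merge_def)
  also have "sum (\<lambda>k. {#merged k#}) {W..<W + n * L} = (\<Sum>k<n * L. {#X' (k div L) (k mod L)#})"
    using sum.shift_bounds_nat_ivl[of "\<lambda>k. {#merged k#}" 0 W "n * L"]
    by (simp add: lessThan_atLeast0 shift_merge_def add.commute)
  also have "\<dots> = (\<Sum>p<n. \<Sum>k\<in>{p * L..<p * L + L}. {#X' (k div L) (k mod L)#})"
    by (rule sum.nat_group[symmetric])
  also have "\<dots> = (\<Sum>p<n. row_mset L (X' p))"
  proof (rule sum.cong[OF refl])
    fix p
    have "(\<Sum>k\<in>{p * L..<p * L + L}. {#X' (k div L) (k mod L)#}) =
        (\<Sum>t\<in>{0..<L}. {#X' ((t + p * L) div L) ((t + p * L) mod L)#})"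
      using sum.shift_bounds_nat_ivl[of "\<lambda>k. {#X' (k div L) (k mod L)#}" 0 "p * L" L]
      by (simp add: add.commute)
    also have "\<dots> = row_mset L (X' p)"
      by (simp add: row_mset_def lessThan_atLeast0)
    finally show "(\<Sum>k\<in>{p * L..<p * L + L}. {#X' (k div L) (k mod L)#}) = row_mset L (X' p)" .
  qed
  also have "\<dots> = (\<Sum>p<n. (\<Sum>t<W. {#X p (W + t)#}) + row_mset W (X (Suc p)))"
    using X' n by (intro sum.cong refl) (simp add: row_mset_shifted)
  finally have "row_mset (N * L - W) merged = row_mset W (X 0) +
      (\<Sum>p<n. (\<Sum>t<W. {#X p (W + t)#}) + row_mset W (X (Suc p)))"
    unfolding NL .
  moreover have "(\<Sum>p<N. row_mset L (X p)) =
      (\<Sum>p<Suc n. row_mset W (X p)) + (\<Sum>p<Suc n. \<Sum>t<W. {#X p (W + t)#})"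
    unfolding row_mset_halves n by (rule sum.distrib)
  moreover have "(\<Sum>p<Suc n. row_mset W (X p)) = row_mset W (X 0) + (\<Sum>p<n. row_mset W (X (Suc p)))"
    by (rule sum.lessThan_Suc_shift)
  ultimately show ?thesis by (simp add: sum.distrib n)
qed

text \<open>Padding is the top of the order, so being padding is itself a threshold. A real item in
  the second half of the last row would leave that row less than half padding; near-sortedness then
  makes all earlier rows entirely real, which is too many items for \<open>K < N * W\<close>. So the
  part omitted from \<open>merged\<close> holds only padding, and the real items form its
  prefix.\<close>

theorem merged_prefix:
  assumes g: "upward le (\<lambda>x. \<not> real_item x)"
    and K: "size (filter_mset real_item (\<Sum>p<N. row_mset L (X p))) = K" "K < N * W"
  shows "row_mset K merged = filter_mset real_item (\<Sum>p<N. row_mset L (X p))"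
    and "\<And>k. k < K \<Longrightarrow> real_item (merged k)"
proof -
  let ?c = "\<lambda>p. cnt (\<lambda>x. \<not> real_item x) L (X p)" and ?n = "N * L - W"
  have items: "size (filter_mset real_item (row_mset L x)) = L - cnt (\<lambda>x. \<not> real_item x) L x" for x
  proof -
    have "size (row_mset L x) = L" by (simp add: row_mset_def size_multiset_sum)
    moreover have "size (filter_mset real_item M) + size (filter_mset (\<lambda>x. \<not> real_item x) M) = size M" for M
      by (metis multiset_partition size_union)
    ultimately show ?thesis by (metis cnt_row_mset add_diff_cancel_right')
  qed
  have none: "\<not> real_item (X (N - 1) (W + t))" if t: "t < W" for t
  proof
    assume "real_item (X (N - 1) (W + t))"
    then have "\<not> L - ?c (N - 1) \<le> W + t"
      using row_sorted_upward[OF X g, of "N - 1" "W + t"] N half t by auto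
    then have c: "?c (N - 1) < W" using half by linarith
    have 0: "?c r = 0" if "Suc r < N" for r
    proof -
      have "?c r = 0 \<or> ?c (N - 1) = L \<or>
          (N - 1 = Suc r \<and> 2 * ?c r \<le> L \<and> L \<le> 2 * ?c (N - 1))"
        using near[OF g] that unfolding near_sorted_def by simp
      then show ?thesis using c half by auto
    qed
    obtain n where n: "N = Suc n" using N by (cases N) auto
    have "K = (\<Sum>p<N. L - ?c p)"
    proof -
      have "filter_mset real_item (\<Sum>p\<in>A. row_mset L (X p)) = (\<Sum>p\<in>A. filter_mset real_item (row_mset L (X p)))"
        if "finite A" for A :: "nat set"
        using that by (induction A rule: finite_induct) auto
      then show ?thesis using K(1) by (simp add: items size_multiset_sum)
    qed
    also have "\<dots> \<ge> n * L + W"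
      using 0 c half by (simp add: n)
    finally have "n * L + W \<le> K" .
    then show False using K(2) half n by (simp add: algebra_simps)
  qed
  have eq: "filter_mset real_item (row_mset ?n merged) = filter_mset real_item (\<Sum>p<N. row_mset L (X p))"
  proof -
    have "filter_mset real_item (\<Sum>t\<in>A. {#X (N - 1) (W + t)#}) = {#}" if "finite A" "A \<subseteq> {..<W}" for A
      using that none by (induction A rule: finite_induct) auto
    then have "filter_mset real_item (\<Sum>t<W. {#X (N - 1) (W + t)#}) = {#}" by blast
    then show ?thesis using arg_cong[OF merged_mset, of "filter_mset real_item"]
      by (simp only: filter_union_mset add_0_right)
  qed
  have "cnt real_item ?n merged = K" using eq K(1) by (simp add: cnt_row_mset)
  then have cntn: "cnt (\<lambda>x. \<not> real_item x) ?n merged = ?n - K" and "K \<le> ?n"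
  proof -
    assume *: "cnt real_item ?n merged = K"
    have "{k. k < ?n \<and> \<not> real_item (merged k)} = {..<?n} - {k. k < ?n \<and> real_item (merged k)}" by auto
    moreover have "card \<dots> = ?n - K" using * by (subst card_Diff_subset) (auto simp: cnt_def)
    ultimately show "cnt (\<lambda>x. \<not> real_item x) ?n merged = ?n - K" by (simp add: cnt_def)
    show "K \<le> ?n" using * cnt_le by metis
  qed
  have iff: "\<not> real_item (merged k) \<longleftrightarrow> K \<le> k" if "k < ?n" for k
  proof -
    have "\<not> real_item (merged k) \<longleftrightarrow> ?n - card {k. k < ?n \<and> \<not> real_item (merged k)} \<le> k"
      by (rule upper_set_eq[OF _ that]) (use merged_upward[OF g] in auto)
    also have "card {k. k < ?n \<and> \<not> real_item (merged k)} = ?n - K" using cntn by (simp only: cnt_def)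
    also have "?n - (?n - K) = K" using \<open>K \<le> ?n\<close> by (rule diff_diff_cancel)
    finally show ?thesis .
  qed
  then show "real_item (merged k)" if "k < K" for k using iff[of k] that \<open>K \<le> ?n\<close> by linarith
  have "filter_mset real_item (\<Sum>k\<in>A. {#merged k#}) = (\<Sum>k\<in>A \<inter> {..<K}. {#merged k#})"
    if "finite A" "A \<subseteq> {..<?n}" for A
    using that by (induction A rule: finite_induct) (use iff in \<open>auto simp: Int_insert_left\<close>)
  from this[of "{..<?n}"] have "filter_mset real_item (row_mset ?n merged) = row_mset K merged"
    using \<open>K \<le> ?n\<close> by (simp add: row_mset_def Int_absorb1)
  then show "row_mset K merged = filter_mset real_item (\<Sum>p<N. row_mset L (X p))" using eq by simp
qed

end

section \<open>Lockstep execution\<close>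

text \<open>\<open>I\<close> is a property of the input items. As items are only ever copied, it
  holds for every item in memory or registers at all times; counting sort uses it to bound the
  labels it reads.\<close>

locale dmm_machine =
  fixes D :: "'a dmm" and c :: nat and I :: "'a \<Rightarrow> bool"
begin

definition word_bound :: nat where "word_bound = c * (banks D * cols D) ^ c"

fun cell_ok :: "'a cell \<Rightarrow> bool" where
  "cell_ok (Word n) \<longleftrightarrow> n \<le> word_bound"
| "cell_ok (Item x) \<longleftrightarrow> I x"

text \<open>The bank number \<open>a\<close> assigned to a processor may be outside the machine, in
  which case the processor may access nothing.\<close>

definition usable :: "nat \<Rightarrow> nat \<Rightarrow> nat \<Rightarrow> bool" where
  "usable a i j \<longleftrightarrow> i = a \<and> a < banks D \<and> j < c * cols D"

text \<open>
  Weakest precondition of exactly \<open>t\<close> steps of processor \<open>p\<close>, which during these steps may access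
  no bank but \<open>a\<close>, of which \<open>row\<close> is the contents.
\<close>
fun wpp :: "nat \<Rightarrow> nat \<Rightarrow> nat \<Rightarrow> instr list \<Rightarrow> ((nat \<Rightarrow> 'a cell) \<Rightarrow> 'a regs \<Rightarrow> bool) \<Rightarrow>
    (nat \<Rightarrow> 'a cell) \<Rightarrow> 'a regs \<Rightarrow> bool" where
  "wpp p a 0 xs Q row R \<longleftrightarrow> xs = [] \<and> Q row R"
| "wpp p a (Suc t) [] Q row R \<longleftrightarrow> False"
| "wpp p a (Suc t) (Skip # xs) Q row R \<longleftrightarrow> wpp p a t xs Q row R"
| "wpp p a (Suc t) (Assign r e # xs) Q row R \<longleftrightarrow>
     eval D p R e \<le> word_bound \<and> wpp p a t xs Q row (R(r := Word (eval D p R e)))"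
| "wpp p a (Suc t) (Copy r s # xs) Q row R \<longleftrightarrow> wpp p a t xs Q row (R(r := R s))"
| "wpp p a (Suc t) (Read r i j # xs) Q row R \<longleftrightarrow>
     usable a (eval D p R i) (eval D p R j) \<and> wpp p a t xs Q row (R(r := row (eval D p R j)))"
| "wpp p a (Suc t) (Write i j r # xs) Q row R \<longleftrightarrow>
     usable a (eval D p R i) (eval D p R j) \<and> wpp p a t xs Q (row(eval D p R j := R r)) R"
| "wpp p a (Suc t) (Cond b ys zs # xs) Q row R \<longleftrightarrow>
     (holds D p R b \<longrightarrow> wpp p a t (ys @ xs) Q row R) \<and>
     (\<not> holds D p R b \<longrightarrow> wpp p a t (zs @ xs) Q row R)"
| "wpp p a (Suc t) (While b ys # xs) Q row R \<longleftrightarrow>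
     (holds D p R b \<longrightarrow> wpp p a t (ys @ While b ys # xs) Q row R) \<and>
     (\<not> holds D p R b \<longrightarrow> wpp p a t xs Q row R)"

text \<open>With these rules the simplifier executes straight-line code whose step count is a
  numeral.\<close>

lemmas wpp_numeral [simp] = wpp.simps(2-)[where t = "pred_numeral v" for v, folded numeral_eq_Suc]

lemma wpp_mono:
  "wpp p a t xs Q row R \<Longrightarrow> (\<And>row R. Q row R \<Longrightarrow> Q' row R) \<Longrightarrow> wpp p a t xs Q' row R"
  by (induction p a t xs Q row R rule: wpp.induct) auto

lemma wpp_append:
  "wpp p a t xs (wpp p a u ys Q) row R \<Longrightarrow> wpp p a (t + u) (xs @ ys) Q row R"
  by (induction p a t xs "wpp p a u ys Q" row R rule: wpp.induct) auto

lemma wpp_append_cons: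
  "wpp p a t [x] (wpp p a u ys Q) row R \<Longrightarrow> wpp p a (t + u) (x # ys) Q row R"
  using wpp_append[of p a t "[x]"] by simp

text \<open>Each round costs one step for the guard and \<open>t\<close> for the body, and the
  failing guard costs one more. The number of rounds \<open>n\<close> is fixed beforehand, which is
  what keeps all processors in lockstep.\<close>

lemma wpp_while:
  assumes "Inv 0 row R"
    and "\<And>k row R. k < n \<Longrightarrow> Inv k row R \<Longrightarrow> holds D p R b \<and> wpp p a t ys (Inv (Suc k)) row R"
    and "\<And>row R. Inv n row R \<Longrightarrow> \<not> holds D p R b \<and> Q row R"
  shows "wpp p a (n * (t + 1) + 1) [While b ys] Q row R"
proof -
  have "Inv (n - k) row R \<Longrightarrow> k \<le> n \<Longrightarrow> wpp p a (k * (t + 1) + 1) [While b ys] Q row R" for k row R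
  proof (induction k arbitrary: row R)
    case 0
    then show ?case using assms(3) by simp
  next
    case (Suc k)
    have b: "holds D p R b" and body: "wpp p a t ys (Inv (Suc (n - Suc k))) row R"
      using assms(2)[of "n - Suc k"] Suc.prems by auto
    have "wpp p a t ys (wpp p a (k * (t + 1) + 1) [While b ys] Q) row R"
      using body by (rule wpp_mono) (use Suc in \<open>auto simp: Suc_diff_Suc\<close>)
    then have "wpp p a (t + (k * (t + 1) + 1)) (ys @ [While b ys]) Q row R"
      by (rule wpp_append)
    then show ?case using b by (simp add: algebra_simps)
  qed
  from this[of n row R] assms(1) show ?thesis by simp
qed

text \<open>The effect on memory is stated as a replacement of bank \<open>a\<close> even if nothing
  is written, so that the steps of all processors combine uniformly. The trailing code
  \<open>ks\<close> stands for whatever follows the block.\<close>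

lemma wpp_step:
  assumes "wpp p a (Suc t) xs Q row R"
  obtains row' R' xs' where "wpp p a t xs' Q row' R'"
    and "\<And>M ks. M a = row \<Longrightarrow> step_proc D M p (xs @ ks, R) = (xs' @ ks, R')"
    and "\<And>M ks. M a = row \<Longrightarrow> write_proc D p (xs @ ks, R) M = M(a := row')"
    and "\<And>i j ks. accesses D p (xs @ ks, R) = Some (i, j) \<Longrightarrow> usable a i j"
    and "(\<forall>j. cell_ok (row j)) \<Longrightarrow> (\<forall>r. cell_ok (R r)) \<Longrightarrow> (\<forall>j. cell_ok (row' j)) \<and> (\<forall>r. cell_ok (R' r))"
proof (cases xs)
  case Nil
  then show thesis using assms by simp
next
  case (Cons x xs1)
  show thesis
  proof (cases x)
    case Skip
    show thesis by (rule that[of xs1 row R]) (use assms Cons Skip in auto)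
  next
    case (Assign r e)
    show thesis by (rule that[of xs1 row "R(r := Word (eval D p R e))"]) (use assms Cons Assign in auto)
  next
    case (Copy r s)
    show thesis by (rule that[of xs1 row "R(r := R s)"]) (use assms Cons Copy in auto)
  next
    case (Read r i j)
    show thesis by (rule that[of xs1 row "R(r := row (eval D p R j))"])
        (use assms Cons Read in \<open>auto simp: usable_def\<close>)
  next
    case (Write i j r)
    show thesis by (rule that[of xs1 "row(eval D p R j := R r)" R])
        (use assms Cons Write in \<open>auto simp: usable_def Let_def\<close>)
  next
    case (Cond b ys zs)
    show thesis by (rule that[of "(if holds D p R b then ys else zs) @ xs1" row R])
        (use assms Cons Cond in auto)
  next
    case (While b ys)
    show thesis by (rule that[of "if holds D p R b then ys @ While b ys # xs1 else xs1" row R])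
        (use assms Cons While in auto)
  qed
qed

section \<open>All processors together\<close>

definition state_ok :: "'a memory \<Rightarrow> (nat \<Rightarrow> 'a regs) \<Rightarrow> bool" where
  "state_ok M Rs \<longleftrightarrow> (\<forall>i j. cell_ok (M i j)) \<and> (\<forall>p < banks D. \<forall>r. cell_ok (Rs p r))"

text \<open>Nothing is said about processors from \<open>banks D\<close> on: they step as well, but
  their writes never reach the memory.\<close>

definition at_code :: "'a config \<Rightarrow> 'a memory \<Rightarrow> (nat \<Rightarrow> instr list) \<Rightarrow> (nat \<Rightarrow> 'a regs) \<Rightarrow> bool" where
  "at_code C M cs Rs \<longleftrightarrow> fst C = M \<and> (\<forall>p < banks D. snd C p = (cs p, Rs p))"

definition legal :: "'a config \<Rightarrow> bool" where
  "legal C \<longleftrightarrow> conflict_free D C \<and> within_resources c D C"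

lemma legalI:
  assumes "at_code C M cs Rs" "state_ok M Rs" "inj_on \<rho> {..<banks D}"
    and "\<And>p i j. p < banks D \<Longrightarrow> accesses D p (cs p, Rs p) = Some (i, j) \<Longrightarrow> usable (\<rho> p) i j"
  shows "legal C"
proof -
  have C: "fst C = M" "\<And>p. p < banks D \<Longrightarrow> snd C p = (cs p, Rs p)"
    using assms(1) by (auto simp: at_code_def)
  have ok: "cell_ok (M i j)" "p < banks D \<Longrightarrow> cell_ok (Rs p r)" for i j p r
    using assms(2) by (auto simp: state_ok_def)
  have acc: "i = \<rho> p \<and> i < banks D \<and> j < c * cols D"
    if "p < banks D" "accesses D p (snd C p) = Some (i, j)" for p i j
    using assms(4)[OF that(1)] that C(2) by (auto simp: usable_def)
  show ?thesis
    unfolding legal_def conflict_free_def within_resources_def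
  proof (intro conjI allI impI)
    fix p q i j j'
    assume "p < banks D" "q < banks D"
      "accesses D p (snd C p) = Some (i, j) \<and> accesses D q (snd C q) = Some (i, j')"
    then have "p < banks D" "q < banks D" "\<rho> p = \<rho> q"
      using acc[of p i j] acc[of q i j'] by auto
    then show "p = q" using assms(3) by (auto simp: inj_on_def)
  next
    fix p r n assume "p < banks D" "snd (snd C p) r = Word n"
    then show "n \<le> c * (banks D * cols D) ^ c" using ok(2)[of p r] C(2)[of p] by (simp add: word_bound_def)
  next
    fix i j n assume "fst C i j = Word n"
    then show "n \<le> c * (banks D * cols D) ^ c" using ok(1)[of i j] C(1) by (simp add: word_bound_def)
  qed (use acc in auto)
qed

text \<open>Total correctness with exact time: all processors enter and leave the block at the same
  point of the program, and every configuration on the way is legal. Quantifying over the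
  continuation \<open>ks\<close> makes blocks composable.\<close>

definition gwp :: "nat \<Rightarrow> instr list \<Rightarrow> ('a memory \<Rightarrow> (nat \<Rightarrow> 'a regs) \<Rightarrow> bool) \<Rightarrow>
    'a memory \<Rightarrow> (nat \<Rightarrow> 'a regs) \<Rightarrow> bool" where
  "gwp t xs Q M Rs \<longleftrightarrow> (state_ok M Rs \<longrightarrow> (\<forall>ks C. at_code C M (\<lambda>_. xs @ ks) Rs \<longrightarrow>
     (\<forall>s < t. legal ((step D ^^ s) C)) \<and>
     (\<exists>M' Rs'. at_code ((step D ^^ t) C) M' (\<lambda>_. ks) Rs' \<and> state_ok M' Rs' \<and> Q M' Rs')))"

lemma gwp_mono:
  "gwp t xs Q M Rs \<Longrightarrow> (\<And>M Rs. state_ok M Rs \<Longrightarrow> Q M Rs \<Longrightarrow> Q' M Rs) \<Longrightarrow> gwp t xs Q' M Rs"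
  unfolding gwp_def by blast

lemma gwp_ok: "(state_ok M Rs \<Longrightarrow> gwp t xs Q M Rs) \<Longrightarrow> gwp t xs Q M Rs"
  unfolding gwp_def by blast

lemma gwp_Nil: "Q M Rs \<Longrightarrow> gwp 0 [] Q M Rs"
  unfolding gwp_def by auto

lemma gwp_append:
  assumes "gwp t xs (gwp u ys Q) M Rs"
  shows "gwp (t + u) (xs @ ys) Q M Rs"
  unfolding gwp_def
proof (intro impI allI)
  fix ks C
  assume ok: "state_ok M Rs" and C: "at_code C M (\<lambda>_. (xs @ ys) @ ks) Rs"
  from assms ok C obtain M1 R1 where 1: "\<forall>s < t. legal ((step D ^^ s) C)"
    "at_code ((step D ^^ t) C) M1 (\<lambda>_. ys @ ks) R1" "state_ok M1 R1" "gwp u ys Q M1 R1"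
    unfolding gwp_def by (metis append.assoc)
  from 1(2-4) obtain M2 R2 where 2: "\<forall>s < u. legal ((step D ^^ s) ((step D ^^ t) C))"
    "at_code ((step D ^^ u) ((step D ^^ t) C)) M2 (\<lambda>_. ks) R2" "state_ok M2 R2" "Q M2 R2"
    unfolding gwp_def by blast
  have split: "(step D ^^ (t + s)) C = (step D ^^ s) ((step D ^^ t) C)" for s
    by (metis add.commute comp_apply funpow_add)
  have "legal ((step D ^^ s) C)" if "s < t + u" for s
  proof (cases "s < t")
    case False
    then have "(step D ^^ s) C = (step D ^^ (s - t)) ((step D ^^ t) C)"
      using split[of "s - t"] by simp
    then show ?thesis using 2(1) False that by simp
  qed (use 1 in blast)
  then show "(\<forall>s<t + u. legal ((step D ^^ s) C)) \<and>
     (\<exists>M' Rs'. at_code ((step D ^^ (t + u)) C) M' (\<lambda>_. ks) Rs' \<and> state_ok M' Rs' \<and> Q M' Rs')"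
    using 2 split by metis
qed

text \<open>By injectivity of \<open>\<rho>\<close>, the bank of \<open>p\<close> is still as in
  \<open>M\<close> when the write of \<open>p\<close> is folded in. Hence the behaviour of
  \<open>write_proc\<close> is needed only for memories that agree with \<open>M\<close> on that
  bank.\<close>

lemma fold_write:
  assumes "distinct ps" and "inj_on \<rho> (set ps)"
    and "\<And>p M'. p \<in> set ps \<Longrightarrow> M' (\<rho> p) = M (\<rho> p) \<Longrightarrow>
           write_proc D p (C p) M' = M'(\<rho> p := row' p)"
  shows "fold (\<lambda>p. write_proc D p (C p)) ps M i =
    (if \<exists>p \<in> set ps. \<rho> p = i then row' (THE p. p \<in> set ps \<and> \<rho> p = i) else M i)"
  using assms
proof (induction ps arbitrary: i rule: rev_induct)
  case Nil
  then show ?case by simp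
next
  case (snoc p ps)
  let ?M = "fold (\<lambda>p. write_proc D p (C p)) ps M"
  have IH: "?M i = (if \<exists>p \<in> set ps. \<rho> p = i then row' (THE p. p \<in> set ps \<and> \<rho> p = i) else M i)" for i
    using snoc.prems by (intro snoc.IH) (auto simp: inj_on_def)
  have notin: "\<not> (\<exists>p' \<in> set ps. \<rho> p' = \<rho> p)"
    using snoc.prems(1,2) by (auto simp: inj_on_def)
  then have "?M (\<rho> p) = M (\<rho> p)" using IH[of "\<rho> p"] by simp
  then have "write_proc D p (C p) ?M = ?M(\<rho> p := row' p)"
    by (intro snoc.prems(3)) simp_all
  then have eq: "fold (\<lambda>p. write_proc D p (C p)) (ps @ [p]) M = ?M(\<rho> p := row' p)"
    by simp
  show ?case
  proof (cases "i = \<rho> p")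
    case True
    have "(THE p'. p' \<in> set (ps @ [p]) \<and> \<rho> p' = i) = p"
      using True snoc.prems(2) by (auto simp: inj_on_def)
    then show ?thesis using True eq by auto
  next
    case False
    have "(p' \<in> set (ps @ [p]) \<and> \<rho> p' = i) \<longleftrightarrow> (p' \<in> set ps \<and> \<rho> p' = i)" for p'
      using False by auto
    then show ?thesis using False IH[of i] eq by simp
  qed
qed

text \<open>The bridge from single processors to the machine. Branching lets the remaining codes
  \<open>cs p\<close> diverge in the middle of a block, but the common step count \<open>t\<close>
  brings all processors back to \<open>ks\<close> simultaneously. Disjoint banks give freedom from
  conflicts and independence of the local runs.\<close>

lemma gwp_lift_codes:
  assumes inj: "inj_on \<rho> {..<banks D}"
    and "\<forall>p < banks D. wpp p (\<rho> p) t (cs p) (Q p) (M (\<rho> p)) (Rs p)"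
    and "state_ok M Rs" and "at_code C M (\<lambda>p. cs p @ ks) Rs"
  shows "(\<forall>s < t. legal ((step D ^^ s) C)) \<and>
     (\<exists>M' Rs'. at_code ((step D ^^ t) C) M' (\<lambda>_. ks) Rs' \<and> state_ok M' Rs' \<and>
        (\<forall>p < banks D. Q p (M' (\<rho> p)) (Rs' p)) \<and> (\<forall>i. i \<notin> \<rho> ` {..<banks D} \<longrightarrow> M' i = M i))"
  using assms(2-)
proof (induction t arbitrary: cs M Rs C)
  case 0
  then show ?case by (auto simp: at_code_def intro!: exI[of _ M] exI[of _ Rs])
next
  case (Suc t)
  define G where "G p row' R' xs' \<longleftrightarrow> wpp p (\<rho> p) t xs' (Q p) row' R' \<and>
      (\<forall>M' ks. M' (\<rho> p) = M (\<rho> p) \<longrightarrow> step_proc D M' p (cs p @ ks, Rs p) = (xs' @ ks, R')) \<and>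
      (\<forall>M' ks. M' (\<rho> p) = M (\<rho> p) \<longrightarrow> write_proc D p (cs p @ ks, Rs p) M' = M'(\<rho> p := row')) \<and>
      (\<forall>i j ks. accesses D p (cs p @ ks, Rs p) = Some (i, j) \<longrightarrow> usable (\<rho> p) i j) \<and>
      (\<forall>j. cell_ok (row' j)) \<and> (\<forall>r. cell_ok (R' r))" for p row' R' xs'
  have "\<exists>row' R' xs'. G p row' R' xs'" if "p < banks D" for p
  proof -
    have w: "wpp p (\<rho> p) (Suc t) (cs p) (Q p) (M (\<rho> p)) (Rs p)" using Suc.prems(1) that by blast
    have ok: "(\<forall>j. cell_ok (M (\<rho> p) j)) \<and> (\<forall>r. cell_ok (Rs p r))"
      using Suc.prems(2) that unfolding state_ok_def by blast
    show ?thesis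
    proof (rule wpp_step[OF w])
      fix row' R' xs'
      assume "wpp p (\<rho> p) t xs' (Q p) row' R'"
        "\<And>M' ks. M' (\<rho> p) = M (\<rho> p) \<Longrightarrow> step_proc D M' p (cs p @ ks, Rs p) = (xs' @ ks, R')"
        "\<And>M' ks. M' (\<rho> p) = M (\<rho> p) \<Longrightarrow> write_proc D p (cs p @ ks, Rs p) M' = M'(\<rho> p := row')"
        "\<And>i j ks. accesses D p (cs p @ ks, Rs p) = Some (i, j) \<Longrightarrow> usable (\<rho> p) i j"
        "\<forall>j. cell_ok (M (\<rho> p) j) \<Longrightarrow> \<forall>r. cell_ok (Rs p r) \<Longrightarrow>
          (\<forall>j. cell_ok (row' j)) \<and> (\<forall>r. cell_ok (R' r))"
      then have "G p row' R' xs'" using ok unfolding G_def by simp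
      then show ?thesis by blast
    qed
  qed
  then obtain row' R' xs' where G: "\<And>p. p < banks D \<Longrightarrow> G p (row' p) (R' p) (xs' p)"
    by metis
  then have
    w: "\<And>p. p < banks D \<Longrightarrow> wpp p (\<rho> p) t (xs' p) (Q p) (row' p) (R' p)" and
    st: "\<And>p M' ks. p < banks D \<Longrightarrow> M' (\<rho> p) = M (\<rho> p) \<Longrightarrow>
        step_proc D M' p (cs p @ ks, Rs p) = (xs' p @ ks, R' p)" and
    wr: "\<And>p M' ks. p < banks D \<Longrightarrow> M' (\<rho> p) = M (\<rho> p) \<Longrightarrow>
        write_proc D p (cs p @ ks, Rs p) M' = M'(\<rho> p := row' p)" and
    ac: "\<And>p i j ks. p < banks D \<Longrightarrow> accesses D p (cs p @ ks, Rs p) = Some (i, j) \<Longrightarrow>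
        usable (\<rho> p) i j" and
    ok: "\<And>p j. p < banks D \<Longrightarrow> cell_ok (row' p j)" "\<And>p r. p < banks D \<Longrightarrow> cell_ok (R' p r)"
    unfolding G_def by blast+
  define M1 where "M1 = fst (step D C)"
  have C: "fst C = M" "\<And>p. p < banks D \<Longrightarrow> snd C p = (cs p @ ks, Rs p)"
    using Suc.prems(3) by (auto simp: at_code_def)
  have M1: "M1 i = (if \<exists>p \<in> set [0..<banks D]. \<rho> p = i
      then row' (THE p. p \<in> set [0..<banks D] \<and> \<rho> p = i) else M i)" for i
    unfolding M1_def step_def fst_conv C(1)
    by (rule fold_write) (use inj C wr in \<open>auto simp: lessThan_atLeast0\<close>)
  have M1_in: "M1 (\<rho> p) = row' p" if "p < banks D" for p
  proof -
    have "(THE p'. p' \<in> set [0..<banks D] \<and> \<rho> p' = \<rho> p) = p"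
      using that inj by (auto simp: inj_on_def)
    then show ?thesis using M1[of "\<rho> p"] that by auto
  qed
  have M1_out: "M1 i = M i" if "i \<notin> \<rho> ` {..<banks D}" for i
    using M1[of i] that by auto
  have ok1: "state_ok M1 R'"
    unfolding state_ok_def
  proof (intro conjI allI impI)
    fix i j show "cell_ok (M1 i j)"
    proof (cases "i \<in> \<rho> ` {..<banks D}")
      case True
      then show ?thesis using M1_in ok by auto
    next
      case False
      then show ?thesis using M1_out Suc.prems(2) by (simp add: state_ok_def)
    qed
  qed (use ok in auto)
  have at1: "at_code (step D C) M1 (\<lambda>p. xs' p @ ks) R'"
    unfolding at_code_def M1_def using C st by (simp add: step_def)
  have leg: "legal C"
    using Suc.prems(2,3) inj ac by (intro legalI) auto
  have "\<forall>p<banks D. wpp p (\<rho> p) t (xs' p) (Q p) (M1 (\<rho> p)) (R' p)"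
    using w M1_in by simp
  from Suc.IH[OF this ok1 at1] obtain M' Rs' where
    1: "\<forall>s < t. legal ((step D ^^ s) (step D C))"
    "at_code ((step D ^^ t) (step D C)) M' (\<lambda>_. ks) Rs'" "state_ok M' Rs'"
    "\<forall>p < banks D. Q p (M' (\<rho> p)) (Rs' p)" "\<forall>i. i \<notin> \<rho> ` {..<banks D} \<longrightarrow> M' i = M1 i"
    by blast
  have shift: "(step D ^^ Suc s) C = (step D ^^ s) (step D C)" for s
    by (metis comp_apply funpow_Suc_right)
  have "legal ((step D ^^ s) C)" if "s < Suc t" for s
  proof (cases s)
    case (Suc s')
    then show ?thesis using that 1(1) shift[of s'] by auto
  qed (use leg in simp)
  then show ?case using 1 M1_out unfolding shift by metis
qed

lemma gwp_lift:
  assumes "inj_on \<rho> {..<banks D}"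
    and "\<And>p. p < banks D \<Longrightarrow> wpp p (\<rho> p) t xs (Q p) (M (\<rho> p)) (Rs p)"
    and "\<And>M' Rs'. state_ok M' Rs' \<Longrightarrow> (\<And>p. p < banks D \<Longrightarrow> Q p (M' (\<rho> p)) (Rs' p)) \<Longrightarrow>
      (\<And>i. i \<notin> \<rho> ` {..<banks D} \<Longrightarrow> M' i = M i) \<Longrightarrow> QQ M' Rs'"
  shows "gwp t xs QQ M Rs"
  unfolding gwp_def
proof (intro impI allI)
  fix ks C
  assume ok: "state_ok M Rs" and C: "at_code C M (\<lambda>_. xs @ ks) Rs"
  have "\<forall>p<banks D. wpp p (\<rho> p) t xs (Q p) (M (\<rho> p)) (Rs p)" using assms(2) by blast
  from gwp_lift_codes[OF assms(1) this ok C] assms(3)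
  show "(\<forall>s<t. legal ((step D ^^ s) C)) \<and>
     (\<exists>M' Rs'. at_code ((step D ^^ t) C) M' (\<lambda>_. ks) Rs' \<and> state_ok M' Rs' \<and> QQ M' Rs')"
    by metis
qed

lemmas gwp_local = gwp_lift[of "\<lambda>p. p", simplified]


text \<open>A loop that communicates cannot be treated by \<open>wpp_while\<close>, since the
  assignment of banks to processors changes within its body. It is unrolled globally instead, which
  requires the guard to have the same value for all processors.\<close>

lemma gwp_while_step:
  assumes "\<forall>p < banks D. holds D p (Rs p) b = v"
    and "gwp u (if v then ys @ [While b ys] else []) Q M Rs"
  shows "gwp (Suc u) [While b ys] Q M Rs"
  unfolding gwp_def
proof (intro impI allI)
  fix ks C
  let ?zs = "if v then ys @ [While b ys] else []"
  assume ok: "state_ok M Rs" and C: "at_code C M (\<lambda>_. [While b ys] @ ks) Rs"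
  have acc: "write_proc D p (snd C p) M' = M'" "accesses D p (snd C p) = None" if "p < banks D" for p M'
    using C that by (auto simp: at_code_def)
  have "fold (\<lambda>p. write_proc D p (snd C p)) ps M = M" if "set ps \<subseteq> {..<banks D}" for ps
    using that by (induction ps) (auto simp: acc)
  from this[of "[0..<banks D]"] have at: "at_code (step D C) M (\<lambda>_. ?zs @ ks) Rs"
    using C assms(1) by (auto simp: at_code_def step_def lessThan_atLeast0)
  have leg: "legal C"
    by (rule legalI[OF C ok, of "\<lambda>p. p"]) auto
  from assms(2) ok at obtain M2 R2 where 2: "\<forall>s < u. legal ((step D ^^ s) (step D C))"
    "at_code ((step D ^^ u) (step D C)) M2 (\<lambda>_. ks) R2" "state_ok M2 R2" "Q M2 R2"
    unfolding gwp_def by blast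
  have shift: "(step D ^^ Suc s) C = (step D ^^ s) (step D C)" for s
    by (metis comp_apply funpow_Suc_right)
  have "legal ((step D ^^ s) C)" if "s < Suc u" for s
  proof (cases s)
    case (Suc s')
    then show ?thesis using that 2(1) shift[of s'] by auto
  qed (use leg in simp)
  then show "(\<forall>s<Suc u. legal ((step D ^^ s) C)) \<and>
     (\<exists>M' Rs'. at_code ((step D ^^ Suc u) C) M' (\<lambda>_. ks) Rs' \<and> state_ok M' Rs' \<and> Q M' Rs')"
    using 2 unfolding shift by blast
qed

lemma gwp_while:
  assumes "Inv 0 M Rs"
    and "\<And>k M Rs. k < n \<Longrightarrow> state_ok M Rs \<Longrightarrow> Inv k M Rs \<Longrightarrow>
      (\<forall>p < banks D. holds D p (Rs p) b) \<and> gwp t ys (Inv (Suc k)) M Rs"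
    and "\<And>M Rs. state_ok M Rs \<Longrightarrow> Inv n M Rs \<Longrightarrow> \<forall>p < banks D. \<not> holds D p (Rs p) b"
  shows "gwp (n * (t + 1) + 1) [While b ys] (Inv n) M Rs"
proof -
  have "Inv (n - k) M Rs \<Longrightarrow> k \<le> n \<Longrightarrow> gwp (k * (t + 1) + 1) [While b ys] (Inv n) M Rs" for k M Rs
  proof (induction k arbitrary: M Rs)
    case 0
    show ?case
    proof (rule gwp_ok)
      assume "state_ok M Rs"
      then have b: "\<forall>p < banks D. holds D p (Rs p) b = False" using assms(3) 0 by simp
      have "gwp (Suc 0) [While b ys] (Inv n) M Rs"
        by (rule gwp_while_step[OF b]) (use 0 in \<open>simp add: gwp_Nil\<close>)
      then show "gwp (0 * (t + 1) + 1) [While b ys] (Inv n) M Rs" by simp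
    qed
  next
    case (Suc k)
    show ?case
    proof (rule gwp_ok)
      assume "state_ok M Rs"
      then have b: "\<forall>p < banks D. holds D p (Rs p) b = True" and
        body: "gwp t ys (Inv (Suc (n - Suc k))) M Rs"
        using assms(2)[of "n - Suc k"] Suc.prems by auto
      have "gwp t ys (gwp (k * (t + 1) + 1) [While b ys] (Inv n)) M Rs"
        using body by (rule gwp_mono) (use Suc in \<open>auto simp: Suc_diff_Suc\<close>)
      then have "gwp (t + (k * (t + 1) + 1)) (ys @ [While b ys]) (Inv n) M Rs"
        by (rule gwp_append)
      with gwp_while_step[OF b, of "t + (k * (t + 1) + 1)" ys]
      show "gwp (Suc k * (t + 1) + 1) [While b ys] (Inv n) M Rs" by (simp add: algebra_simps)
    qed
  qed
  from this[of n M Rs] assms(1) show ?thesis by simp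
qed

end

section \<open>Routing\<close>

abbreviation (input) reg_q :: nat where "reg_q \<equiv> 0"
abbreviation (input) reg_N :: nat where "reg_N \<equiv> 1"
abbreviation (input) reg_L :: nat where "reg_L \<equiv> 2"
abbreviation (input) reg_t :: nat where "reg_t \<equiv> 3"
abbreviation (input) reg_v :: nat where "reg_v \<equiv> 4"

definition for_t :: "exp \<Rightarrow> instr list \<Rightarrow> instr list" where
  "for_t n xs = [Assign reg_t (Const 0),
     While (Less (Reg reg_t) n) (xs @ [Assign reg_t (Add (Reg reg_t) (Const 1))])]"

text \<open>The \<open>Skip\<close> gives idle processors the same timing as writing ones. A round
  takes 5 steps including the guard and the increment, whence the total
  \<open>5 * L + 2\<close>.\<close>

definition route :: "test \<Rightarrow> exp \<Rightarrow> exp \<Rightarrow> exp \<Rightarrow> instr list" where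
  "route b g h k = for_t (Reg reg_L) [Read reg_v Proc_Id g, Cond b [Write h k reg_v] [Skip]]"

text \<open>The bound 200 leaves room for every address used, at most \<open>97 * m\<close>, and for
  all words stored, which are linear in \<open>m\<close>; values such as \<open>m * m\<close> occur
  only inside expressions.\<close>

locale dmm_square = dmm_machine D c I for D :: "'a dmm" and c I +
  fixes m n q N L :: nat
  assumes banks [simp]: "banks D = m" and cols [simp]: "cols D = m" and c: "200 \<le> c"
    and q: "q = 2 ^ n" and N: "N = q * q" and L: "L = 32 * N"
    and N_le: "N \<le> m" and less_N: "m < 4 * N"
begin

lemma m_pos: "0 < m" and q_pos: "0 < q" and N_pos: "0 < N" and L_pos: "0 < L"
proof -
  show q_pos: "0 < q" by (simp add: q)
  show N_pos: "0 < N" using q_pos by (simp add: N)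
  show "0 < m" "0 < L" using N_pos N_le L by auto
qed

lemma word_bound_ge: "x \<le> 200 * m \<Longrightarrow> x \<le> word_bound"
proof -
  assume "x \<le> 200 * m"
  also have "200 * m \<le> c * (m * m) ^ c"
  proof (rule mult_le_mono[OF c])
    have "m \<le> m * m" by simp
    also have "\<dots> \<le> (m * m) ^ c" using m_pos c by (intro self_le_power) auto
    finally show "m \<le> (m * m) ^ c" .
  qed
  finally show ?thesis by (simp add: word_bound_def)
qed

lemma usableI: "i = a \<Longrightarrow> a < m \<Longrightarrow> j < 200 * m \<Longrightarrow> usable a i j"
  using mult_le_mono1[OF c, of m] unfolding usable_def banks cols by linarith

definition env :: "'a regs \<Rightarrow> bool" where
  "env R \<longleftrightarrow> R reg_q = Word q \<and> R reg_N = Word N \<and> R reg_L = Word L"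

lemma wpp_for_t:
  assumes "Inv 0 row (R(reg_t := Word 0))"
    and "\<And>k row R. Inv k row R \<Longrightarrow> k \<le> b \<Longrightarrow> R reg_t = Word k \<and> eval D p R e = b"
    and "\<And>k row R. k < b \<Longrightarrow> Inv k row R \<Longrightarrow>
      wpp p a u xs (\<lambda>row R. R reg_t = Word k \<and> Inv (Suc k) row (R(reg_t := Word (Suc k)))) row R"
    and b: "b \<le> 200 * m"
    and "\<And>row R. Inv b row R \<Longrightarrow> Q row R"
  shows "wpp p a (b * (u + 2) + 2) (for_t e xs) Q row R"
proof -
  have "wpp p a (b * ((u + 1) + 1) + 1) [While (Less (Reg reg_t) e)
      (xs @ [Assign reg_t (Add (Reg reg_t) (Const 1))])] Q row (R(reg_t := Word 0))"
  proof (rule wpp_while[where Inv = Inv])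
    fix k row R assume k: "k < b" and inv: "Inv k row R"
    have "wpp p a u xs (wpp p a 1 [Assign reg_t (Add (Reg reg_t) (Const 1))] (Inv (Suc k))) row R"
      by (rule wpp_mono[OF assms(3)[OF k inv]]) (use k b in \<open>auto intro: word_bound_ge\<close>)
    from wpp_append[OF this] assms(2)[OF inv] k
    show "holds D p R (Less (Reg reg_t) e) \<and>
      wpp p a (u + 1) (xs @ [Assign reg_t (Add (Reg reg_t) (Const 1))]) (Inv (Suc k)) row R"
      by simp
  next
    fix row R assume inv: "Inv b row R"
    show "\<not> holds D p R (Less (Reg reg_t) e) \<and> Q row R"
      using assms(2,5)[OF inv] by simp
  qed (fact assms(1))
  then have "wpp p a (Suc (b * ((u + 1) + 1) + 1)) (for_t e xs) Q row R"
    by (simp add: for_t_def)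
  moreover have "Suc (b * ((u + 1) + 1) + 1) = b * (u + 2) + 2" by simp
  ultimately show ?thesis by metis
qed

text \<open>The loop amounts to one simultaneous move: \<open>inj\<close> keeps two processors from
  writing to a bank in the same step, \<open>once\<close> keeps delivered cells from being
  overwritten later, and \<open>disj\<close> keeps the sources intact. \<open>G\<close> is bounded
  for idle processors too, because reading is unconditional.\<close>

lemma gwp_route:
  fixes G H K :: "nat \<Rightarrow> nat \<Rightarrow> nat" and act :: "nat \<Rightarrow> nat \<Rightarrow> bool"
  assumes env0: "\<forall>p < m. env (Rs p)"
    and ev: "\<And>p t R. p < m \<Longrightarrow> t < L \<Longrightarrow> env R \<Longrightarrow> R reg_t = Word t \<Longrightarrow>
      eval D p R g = G p t \<and> (holds D p R b \<longleftrightarrow> act p t) \<and>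
      eval D p R h = H p t \<and> eval D p R k = K p t"
    and G: "\<And>p t. p < m \<Longrightarrow> t < L \<Longrightarrow> G p t < 200 * m"
    and HK: "\<And>p t. p < m \<Longrightarrow> t < L \<Longrightarrow> act p t \<Longrightarrow> H p t < m \<and> K p t < 200 * m"
    and inj: "\<And>p p' t. p < m \<Longrightarrow> p' < m \<Longrightarrow> t < L \<Longrightarrow> act p t \<Longrightarrow> act p' t \<Longrightarrow>
      H p t = H p' t \<Longrightarrow> p = p'"
    and once: "\<And>p p' t t'. p < m \<Longrightarrow> p' < m \<Longrightarrow> t < L \<Longrightarrow> t' < L \<Longrightarrow> act p t \<Longrightarrow> act p' t' \<Longrightarrow>
      H p t = H p' t' \<Longrightarrow> K p t = K p' t' \<Longrightarrow> t = t'"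
    and disj: "\<And>p p' t t'. p < m \<Longrightarrow> p' < m \<Longrightarrow> t < L \<Longrightarrow> t' < L \<Longrightarrow> act p t \<Longrightarrow> K p t \<noteq> G p' t'"
    and Q: "\<And>M' Rs'. state_ok M' Rs' \<Longrightarrow> \<forall>p < m. env (Rs' p) \<Longrightarrow>
      (\<And>p t. p < m \<Longrightarrow> t < L \<Longrightarrow> act p t \<Longrightarrow> M' (H p t) (K p t) = M p (G p t)) \<Longrightarrow>
      (\<And>i j. (\<And>p t. p < m \<Longrightarrow> t < L \<Longrightarrow> act p t \<Longrightarrow> \<not> (H p t = i \<and> K p t = j)) \<Longrightarrow> M' i j = M i j) \<Longrightarrow>
      Q M' Rs'"
  shows "gwp (5 * L + 2) (route b g h k) Q M Rs"
proof -
  define Inv where "Inv t M' Rs' \<longleftrightarrow> (\<forall>p < m. env (Rs' p) \<and> Rs' p reg_t = Word t) \<and>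
      (\<forall>p < m. \<forall>t' < t. t' < L \<longrightarrow> act p t' \<longrightarrow> M' (H p t') (K p t') = M p (G p t')) \<and>
      (\<forall>i j. (\<forall>p < m. \<forall>t' < t. t' < L \<longrightarrow> act p t' \<longrightarrow> \<not> (H p t' = i \<and> K p t' = j)) \<longrightarrow> M' i j = M i j)"
    for t M' and Rs' :: "nat \<Rightarrow> 'a regs"
  let ?read = "[Read reg_v Proc_Id g]" and ?write = "[Cond b [Write h k reg_v] [Skip]]"
    and ?incr = "[Assign reg_t (Add (Reg reg_t) (Const 1))]"
  let ?body = "[Read reg_v Proc_Id g, Cond b [Write h k reg_v] [Skip],
      Assign reg_t (Add (Reg reg_t) (Const 1))]"
  have body: "gwp 4 ?body (Inv (Suc t)) M1 R1" if t: "t < L" and inv: "Inv t M1 R1" for t M1 R1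
  proof -
    \<comment> \<open>An idle processor is assigned the nonexistent bank \<open>m + p\<close>, which
      makes the assignment injective on all processors.\<close>
    define \<rho> where "\<rho> p = (if act p t then H p t else m + p)" for p
    have \<rho>: "inj_on \<rho> {..<banks D}"
      unfolding inj_on_def \<rho>_def banks
    proof (intro ballI impI)
      fix p p' assume *: "p \<in> {..<m}" "p' \<in> {..<m}"
        "(if act p t then H p t else m + p) = (if act p' t then H p' t else m + p')"
      then show "p = p'"
        using inj[of p p' t] HK[of p t] HK[of p' t] t by (cases "act p t"; cases "act p' t") auto
    qed
    have R1: "env (R1 p)" "R1 p reg_t = Word t" if "p < m" for p
      using inv that by (auto simp: Inv_def)
    have M1: "M1 p (G p t) = M p (G p t)" if "p < m" for p
    proof -
      have "\<forall>p'<m. \<forall>t'<t. t' < L \<longrightarrow> act p' t' \<longrightarrow> \<not> (H p' t' = p \<and> K p' t' = G p t)"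
        using disj[OF _ that _ t] by metis
      with inv show ?thesis unfolding Inv_def by blast
    qed
    \<comment> \<open>The body is split where the assignment of banks changes: each processor has
      its own bank while reading and incrementing, and bank \<open>\<rho> p\<close> while writing.
      The three parts are treated from the last to the first, as weakest preconditions
      suggest.\<close>
    have 3: "gwp 1 ?incr (Inv (Suc t)) M3 R3"
      if R3: "\<And>p. p < m \<Longrightarrow> env (R3 p) \<and> R3 p reg_t = Word t"
        and M3: "\<And>p. p < m \<Longrightarrow> M3 (\<rho> p) =
          (if act p t then (M1 (\<rho> p))(K p t := M p (G p t)) else M1 (\<rho> p))"
        and M3': "\<And>i. i \<notin> \<rho> ` {..<m} \<Longrightarrow> M3 i = M1 i" for M3 R3
    proof (rule gwp_local[where Q = "\<lambda>p row R. row = M3 p \<and> R = (R3 p)(reg_t := Word (Suc t))"])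
      fix p assume "p < banks D"
      then show "wpp p p 1 ?incr
          (\<lambda>row R. row = M3 p \<and> R = (R3 p)(reg_t := Word (Suc t))) (M3 p) (R3 p)"
        using R3[of p] t L N_le by (auto intro!: word_bound_ge)
    next
      fix M' Rs'
      assume 1: "\<And>p. p < banks D \<Longrightarrow> M' p = M3 p \<and> Rs' p = (R3 p)(reg_t := Word (Suc t))"
        "\<And>i. \<not> i < banks D \<Longrightarrow> M' i = M3 i"
      then have M': "M' = M3" by (intro ext) (metis)
      have M3_act: "M3 (H p t) = (M1 (H p t))(K p t := M p (G p t))" if "p < m" "act p t" for p
        using M3[OF that(1)] that(2) by (simp add: \<rho>_def)
      have M3_out: "M3 i = M1 i" if "\<And>p. p < m \<Longrightarrow> act p t \<Longrightarrow> H p t \<noteq> i" for i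
      proof (cases "i \<in> \<rho> ` {..<m}")
        case True
        then obtain p where p: "p < m" "i = \<rho> p" by auto
        then have "\<not> act p t" using that[of p] by (auto simp: \<rho>_def)
        then show ?thesis using M3[OF p(1)] p by simp
      qed (use M3' in blast)
      show "Inv (Suc t) M' Rs'"
        unfolding Inv_def M'
      proof (intro conjI allI impI)
        fix p assume "p < m"
        then show "env (Rs' p)" "Rs' p reg_t = Word (Suc t)"
          using 1(1)[of p] R3[of p] by (auto simp: env_def)
      next
        fix p t' assume *: "p < m" "t' < Suc t" "t' < L" "act p t'"
        show "M3 (H p t') (K p t') = M p (G p t')"
        proof (cases "t' = t")
          case True
          then show ?thesis using M3_act * by simp
        next
          case False
          then have old: "M1 (H p t') (K p t') = M p (G p t')"
            using * inv unfolding Inv_def by simp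
          show ?thesis
          proof (cases "\<exists>p' < m. act p' t \<and> H p' t = H p t'")
            case True
            then obtain p' where p': "p' < m" "act p' t" "H p' t = H p t'" by auto
            \<comment> \<open>The bank was also a target at an earlier time; by \<open>once\<close>
              the present write hits a different column there.\<close>
            then have "K p' t \<noteq> K p t'" using once[OF p'(1) *(1) t *(3) p'(2) *(4)] False by auto
            then show ?thesis using M3_act[OF p'(1,2)] p'(3) old by simp
          next
            case False
            then show ?thesis using M3_out[of "H p t'"] old by auto
          qed
        qed
      next
        fix i j
        assume *: "\<forall>p<m. \<forall>t'<Suc t. t' < L \<longrightarrow> act p t' \<longrightarrow> \<not> (H p t' = i \<and> K p t' = j)"
        then have old: "M1 i j = M i j" using inv unfolding Inv_def by simp
        show "M3 i j = M i j"
        proof (cases "\<exists>p < m. act p t \<and> H p t = i")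
          case True
          then obtain p where p: "p < m" "act p t" "H p t = i" by auto
          then have "K p t \<noteq> j" using * t by blast
          then show ?thesis using M3_act[OF p(1,2)] p(3) old by simp
        next
          case False
          then show ?thesis using M3_out[of i] old by auto
        qed
      qed
    qed
    have 2: "gwp 2 ?write
        (gwp 1 ?incr (Inv (Suc t))) M1 R2"
      if R2: "\<And>p. p < m \<Longrightarrow> R2 p = (R1 p)(reg_v := M1 p (G p t))" for R2
    proof (rule gwp_lift[OF \<rho>, where Q = "\<lambda>p row R. R = R2 p \<and> row =
        (if act p t then (M1 (\<rho> p))(K p t := M p (G p t)) else M1 (\<rho> p))"])
      fix p assume p: "p < banks D"
      have "env (R2 p)" "R2 p reg_t = Word t" "R2 p reg_v = M p (G p t)"
        using R1[of p] R2[of p] M1[of p] p by (simp_all add: env_def)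
      then show "wpp p (\<rho> p) 2 ?write (\<lambda>row R. R = R2 p \<and> row =
        (if act p t then (M1 (\<rho> p))(K p t := M p (G p t)) else M1 (\<rho> p))) (M1 (\<rho> p)) (R2 p)"
        using ev[of p t "R2 p"] p t HK[of p t] by (auto simp: \<rho>_def intro!: usableI)
    next
      fix M' Rs'
      assume 1: "\<And>p. p < banks D \<Longrightarrow> Rs' p = R2 p \<and> M' (\<rho> p) =
         (if act p t then (M1 (\<rho> p))(K p t := M p (G p t)) else M1 (\<rho> p))"
        "\<And>i. i \<notin> \<rho> ` {..<banks D} \<Longrightarrow> M' i = M1 i"
      show "gwp 1 ?incr (Inv (Suc t)) M' Rs'"
        by (rule 3) (use 1 R1 R2 in \<open>auto simp: env_def\<close>)
    qed
    have "gwp 1 ?read (gwp 2 ?write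
        (gwp 1 ?incr (Inv (Suc t)))) M1 R1"
    proof (rule gwp_local[where Q = "\<lambda>p row R. R = (R1 p)(reg_v := M1 p (G p t)) \<and> row = M1 p"])
      fix p assume p: "p < banks D"
      then show "wpp p p 1 ?read
          (\<lambda>row R. R = (R1 p)(reg_v := M1 p (G p t)) \<and> row = M1 p) (M1 p) (R1 p)"
        using ev[of p t "R1 p"] R1[of p] G[of p t] t by (auto intro!: usableI)
    next
      fix M' Rs'
      assume 1: "\<And>p. p < banks D \<Longrightarrow> Rs' p = (R1 p)(reg_v := M1 p (G p t)) \<and> M' p = M1 p"
        "\<And>i. \<not> i < banks D \<Longrightarrow> M' i = M1 i"
      then have "M' = M1" by (intro ext) metis
      then show "gwp 2 ?write
        (gwp 1 ?incr (Inv (Suc t))) M' Rs'"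
        using 2[of Rs'] 1(1) by simp
    qed
    from gwp_append[OF gwp_append[OF this]] show ?thesis by (simp add: eval_nat_numeral)
  qed
  have loop: "gwp (L * (4 + 1) + 1) [While (Less (Reg reg_t) (Reg reg_L)) ?body] (Inv L) M1 R1"
    if "Inv 0 M1 R1" for M1 R1
  proof (rule gwp_while[where Inv = Inv])
    show "Inv 0 M1 R1" by (rule that)
  next
    fix t M Rs assume "t < L" "Inv t M Rs"
    moreover from this have "holds D p (Rs p) (Less (Reg reg_t) (Reg reg_L))" if "p < m" for p
      using that by (simp add: Inv_def env_def)
    ultimately show "(\<forall>p<banks D. holds D p (Rs p) (Less (Reg reg_t) (Reg reg_L))) \<and>
        gwp 4 ?body (Inv (Suc t)) M Rs"
      using body by simp
  next
    fix M Rs assume "Inv L M Rs"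
    then show "\<forall>p<banks D. \<not> holds D p (Rs p) (Less (Reg reg_t) (Reg reg_L))"
      by (simp add: Inv_def env_def)
  qed
  have "gwp 1 [Assign reg_t (Const 0)]
      (gwp (L * (4 + 1) + 1) [While (Less (Reg reg_t) (Reg reg_L)) ?body] (Inv L)) M Rs"
  proof (rule gwp_local[where Q = "\<lambda>p row R. R = (Rs p)(reg_t := Word 0) \<and> row = M p"])
    fix M' Rs'
    assume 1: "\<And>p. p < banks D \<Longrightarrow> Rs' p = (Rs p)(reg_t := Word 0) \<and> M' p = M p"
      "\<And>i. \<not> i < banks D \<Longrightarrow> M' i = M i"
    then have "M' = M" by (intro ext) metis
    then have "Inv 0 M' Rs'" using 1(1) env0 by (simp add: Inv_def env_def)
    then show "gwp (L * (4 + 1) + 1) [While (Less (Reg reg_t) (Reg reg_L)) ?body] (Inv L) M' Rs'"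
      by (rule loop)
  qed auto
  from gwp_append[OF this] have "gwp (5 * L + 2) (route b g h k) (Inv L) M Rs"
    by (simp add: route_def for_t_def algebra_simps)
  then show ?thesis
  proof (rule gwp_mono)
    fix M' Rs' assume ok: "state_ok M' Rs'" and inv: "Inv L M' Rs'"
    show "Q M' Rs'"
    proof (rule Q[OF ok])
      show "\<forall>p<m. env (Rs' p)" using inv by (simp add: Inv_def)
    next
      fix p t assume "p < m" "t < L" "act p t"
      then show "M' (H p t) (K p t) = M p (G p t)" using inv by (simp add: Inv_def)
    next
      fix i j assume *: "\<And>p t. p < m \<Longrightarrow> t < L \<Longrightarrow> act p t \<Longrightarrow> \<not> (H p t = i \<and> K p t = j)"
      have "\<forall>p < m. \<forall>t' < L. t' < L \<longrightarrow> act p t' \<longrightarrow> \<not> (H p t' = i \<and> K p t' = j)"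
        using * by blast
      then show "M' i j = M i j" using inv unfolding Inv_def by blast
    qed
  qed
qed

end

section \<open>Local merge sort\<close>

definition blocks_sorted :: "('c \<Rightarrow> 'c \<Rightarrow> bool) \<Rightarrow> nat \<Rightarrow> nat \<Rightarrow> (nat \<Rightarrow> 'c) \<Rightarrow> bool" where
  "blocks_sorted le w k x \<longleftrightarrow> (\<forall>t t'. t \<le> t' \<longrightarrow> t' < k \<longrightarrow> t div w = t' div w \<longrightarrow> le (x t) (x t'))"

text \<open>
  The blocks \<open>{u..<u+w}\<close> and \<open>{u+w..<u+2*w}\<close> of \<open>S\<close> are being merged into \<open>X\<close>; positions below
  \<open>k\<close> are filled, and the heads of the two blocks are \<open>k+(u+w)-j\<close> and \<open>j\<close>.
\<close>
definition merging :: "('c \<Rightarrow> 'c \<Rightarrow> bool) \<Rightarrow> nat \<Rightarrow> (nat \<Rightarrow> 'c) \<Rightarrow> nat \<Rightarrow> nat \<Rightarrow> nat \<Rightarrow> (nat \<Rightarrow> 'c) \<Rightarrow> bool" where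
  "merging le w S u k j X \<longleftrightarrow> u + w \<le> j \<and> j \<le> u + 2 * w \<and> k \<le> j \<and> j \<le> k + w \<and>
     (\<Sum>t<k. {#X t#}) = (\<Sum>t<k + (u + w) - j. {#S t#}) + (\<Sum>t\<in>{u + w..<j}. {#S t#}) \<and>
     blocks_sorted le (2 * w) k X \<and>
     (\<forall>t\<in>{u..<k}. \<forall>s\<in>{k + (u + w) - j..<u + w} \<union> {j..<u + 2 * w}. le (X t) (S s))"

definition merged_upto :: "('c \<Rightarrow> 'c \<Rightarrow> bool) \<Rightarrow> nat \<Rightarrow> (nat \<Rightarrow> 'c) \<Rightarrow> nat \<Rightarrow> (nat \<Rightarrow> 'c) \<Rightarrow> bool" where
  "merged_upto le w S k X \<longleftrightarrow> (\<Sum>t<k. {#X t#}) = (\<Sum>t<k. {#S t#}) \<and> blocks_sorted le (2 * w) k X"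

definition take_right :: "('c \<Rightarrow> 'c \<Rightarrow> bool) \<Rightarrow> nat \<Rightarrow> (nat \<Rightarrow> 'c) \<Rightarrow> nat \<Rightarrow> nat \<Rightarrow> nat \<Rightarrow> bool" where
  "take_right le w S u k j \<longleftrightarrow> j < u + 2 * w \<and>
     \<not> (k + (u + w) - j < u + w \<and> le (S (k + (u + w) - j)) (S j))"

lemma merging_start:
  assumes "merged_upto le w S k X"
  shows "merging le w S k k (k + w) X"
  using assms by (simp add: merged_upto_def merging_def)

text \<open>The head that is taken lies below everything left in both blocks, by sortedness within
  its own block and by the comparison of the heads with transitivity across. This preserves both the
  sortedness of the output and the lower bound in the last clause of \<open>merging\<close>. Since
  the two heads always add up to \<open>k + (u + w)\<close>, storing one of them suffices.\<close>

lemma merging_step: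
  assumes m: "merging le w S u k j X" and k: "u \<le> k" "k < u + 2 * w" and u: "(2 * w) dvd u"
    and S: "blocks_sorted le w (u + 2 * w) S" and le: "transp le" "totalp le" "reflp le"
  shows "if take_right le w S u k j then merging le w S u (Suc k) (Suc j) (X(k := S j))
    else merging le w S u (Suc k) j (X(k := S (k + (u + w) - j)))"
proof -
  define i where "i = k + (u + w) - j"
  have w: "0 < w" using k by simp
  have b: "u + w \<le> j" "j \<le> u + 2 * w" "k \<le> j" "j \<le> k + w"
    and sum: "(\<Sum>t<k. {#X t#}) = (\<Sum>t<i. {#S t#}) + (\<Sum>t\<in>{u + w..<j}. {#S t#})"
    and X: "blocks_sorted le (2 * w) k X"
    and lower: "\<And>t s. u \<le> t \<Longrightarrow> t < k \<Longrightarrow> i \<le> s \<and> s < u + w \<or> j \<le> s \<and> s < u + 2 * w \<Longrightarrow> le (X t) (S s)"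
    using m unfolding merging_def i_def by (blast, blast, blast, blast, blast, blast, auto)
  have i: "u \<le> i" "i \<le> u + w" "i + j = k + (u + w)" using b by (auto simp: i_def)
  obtain v where v: "u = 2 * w * v" using u by (auto simp: dvd_def)
  \<comment> \<open>Because \<open>u\<close> is a multiple of \<open>2 * w\<close>, the output
    positions sharing a block of width \<open>2 * w\<close> with \<open>k\<close> are exactly those
    from \<open>u\<close> on.\<close>
  have block: "t div (2 * w) = v \<longleftrightarrow> u \<le> t" if "t \<le> k" for t
    using that k w v by (auto simp: div_nat_eqI dividend_less_times_div intro!: div_nat_eqI)
  have trans: "le x y \<Longrightarrow> le y z \<Longrightarrow> le x z" and tot: "le x y \<or> le y x" for x y z
    using le by (auto dest: transpD totalpD reflpD) (metis reflpD totalpD)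
  have left: "le (S s) (S s')" if "u \<le> s" "s \<le> s'" "s' < u + w" for s s'
  proof -
    have "s div w = 2 * v" "s' div w = 2 * v" using that v by (auto intro!: div_nat_eqI simp: algebra_simps)
    then show ?thesis using S that unfolding blocks_sorted_def by simp
  qed
  have right: "le (S s) (S s')" if "u + w \<le> s" "s \<le> s'" "s' < u + 2 * w" for s s'
  proof -
    have "s div w = 2 * v + 1" "s' div w = 2 * v + 1" using that v by (auto intro!: div_nat_eqI simp: algebra_simps)
    then show ?thesis using S that unfolding blocks_sorted_def by simp
  qed
  have ext: "blocks_sorted le (2 * w) (Suc k) (X(k := y))" if "\<And>t. u \<le> t \<Longrightarrow> t < k \<Longrightarrow> le (X t) y" for y
    unfolding blocks_sorted_def
  proof (intro allI impI)
    fix t t' assume *: "t \<le> t'" "t' < Suc k" "t div (2 * w) = t' div (2 * w)"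
    show "le ((X(k := y)) t) ((X(k := y)) t')"
    proof (cases "t' = k")
      case True
      then have "u \<le> t" using block[of k] block[of t] * k by simp
      then show ?thesis using True * that[of t] le(3) by (cases "t = k") (auto dest: reflpD)
    next
      case False
      then show ?thesis using * X unfolding blocks_sorted_def by simp
    qed
  qed
  have sumk: "(\<Sum>t<Suc k. {#(X(k := y)) t#}) = (\<Sum>t<k. {#X t#}) + {#y#}" for y
    by simp
  show ?thesis
  proof (cases "take_right le w S u k j")
    case True
    then have j: "j < u + 2 * w" and or: "i = u + w \<or> \<not> le (S i) (S j)"
      using i by (auto simp: take_right_def i_def[symmetric])
    have first: "le (S j) (S s)" if "i \<le> s \<and> s < u + w \<or> j \<le> s \<and> s < u + 2 * w" for s
      using that
    proof
      assume s: "i \<le> s \<and> s < u + w"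
      then have "le (S j) (S i)" using or tot[of "S i" "S j"] by auto
      then show ?thesis using left[of i s] i s trans by blast
    qed (use right b in auto)
    have eq: "Suc k + (u + w) - Suc j = i" by (simp add: i_def)
    have "merging le w S u (Suc k) (Suc j) (X(k := S j))"
      unfolding merging_def eq sumk sum
    proof (intro conjI ballI)
      show "blocks_sorted le (2 * w) (Suc k) (X(k := S j))"
        by (rule ext) (use lower j in auto)
    next
      fix t s assume "t \<in> {u..<Suc k}" "s \<in> {i..<u + w} \<union> {Suc j..<u + 2 * w}"
      then show "le ((X(k := S j)) t) (S s)"
        using lower[of t s] first[of s] by (cases "t = k") auto
    qed (use b j in auto)
    then show ?thesis using True by simp
  next
    case False
    then have iw: "i < u + w" and or: "j = u + 2 * w \<or> le (S i) (S j)"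
      using i b k by (auto simp: take_right_def i_def[symmetric])
    have first: "le (S i) (S s)" if "i \<le> s \<and> s < u + w \<or> j \<le> s \<and> s < u + 2 * w" for s
      using that
    proof
      assume s: "j \<le> s \<and> s < u + 2 * w"
      then have "le (S i) (S j)" using or by auto
      then show ?thesis using right[of j s] b s trans by blast
    qed (use left i in auto)
    have eq: "Suc k + (u + w) - j = Suc i" using b by (simp add: i_def)
    have "merging le w S u (Suc k) j (X(k := S i))"
      unfolding merging_def eq sumk sum
    proof (intro conjI ballI)
      show "blocks_sorted le (2 * w) (Suc k) (X(k := S i))"
        by (rule ext) (use lower iw in auto)
    next
      fix t s assume "t \<in> {u..<Suc k}" "s \<in> {Suc i..<u + w} \<union> {j..<u + 2 * w}"
      then show "le ((X(k := S i)) t) (S s)"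
        using lower[of t s] first[of s] by (cases "t = k") auto
    qed (use b iw i in \<open>auto simp: algebra_simps\<close>)
    then show ?thesis using False by (simp add: i_def)
  qed
qed

lemma merging_finish:
  assumes "merging le w S u (u + 2 * w) j X"
  shows "merged_upto le w S (u + 2 * w) X"
proof -
  have j: "j = u + 2 * w" using assms by (auto simp: merging_def)
  then have "(\<Sum>t<u + 2 * w. {#X t#}) = (\<Sum>t<u + w. {#S t#}) + (\<Sum>t\<in>{u + w..<u + 2 * w}. {#S t#})"
    using assms by (simp add: merging_def add.commute)
  also have "\<dots> = (\<Sum>t<u + 2 * w. {#S t#})"
    by (simp add: lessThan_atLeast0 sum.atLeastLessThan_concat)
  finally show ?thesis using assms by (simp add: merged_upto_def merging_def)
qed

text \<open>All words are equivalent tops, and items with the same key are equivalent, so this is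
  only a total preorder. That is why the sorting lemmas take a relation \<open>le\<close> rather
  than a linear order on cells.\<close>

definition cell_le :: "('a \<Rightarrow> 'k::linorder) \<Rightarrow> 'a cell \<Rightarrow> 'a cell \<Rightarrow> bool" where
  "cell_le key a b \<longleftrightarrow> (case b of Word _ \<Rightarrow> True | Item y \<Rightarrow>
     (case a of Word _ \<Rightarrow> False | Item x \<Rightarrow> key x \<le> key y))"

lemma cell_le_order: "transp (cell_le key)" "totalp (cell_le key)" "reflp (cell_le key)"
  by (auto simp: cell_le_def transp_def totalp_on_def reflp_on_def split: cell.splits)

abbreviation (input) reg_u :: nat where "reg_u \<equiv> 5"
abbreviation (input) reg_j :: nat where "reg_j \<equiv> 6"
abbreviation (input) reg_w :: nat where "reg_w \<equiv> 7"

text \<open>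
  The matrix occupies the columns below \<open>m\<close> of a bank.  The rows to be sorted start in column
  \<open>64m\<close>, the sorted rows in column \<open>32m\<close>, and the counters of counting sort in column \<open>96m\<close>; note
  that \<open>L \<le> 32m\<close>.
\<close>
definition X_col :: "exp \<Rightarrow> exp" where "X_col e = Add (Mul (Const 32) Num_Cols) e"
definition S_col :: "exp \<Rightarrow> exp" where "S_col e = Add (Mul (Const 64) Num_Cols) e"
definition Z_col :: "exp \<Rightarrow> exp" where "Z_col e = Add (Mul (Const 96) Num_Cols) e"

text \<open>The value \<open>u + w\<close> of \<open>merging\<close>, with \<open>u\<close> obtained
  by rounding the loop counter down to a multiple of the double width.\<close>

definition mid_exp :: exp where
  "mid_exp = Add (Mul (Div (Reg reg_t) (Mul (Const 2) (Reg reg_w))) (Mul (Const 2) (Reg reg_w))) (Reg reg_w)"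

definition left_exp :: exp where
  "left_exp = Sub (Add (Reg reg_t) mid_exp) (Reg reg_j)"

text \<open>\<open>Item_Less\<close> is false whenever a word is involved, so the role of words as
  infinity has to be spelled out: a word in \<open>reg_u\<close> makes the test true, otherwise
  \<open>reg_v\<close> must hold an item that is not greater.\<close>

definition le_test :: test where
  "le_test = Neg (Conj (Is_Item reg_u) (Neg (Conj (Is_Item reg_v) (Neg (Item_Less reg_u reg_v)))))"

text \<open>The \<open>Skip\<close>s pad the shorter branches, so that a pass through the body takes
  8 steps whatever the data.\<close>

definition merge_body :: "instr list" where
  "merge_body =
    [Cond (Less (Mod (Reg reg_t) (Mul (Const 2) (Reg reg_w))) (Const 1))
       [Assign reg_j (Add (Reg reg_t) (Reg reg_w))] [Skip],
     Read reg_v Proc_Id (S_col left_exp),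
     Read reg_u Proc_Id (S_col (Reg reg_j)),
     Cond (Conj (Less (Reg reg_j) (Add mid_exp (Reg reg_w))) (Neg (Conj (Less left_exp mid_exp) le_test)))
       [Copy reg_v reg_u, Assign reg_j (Add (Reg reg_j) (Const 1))] [Skip, Skip],
     Write Proc_Id (X_col (Reg reg_t)) reg_v]"

definition copy_back :: "instr list" where
  "copy_back = [Read reg_v Proc_Id (X_col (Reg reg_t)), Write Proc_Id (S_col (Reg reg_t)) reg_v]"

definition merge_sort :: "instr list" where
  "merge_sort = Assign reg_w (Const 1) # [While (Less (Reg reg_w) (Reg reg_L))
     (for_t (Reg reg_L) merge_body @ for_t (Reg reg_L) copy_back @
      [Assign reg_w (Mul (Const 2) (Reg reg_w))])]"

section \<open>Correctness and time of the merge sort program\<close>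

context dmm_square
begin

definition X_row :: "(nat \<Rightarrow> 'a cell) \<Rightarrow> nat \<Rightarrow> 'a cell" where "X_row row t = row (32 * m + t)"
definition S_row :: "(nat \<Rightarrow> 'a cell) \<Rightarrow> nat \<Rightarrow> 'a cell" where "S_row row t = row (64 * m + t)"

text \<open>\<open>u\<close> is the exact time, the same for every processor and every content. The
  matrix columns must survive because the second sort in \<open>finish\<close> runs when part of the
  output is already there.\<close>

definition sorter :: "('a cell \<Rightarrow> 'a cell \<Rightarrow> bool) \<Rightarrow> instr list \<Rightarrow> nat \<Rightarrow> bool" where
  "sorter le xs u \<longleftrightarrow> (\<forall>p < m. \<forall>row R. env R \<longrightarrow> (\<forall>j. cell_ok (row j)) \<longrightarrow>
     wpp p p u xs (\<lambda>row' R'. env R' \<and> row_sorted le L (X_row row') \<and>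
       row_mset L (X_row row') = row_mset L (S_row row) \<and> (\<forall>j < m. row' j = row j)) row R)"

lemma L_le: "L \<le> 32 * m"
  using L N_le by simp

lemma row_mset_cong: "(\<And>t. t < k \<Longrightarrow> x t = y t) \<Longrightarrow> row_mset k x = row_mset k y"
  by (simp add: row_mset_def)

lemma X_row_upd: "X_row (row(32 * m + t := v)) = (X_row row)(t := v)"
  by (auto simp: X_row_def)

lemma S_row_upd: "S_row (row(64 * m + t := v)) = (S_row row)(t := v)"
  by (auto simp: S_row_def)

lemma wpp_copy_back:
  assumes p: "p < m" and R: "env R" "R reg_w = Word w"
    and Q: "\<And>row' R'. env R' \<Longrightarrow> R' reg_w = Word w \<Longrightarrow> (\<And>t. t < L \<Longrightarrow> X_row row' t = X_row row t) \<Longrightarrow>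
      (\<And>t. t < L \<Longrightarrow> S_row row' t = X_row row t) \<Longrightarrow> (\<And>j. j < m \<Longrightarrow> row' j = row j) \<Longrightarrow> Q row' R'"
  shows "wpp p p (L * 4 + 2) (for_t (Reg reg_L) copy_back) Q row R"
proof -
  define Inv where "Inv k row' R' \<longleftrightarrow> env R' \<and> R' reg_w = Word w \<and> R' reg_t = Word k \<and>
      (\<forall>t < L. X_row row' t = X_row row t) \<and> (\<forall>t < k. S_row row' t = X_row row t) \<and> (\<forall>j < m. row' j = row j)"
    for k row' and R' :: "'a regs"
  have "wpp p p (L * (2 + 2) + 2) (for_t (Reg reg_L) copy_back) Q row R"
  proof (rule wpp_for_t[where Inv = Inv])
    show "Inv 0 row (R(reg_t := Word 0))" using R by (simp add: Inv_def env_def)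
  next
    fix k row' R' assume "Inv k row' R'"
    then show "R' reg_t = Word k \<and> eval D p R' (Reg reg_L) = L" by (simp add: Inv_def env_def)
  next
    fix k row' R' assume k: "k < L" and inv: "Inv k row' R'"
    have "Inv (Suc k) (row'(64 * m + k := row' (32 * m + k))) (R'(reg_v := row' (32 * m + k), reg_t := Word (Suc k)))"
      using inv k L_le m_pos by (auto simp: Inv_def env_def S_row_upd less_Suc_eq X_row_def)
    then show "wpp p p 2 copy_back (\<lambda>row R. R reg_t = Word k \<and> Inv (Suc k) row (R(reg_t := Word (Suc k)))) row' R'"
      using inv p k L_le by (auto simp: copy_back_def Inv_def X_col_def S_col_def intro!: usableI)
  qed (use L_le Q in \<open>auto simp: Inv_def\<close>)
  then show ?thesis by simp
qed

lemma holds_le_test: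
  assumes "item_less D = (\<lambda>x y. key x < key y)"
  shows "holds D p R le_test \<longleftrightarrow> cell_le key (R reg_v) (R reg_u)"
  by (auto simp: le_test_def cell_le_def assms split: cell.splits)

lemma wpp_merge_pass:
  assumes p: "p < m" and R: "env R" "R reg_w = Word w"
    and w: "0 < w" "2 * w dvd L" "w \<le> L"
    and less: "item_less D = (\<lambda>x y. key x < key y)"
    and S: "blocks_sorted (cell_le key) w L (S_row row)"
    and Q: "\<And>row' R'. env R' \<Longrightarrow> R' reg_w = Word w \<Longrightarrow>
      merged_upto (cell_le key) w (S_row row) L (X_row row') \<Longrightarrow>
      (\<And>t. t < L \<Longrightarrow> S_row row' t = S_row row t) \<Longrightarrow> (\<And>j. j < m \<Longrightarrow> row' j = row j) \<Longrightarrow> Q row' R'"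
  shows "wpp p p (L * 10 + 2) (for_t (Reg reg_L) merge_body) Q row R"
proof -
  let ?le = "cell_le key" and ?S = "S_row row" and ?u = "\<lambda>k. k div (2 * w) * (2 * w)"
  \<comment> \<open>At the start of a double block \<open>reg_j\<close> is stale and is reset by the
    first instruction of the body; the invariant therefore speaks of \<open>reg_j\<close> only
    inside a block.\<close>
  define Inv where "Inv k row' R' \<longleftrightarrow> env R' \<and> R' reg_w = Word w \<and> R' reg_t = Word k \<and>
      (\<forall>t < L. S_row row' t = ?S t) \<and> (\<forall>j < m. row' j = row j) \<and>
      (if 2 * w dvd k then merged_upto ?le w ?S k (X_row row')
       else \<exists>j. R' reg_j = Word j \<and> merging ?le w ?S (?u k) k j (X_row row'))"
    for k row' and R' :: "'a regs"
  have "wpp p p (L * (8 + 2) + 2) (for_t (Reg reg_L) merge_body) Q row R"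
  proof (rule wpp_for_t[where Inv = Inv])
    show "Inv 0 row (R(reg_t := Word 0))"
      using R by (simp add: Inv_def env_def merged_upto_def blocks_sorted_def)
  next
    fix k row' R' assume "Inv k row' R'"
    then show "R' reg_t = Word k \<and> eval D p R' (Reg reg_L) = L" by (simp add: Inv_def env_def)
  next
    fix k row' R' assume k: "k < L" and inv: "Inv k row' R'"
    define u where "u = ?u k"
    define Post where "Post row R \<longleftrightarrow> R reg_t = Word k \<and> Inv (Suc k) row (R(reg_t := Word (Suc k)))"
      for row R
    have u: "u \<le> k" "k < u + 2 * w" "2 * w dvd u"
      using w(1) div_mult_mod_eq[of k "2 * w"] mod_less_divisor[of "2 * w" k] unfolding u_def
      by (linarith, linarith, simp)
    \<comment> \<open>A double block that starts below \<open>L\<close> is complete, because its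
      width divides both \<open>u\<close> and \<open>L\<close>.\<close>
    have uL: "u + 2 * w \<le> L"
    proof -
      obtain a b where "L = 2 * w * a" "u = 2 * w * b" using w(2) u(3) by (auto simp: dvd_def)
      then have "b < a" using u(1) k by (metis le_less_trans nat_mult_less_cancel1 zero_less_mult_iff mult_less_cancel1)
      then have "2 * w * (b + 1) \<le> 2 * w * a" by (intro mult_le_mono2) simp
      then show ?thesis using \<open>L = 2 * w * a\<close> \<open>u = 2 * w * b\<close> by simp
    qed
    have S': "blocks_sorted ?le w (u + 2 * w) ?S"
      using S uL unfolding blocks_sorted_def by auto
    have row': "R' reg_w = Word w" "R' reg_t = Word k" "\<And>t. t < L \<Longrightarrow> row' (64 * m + t) = ?S t"
      using inv by (auto simp: Inv_def S_row_def)
    have fin: "Inv (Suc k) (row'(32 * m + k := x)) R2"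
      if mg: "merging ?le w ?S u (Suc k) j ((X_row row')(k := x))"
        and R2: "env R2" "R2 reg_w = Word w" "R2 reg_t = Word (Suc k)" "R2 reg_j = Word j" for x j R2
    proof -
      have rest: "(\<forall>t < L. S_row (row'(32 * m + k := x)) t = ?S t)"
        "\<forall>j < m. (row'(32 * m + k := x)) j = row j"
        using inv k L_le m_pos by (auto simp: Inv_def S_row_def)
      show ?thesis
      proof (cases "2 * w dvd Suc k")
        case True
        have "Suc k = u + 2 * w"
        proof -
          have "2 * w dvd Suc k - u" using True u(3) by (rule dvd_diff_nat)
          then have "2 * w \<le> Suc k - u" using u(1) by (intro dvd_imp_le) auto
          then show ?thesis using u by simp
        qed
        then have "merged_upto ?le w ?S (Suc k) (X_row (row'(32 * m + k := x)))"
          using merging_finish mg X_row_upd by metis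
        then show ?thesis using rest R2 True by (simp add: Inv_def)
      next
        case False
        then have "?u (Suc k) = u" by (simp add: u_def div_Suc dvd_eq_mod_eq_0)
        then show ?thesis using rest R2 False mg by (simp add: Inv_def X_row_upd)
      qed
    qed
    have step: "wpp p p 6 (tl merge_body) Post row' R1"
      if R1: "env R1" "R1 reg_w = Word w" "R1 reg_t = Word k" "R1 reg_j = Word j"
        and mg: "merging ?le w ?S u k j (X_row row')" for R1 j
    proof -
      have j: "u + w \<le> j" "j \<le> u + 2 * w" "k \<le> j" "j \<le> k + w"
        using mg unfolding merging_def by blast+
      define i where "i = k + (u + w) - j"
      have i: "i \<le> u + w" "i < L" using j uL w(1) by (auto simp: i_def)
      have mid: "eval D p (R1(4 := x, 5 := y)) mid_exp = u + w" "eval D p R1 mid_exp = u + w" for x y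
        using R1 by (simp_all add: mid_exp_def u_def)
      have left: "eval D p (R1(4 := x, 5 := y)) left_exp = i" "eval D p R1 left_exp = i" for x y
        using R1 mid by (simp_all add: left_exp_def i_def)
      have tr: "take_right ?le w ?S u k j \<longleftrightarrow>
          j < u + w + w \<and> \<not> (i < u + w \<and> ?le (row' (64 * m + i)) (row' (64 * m + j)))"
        using row'(3)[of i] row'(3)[of j] i uL by (auto simp: take_right_def i_def[symmetric])
      have nxt: "if take_right ?le w ?S u k j
          then merging ?le w ?S u (Suc k) (Suc j) ((X_row row')(k := row' (64 * m + j)))
          else merging ?le w ?S u (Suc k) j ((X_row row')(k := row' (64 * m + i)))"
        using merging_step[OF mg u(1,2,3) S' cell_le_order] row'(3)[of i] row'(3)[of j] i uL
        unfolding i_def[symmetric] by (auto simp: take_right_def split: if_splits)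
      \<comment> \<open>Both heads are read even if one block is exhausted. In that case only the
        legality of the address matters, since \<open>take_right\<close> is decided without the
        value.\<close>
      have bounds: "64 * m + i < 200 * m" "64 * m + j < 200 * m" "32 * m + k < 200 * m"
        using i j uL k L_le m_pos by auto
      have "env (R1(4 := x, 5 := y))" for x y using R1(1) by (simp add: env_def)
      show ?thesis
      proof (cases "take_right ?le w ?S u k j")
        case True
        then have "Inv (Suc k) (row'(32 * m + k := row' (64 * m + j)))
            (R1(4 := row' (64 * m + i), 5 := row' (64 * m + j), 4 := row' (64 * m + j), 6 := Word (Suc j), 3 := Word (Suc k)))"
          by (intro fin[of "Suc j"]) (use nxt R1 in \<open>auto simp: env_def\<close>)
        moreover have "Suc j \<le> word_bound"
          using True tr uL L_le m_pos by (intro word_bound_ge) auto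
        ultimately show ?thesis
          using True tr bounds p R1
          by (simp add: merge_body_def mid left holds_le_test[OF less] S_col_def X_col_def usableI Post_def)
      next
        case False
        then have "Inv (Suc k) (row'(32 * m + k := row' (64 * m + i)))
            (R1(4 := row' (64 * m + i), 5 := row' (64 * m + j), 3 := Word (Suc k)))"
          by (intro fin[of j]) (use nxt R1 in \<open>auto simp: env_def\<close>)
        then show ?thesis
          using False tr bounds p R1
          by (auto simp: merge_body_def mid left holds_le_test[OF less] S_col_def X_col_def usableI Post_def)
      qed
    qed
    have "wpp p p 2 [hd merge_body] (wpp p p 6 (tl merge_body) Post) row' R'"
    proof (cases "2 * w dvd k")
      case True
      then have "u = k" by (simp add: u_def)
      have "merging ?le w ?S u k (k + w) (X_row row')"
        using inv True \<open>u = k\<close> by (auto simp: Inv_def intro: merging_start)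
      then have "wpp p p 6 (tl merge_body) Post row' (R'(reg_j := Word (k + w)))"
        by (rule step[rotated -1]) (use inv in \<open>auto simp: Inv_def env_def\<close>)
      moreover have "k + w \<le> word_bound" using k w(3) L_le by (intro word_bound_ge) auto
      ultimately show ?thesis using row' True
        by (simp add: merge_body_def dvd_eq_mod_eq_0)
    next
      case False
      then obtain j where "R' reg_j = Word j" "merging ?le w ?S u k j (X_row row')"
        using inv by (auto simp: Inv_def u_def)
      then have "wpp p p 6 (tl merge_body) Post row' R'"
        using inv by (intro step) (auto simp: Inv_def)
      then show ?thesis using row' False
        by (simp add: merge_body_def dvd_eq_mod_eq_0)
    qed
    from wpp_append[OF this]
    have "wpp p p (2 + 6) merge_body Post row' R'" by (simp add: merge_body_def)
    then show "wpp p p 8 merge_body (\<lambda>row R. R reg_t = Word k \<and> Inv (Suc k) row (R(reg_t := Word (Suc k)))) row' R'"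
      unfolding Post_def by simp
  qed (use L_le Q in \<open>auto simp: Inv_def w(2)\<close>)
  then show ?thesis by simp
qed

lemma L_power: "L = 2 ^ (2 * n + 5)"
  by (simp add: L N q power_add power_mult power2_eq_square power_mult_distrib mult.commute flip: power_mult_distrib)

lemma sorter_merge_sort:
  assumes less: "item_less D = (\<lambda>x y. key x < key y)"
  shows "sorter (cell_le key) merge_sort ((2 * n + 5) * (14 * L + 6) + 2)"
  unfolding sorter_def
proof (intro allI impI)
  fix p row R assume p: "p < m" and R: "env R"
  let ?le = "cell_le key" and ?post = "\<lambda>row' R'. env R' \<and> row_sorted (cell_le key) L (X_row row') \<and>
       row_mset L (X_row row') = row_mset L (S_row row) \<and> (\<forall>j < m. row' j = row j)"
  \<comment> \<open>After a pass the \<open>X\<close> columns still hold what was copied back, so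
    the final result is found there too. Before the first pass their contents are arbitrary, hence
    the condition \<open>0 < e\<close>; there is at least one pass as \<open>L\<close> is at least
    32.\<close>
  define Inv where "Inv e row' R' \<longleftrightarrow> env R' \<and> R' reg_w = Word (2 ^ e) \<and>
      blocks_sorted ?le (2 ^ e) L (S_row row') \<and> row_mset L (S_row row') = row_mset L (S_row row) \<and>
      (0 < e \<longrightarrow> (\<forall>t < L. X_row row' t = S_row row' t)) \<and> (\<forall>j < m. row' j = row j)"
    for e row' and R' :: "'a regs"
  let ?body = "for_t (Reg reg_L) merge_body @ for_t (Reg reg_L) copy_back @
      [Assign reg_w (Mul (Const 2) (Reg reg_w))]"
  have "wpp p p ((2 * n + 5) * ((L * 10 + 2 + (L * 4 + 2 + 1)) + 1) + 1)
      [While (Less (Reg reg_w) (Reg reg_L)) ?body] ?post row (R(reg_w := Word 1))"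
  proof (rule wpp_while[where Inv = Inv])
    show "Inv 0 row (R(reg_w := Word 1))"
      using R cell_le_order(3)[of key]
      by (auto simp: Inv_def env_def blocks_sorted_def dest: reflpD)
  next
    fix e row' R' assume e: "e < 2 * n + 5" and inv: "Inv e row' R'"
    have wL: "2 ^ Suc e dvd L" unfolding L_power using e by (intro le_imp_power_dvd) simp
    have "(2::nat) ^ Suc e \<le> L" using wL L_pos by (rule dvd_imp_le)
    have "wpp p p (L * 10 + 2) (for_t (Reg reg_L) merge_body)
        (wpp p p (L * 4 + 2 + 1) (for_t (Reg reg_L) copy_back @ [Assign reg_w (Mul (Const 2) (Reg reg_w))])
          (Inv (Suc e))) row' R'"
    proof (rule wpp_merge_pass[OF p, where w = "2 ^ e"])
      fix row1 R1
      assume 1: "env R1" "R1 reg_w = Word (2 ^ e)" "merged_upto ?le (2 ^ e) (S_row row') L (X_row row1)"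
        "\<And>t. t < L \<Longrightarrow> S_row row1 t = S_row row' t" "\<And>j. j < m \<Longrightarrow> row1 j = row' j"
      have "wpp p p (L * 4 + 2) (for_t (Reg reg_L) copy_back)
          (wpp p p 1 [Assign reg_w (Mul (Const 2) (Reg reg_w))] (Inv (Suc e))) row1 R1"
      proof (rule wpp_copy_back[OF p 1(1,2)])
        fix row2 R2
        assume 2: "env R2" "R2 reg_w = Word (2 ^ e)" "\<And>t. t < L \<Longrightarrow> X_row row2 t = X_row row1 t"
          "\<And>t. t < L \<Longrightarrow> S_row row2 t = X_row row1 t" "\<And>j. j < m \<Longrightarrow> row2 j = row1 j"
        have "row_mset L (S_row row2) = row_mset L (X_row row1)"
          by (rule row_mset_cong) (rule 2(4))
        also have "\<dots> = row_mset L (S_row row)"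
          using 1(3) inv by (simp add: merged_upto_def row_mset_def Inv_def)
        finally have ms: "row_mset L (S_row row2) = row_mset L (S_row row)" .
        have "blocks_sorted ?le (2 ^ Suc e) L (X_row row1)"
          using 1(3) by (simp add: merged_upto_def)
        then have bs: "blocks_sorted ?le (2 ^ Suc e) L (S_row row2)"
          using 2(4) unfolding blocks_sorted_def by simp
        have "Inv (Suc e) row2 (R2(reg_w := Word (2 ^ Suc e)))"
          unfolding Inv_def using ms bs 1(5) 2 inv by (simp add: env_def Inv_def)
        then show "wpp p p 1 [Assign reg_w (Mul (Const 2) (Reg reg_w))] (Inv (Suc e)) row2 R2"
          using 2(2) \<open>2 ^ Suc e \<le> L\<close> L_le by (auto intro!: word_bound_ge)
      qed
      from wpp_append[OF this]
      show "wpp p p (L * 4 + 2 + 1) (for_t (Reg reg_L) copy_back @ [Assign reg_w (Mul (Const 2) (Reg reg_w))])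
          (Inv (Suc e)) row1 R1" .
    qed (use inv wL \<open>2 ^ Suc e \<le> L\<close> less in \<open>auto simp: Inv_def\<close>)
    from wpp_append[OF this]
    have "wpp p p (L * 10 + 2 + (L * 4 + 2 + 1)) ?body (Inv (Suc e)) row' R'" .
    moreover have "(2::nat) ^ e < L" unfolding L_power using e by (intro power_strict_increasing) auto
    ultimately show "holds D p R' (Less (Reg reg_w) (Reg reg_L)) \<and>
        wpp p p (L * 10 + 2 + (L * 4 + 2 + 1)) ?body (Inv (Suc e)) row' R'"
      using inv by (simp add: Inv_def env_def)
  next
    fix row' R' assume inv: "Inv (2 * n + 5) row' R'"
    have w: "R' reg_w = Word L" "env R'" and X: "\<And>t. t < L \<Longrightarrow> X_row row' t = S_row row' t"
      and S: "blocks_sorted ?le L L (S_row row')" "row_mset L (S_row row') = row_mset L (S_row row)"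
        "\<forall>j < m. row' j = row j"
      using inv unfolding Inv_def L_power[symmetric] by simp_all
    have "row_sorted ?le L (X_row row')"
      using X S(1) unfolding blocks_sorted_def row_sorted_def by simp
    moreover have "row_mset L (X_row row') = row_mset L (S_row row')"
      by (rule row_mset_cong) (rule X)
    ultimately show "\<not> holds D p R' (Less (Reg reg_w) (Reg reg_L)) \<and> ?post row' R'"
      using S w by (simp add: env_def)
  qed
  then have "wpp p p 1 [Assign reg_w (Const 1)]
      (wpp p p ((2 * n + 5) * ((L * 10 + 2 + (L * 4 + 2 + 1)) + 1) + 1)
        [While (Less (Reg reg_w) (Reg reg_L)) ?body] ?post) row R"
    using m_pos by (auto intro!: word_bound_ge)
  from wpp_append_cons[OF this]
  have "wpp p p (1 + ((2 * n + 5) * ((L * 10 + 2 + (L * 4 + 2 + 1)) + 1) + 1)) merge_sort ?post row R"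
    by (simp only: merge_sort_def)
  moreover have "1 + ((2 * n + 5) * ((L * 10 + 2 + (L * 4 + 2 + 1)) + 1) + 1) = (2 * n + 5) * (14 * L + 6) + 2"
    by (simp add: algebra_simps)
  ultimately show "wpp p p ((2 * n + 5) * (14 * L + 6) + 2) merge_sort ?post row R"
    by metis
qed

end

section \<open>Local counting sort\<close>

definition key_count :: "(nat \<Rightarrow> nat) \<Rightarrow> nat \<Rightarrow> nat \<Rightarrow> nat" where
  "key_count \<kappa> k v = card {t. t < k \<and> \<kappa> t = v}"

definition key_below :: "(nat \<Rightarrow> nat) \<Rightarrow> nat \<Rightarrow> nat \<Rightarrow> nat" where
  "key_below \<kappa> L v = card {t. t < L \<and> \<kappa> t < v}"

text \<open>The first summand is what the prefix sums leave in the counter of a key, the second is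
  how often that counter has been incremented when \<open>t\<close> is reached.\<close>

definition stable_pos :: "(nat \<Rightarrow> nat) \<Rightarrow> nat \<Rightarrow> nat \<Rightarrow> nat" where
  "stable_pos \<kappa> L t = key_below \<kappa> L (\<kappa> t) + key_count \<kappa> t (\<kappa> t)"

lemma key_count_0 [simp]: "key_count \<kappa> 0 v = 0"
  by (simp add: key_count_def)

lemma key_count_Suc: "key_count \<kappa> (Suc k) v = key_count \<kappa> k v + (if \<kappa> k = v then 1 else 0)"
proof -
  have "{t. t < Suc k \<and> \<kappa> t = v} = (if \<kappa> k = v then insert k {t. t < k \<and> \<kappa> t = v} else {t. t < k \<and> \<kappa> t = v})"
    by (auto simp: less_Suc_eq)
  then show ?thesis by (simp add: key_count_def)
qed

lemma key_count_le: "key_count \<kappa> k v \<le> k"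
  unfolding key_count_def using card_mono[of "{..<k}" "{t. t < k \<and> \<kappa> t = v}"] by auto

lemma key_below_0 [simp]: "key_below \<kappa> L 0 = 0"
  by (simp add: key_below_def)

lemma key_below_Suc: "key_below \<kappa> L (Suc v) = key_below \<kappa> L v + key_count \<kappa> L v"
proof -
  have "{t. t < L \<and> \<kappa> t < Suc v} = {t. t < L \<and> \<kappa> t < v} \<union> {t. t < L \<and> \<kappa> t = v}" by auto
  moreover have "card \<dots> = card {t. t < L \<and> \<kappa> t < v} + card {t. t < L \<and> \<kappa> t = v}"
    by (rule card_Un_disjoint) auto
  ultimately show ?thesis by (simp add: key_below_def key_count_def)
qed

lemma key_below_le: "key_below \<kappa> L v \<le> L"
  unfolding key_below_def using card_mono[of "{..<L}" "{t. t < L \<and> \<kappa> t < v}"] by auto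

lemma stable_pos_eq:
  assumes "t < L"
  shows "stable_pos \<kappa> L t = card {s. s < L \<and> (\<kappa> s < \<kappa> t \<or> \<kappa> s = \<kappa> t \<and> s < t)}"
proof -
  have "{s. s < L \<and> (\<kappa> s < \<kappa> t \<or> \<kappa> s = \<kappa> t \<and> s < t)} =
      {s. s < L \<and> \<kappa> s < \<kappa> t} \<union> {s. s < t \<and> \<kappa> s = \<kappa> t}" using assms by auto
  moreover have "card \<dots> = card {s. s < L \<and> \<kappa> s < \<kappa> t} + card {s. s < t \<and> \<kappa> s = \<kappa> t}"
    by (rule card_Un_disjoint) auto
  ultimately show ?thesis by (simp add: stable_pos_def key_below_def key_count_def)
qed

lemma stable_pos_less:
  assumes "t < L" "t' < L" "\<kappa> t < \<kappa> t' \<or> \<kappa> t = \<kappa> t' \<and> t < t'"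
  shows "stable_pos \<kappa> L t < stable_pos \<kappa> L t'"
  unfolding stable_pos_eq[OF assms(1)] stable_pos_eq[OF assms(2)]
  by (rule psubset_card_mono) (use assms in auto)

text \<open>The position counts the predecessors in the lexicographic order of keys and indices, so
  it is strictly monotone for that linear order, hence injective.\<close>

lemma bij_betw_stable_pos: "bij_betw (stable_pos \<kappa> L) {..<L} {..<L}"
proof (rule bij_betw_endo)
  show "inj_on (stable_pos \<kappa> L) {..<L}"
  proof (rule inj_onI)
    fix t t' assume *: "t \<in> {..<L}" "t' \<in> {..<L}" "stable_pos \<kappa> L t = stable_pos \<kappa> L t'"
    show "t = t'"
      using * stable_pos_less[of t L t' \<kappa>] stable_pos_less[of t' L t \<kappa>]
      by (cases "\<kappa> t" "\<kappa> t'" rule: linorder_cases; cases t t' rule: linorder_cases) auto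
  qed
  have "stable_pos \<kappa> L t < L" if "t < L" for t
  proof -
    have "card {s. s < L \<and> (\<kappa> s < \<kappa> t \<or> \<kappa> s = \<kappa> t \<and> s < t)} < card {..<L}"
      by (rule psubset_card_mono) (use that in auto)
    then show ?thesis using that by (simp add: stable_pos_eq)
  qed
  then show "stable_pos \<kappa> L ` {..<L} \<subseteq> {..<L}" by auto
qed simp

lemma stable_pos_sorts:
  assumes X: "\<And>t. t < L \<Longrightarrow> X (stable_pos \<kappa> L t) = S t"
    and le: "\<And>t t'. t < L \<Longrightarrow> t' < L \<Longrightarrow> \<kappa> t \<le> \<kappa> t' \<Longrightarrow> le (S t) (S t')"
  shows "row_sorted le L X" and "row_mset L X = row_mset L S"
proof -
  show "row_sorted le L X"
    unfolding row_sorted_def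
  proof (intro allI impI)
    fix a b assume ab: "a \<le> b" "b < L"
    have "a \<in> stable_pos \<kappa> L ` {..<L}" "b \<in> stable_pos \<kappa> L ` {..<L}"
      using ab bij_betw_imp_surj_on[OF bij_betw_stable_pos] by auto
    then obtain t t' where t: "t < L" "t' < L" "a = stable_pos \<kappa> L t" "b = stable_pos \<kappa> L t'" by auto
    then have "\<not> \<kappa> t' < \<kappa> t" using stable_pos_less[of t' L t \<kappa>] ab by auto
    then show "le (X a) (X b)" using t le X by simp
  qed
  have "row_mset L X = (\<Sum>t<L. {#X (stable_pos \<kappa> L t)#})"
    unfolding row_mset_def by (rule sum.reindex_bij_betw[OF bij_betw_stable_pos, symmetric])
  then show "row_mset L X = row_mset L S" using X by (simp add: row_mset_def)
qed

text \<open>Padding gets the key \<open>Num_Cols\<close>, above all labels. There are thus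
  \<open>m + 1\<close> counters, and the loops over them run up to
  \<open>Num_Cols + 1\<close>.\<close>

definition load_key :: "instr list" where
  "load_key = [Read reg_v Proc_Id (S_col (Reg reg_t)),
     Cond (Is_Item reg_v) [Assign reg_u (Label reg_v)] [Assign reg_u Num_Cols],
     Read reg_j Proc_Id (Z_col (Reg reg_u))]"

definition store_counter :: "instr list" where
  "store_counter = [Assign reg_j (Add (Reg reg_j) (Const 1)), Write Proc_Id (Z_col (Reg reg_u)) reg_j]"

definition clear_body :: "instr list" where
  "clear_body = [Assign reg_j (Const 0), Write Proc_Id (Z_col (Reg reg_t)) reg_j]"

definition prefix_body :: "instr list" where
  "prefix_body = [Read reg_j Proc_Id (Z_col (Reg reg_t)), Write Proc_Id (Z_col (Reg reg_t)) reg_w,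
     Assign reg_w (Add (Reg reg_w) (Reg reg_j))]"

definition counting_sort :: "instr list" where
  "counting_sort =
     for_t (Add Num_Cols (Const 1)) clear_body @
     for_t (Reg reg_L) (load_key @ store_counter) @
     Assign reg_w (Const 0) #
     for_t (Add Num_Cols (Const 1)) prefix_body @
     for_t (Reg reg_L) (load_key @ Write Proc_Id (X_col (Reg reg_j)) reg_v # store_counter)"

section \<open>Correctness and time of the counting sort program\<close>

context dmm_square
begin

definition Z_row :: "(nat \<Rightarrow> 'a cell) \<Rightarrow> nat \<Rightarrow> 'a cell" where "Z_row row v = row (96 * m + v)"

definition label_key :: "'a cell \<Rightarrow> nat" where
  "label_key x = (case x of Item y \<Rightarrow> item_label D y | Word _ \<Rightarrow> m)"

definition keeps :: "(nat \<Rightarrow> 'a cell) \<Rightarrow> (nat \<Rightarrow> 'a cell) \<Rightarrow> bool" where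
  "keeps row row' \<longleftrightarrow> (\<forall>t < L. S_row row' t = S_row row t) \<and> (\<forall>j < m. row' j = row j)"

lemma keeps_Z: "keeps row row' \<Longrightarrow> v \<le> m \<Longrightarrow> keeps row (row'(96 * m + v := x))"
  using L_le m_pos by (auto simp: keeps_def S_row_def)

lemma keeps_X: "keeps row row' \<Longrightarrow> t < L \<Longrightarrow> keeps row (row'(32 * m + t := x))"
  using L_le m_pos by (auto simp: keeps_def S_row_def)

lemma Z_row_upd: "Z_row (row(96 * m + v := x)) = (Z_row row)(v := x)"
  by (auto simp: Z_row_def)

lemma Z_row_upd_X: "t < L \<Longrightarrow> Z_row (row(32 * m + t := x)) = Z_row row"
  using L_le m_pos by (auto simp: Z_row_def)

lemma wpp_clear:
  assumes p: "p < m" and R: "env R"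
    and Q: "\<And>row' R'. env R' \<Longrightarrow> keeps row row' \<Longrightarrow> (\<And>v. v \<le> m \<Longrightarrow> Z_row row' v = Word 0) \<Longrightarrow> Q row' R'"
  shows "wpp p p ((m + 1) * 4 + 2) (for_t (Add Num_Cols (Const 1)) clear_body) Q row R"
proof -
  define Inv where "Inv k row' R' \<longleftrightarrow> env R' \<and> R' reg_t = Word k \<and> keeps row row' \<and>
      (\<forall>v<k. Z_row row' v = Word 0)" for k row' and R' :: "'a regs"
  have "wpp p p ((m + 1) * (2 + 2) + 2) (for_t (Add Num_Cols (Const 1)) clear_body) Q row R"
  proof (rule wpp_for_t[where Inv = Inv])
    show "Inv 0 row (R(reg_t := Word 0))" using R by (simp add: Inv_def env_def keeps_def)
  next
    fix k row' R' assume k: "k < m + 1" and inv: "Inv k row' R'"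
    have "Inv (Suc k) (row'(96 * m + k := Word 0)) (R'(reg_j := Word 0, reg_t := Word (Suc k)))"
      using inv k keeps_Z by (auto simp: Inv_def env_def Z_row_upd less_Suc_eq)
    then show "wpp p p 2 clear_body (\<lambda>row R. R reg_t = Word k \<and> Inv (Suc k) row (R(reg_t := Word (Suc k)))) row' R'"
      using inv p k m_pos by (auto simp: clear_body_def Inv_def Z_col_def intro!: usableI)
  qed (use m_pos Q in \<open>auto simp: Inv_def env_def less_Suc_eq_le\<close>)
  then show ?thesis by simp
qed

lemma wpp_prefix:
  assumes p: "p < m" and R: "env R" "R reg_w = Word 0"
    and Z: "\<And>v. v \<le> m \<Longrightarrow> Z_row row v = Word (key_count \<kappa> L v)"
    and Q: "\<And>row' R'. env R' \<Longrightarrow> keeps row row' \<Longrightarrow>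
      (\<And>v. v \<le> m \<Longrightarrow> Z_row row' v = Word (key_below \<kappa> L v)) \<Longrightarrow> Q row' R'"
  shows "wpp p p ((m + 1) * 5 + 2) (for_t (Add Num_Cols (Const 1)) prefix_body) Q row R"
proof -
  define Inv where "Inv k row' R' \<longleftrightarrow> env R' \<and> R' reg_t = Word k \<and> R' reg_w = Word (key_below \<kappa> L k) \<and>
      keeps row row' \<and> (\<forall>v<k. Z_row row' v = Word (key_below \<kappa> L v)) \<and>
      (\<forall>v. k \<le> v \<longrightarrow> v \<le> m \<longrightarrow> Z_row row' v = Word (key_count \<kappa> L v))" for k row' and R' :: "'a regs"
  have "wpp p p ((m + 1) * (3 + 2) + 2) (for_t (Add Num_Cols (Const 1)) prefix_body) Q row R"
  proof (rule wpp_for_t[where Inv = Inv])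
    show "Inv 0 row (R(reg_t := Word 0))" using R Z by (simp add: Inv_def env_def keeps_def)
  next
    fix k row' R' assume k: "k < m + 1" and inv: "Inv k row' R'"
    have "Inv (Suc k) (row'(96 * m + k := Word (key_below \<kappa> L k)))
        (R'(reg_j := Word (key_count \<kappa> L k), reg_w := Word (key_below \<kappa> L k + key_count \<kappa> L k), reg_t := Word (Suc k)))"
      using inv k keeps_Z by (auto simp: Inv_def env_def Z_row_upd less_Suc_eq key_below_Suc)
    moreover have "row' (96 * m + k) = Word (key_count \<kappa> L k)"
      using inv k by (simp add: Inv_def Z_row_def)
    moreover have "key_below \<kappa> L k + key_count \<kappa> L k \<le> word_bound"
      using key_below_le[of \<kappa> L "Suc k"] L_le by (intro word_bound_ge) (simp add: key_below_Suc)
    ultimately show "wpp p p 3 prefix_body (\<lambda>row R. R reg_t = Word k \<and> Inv (Suc k) row (R(reg_t := Word (Suc k)))) row' R'"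
      using inv p k m_pos by (auto simp: prefix_body_def Inv_def Z_col_def intro!: usableI)
  qed (use m_pos Q in \<open>auto simp: Inv_def env_def less_Suc_eq_le\<close>)
  then show ?thesis by simp
qed

lemma wpp_load_key:
  assumes p: "p < m" and R: "env R" "R reg_t = Word k" and k: "k < L"
    and S: "S_row row k = x" "label_key x \<le> m" and Z: "Z_row row (label_key x) = Word z"
    and Q: "wpp p p u ys Q row (R(reg_v := x, reg_u := Word (label_key x), reg_j := Word z))"
  shows "wpp p p (4 + u) (load_key @ ys) Q row R"
proof (rule wpp_append)
  show "wpp p p 4 load_key (wpp p p u ys Q) row R"
    using assms L_le m_pos
    by (cases x) (auto simp: load_key_def S_col_def Z_col_def S_row_def Z_row_def label_key_def
        intro!: usableI word_bound_ge)
qed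

lemma wpp_count:
  assumes p: "p < m" and R: "env R"
    and \<kappa>: "\<And>t. t < L \<Longrightarrow> \<kappa> t = label_key (S_row row t) \<and> \<kappa> t \<le> m"
    and Z: "\<And>v. v \<le> m \<Longrightarrow> Z_row row v = Word 0"
    and Q: "\<And>row' R'. env R' \<Longrightarrow> keeps row row' \<Longrightarrow>
      (\<And>v. v \<le> m \<Longrightarrow> Z_row row' v = Word (key_count \<kappa> L v)) \<Longrightarrow> Q row' R'"
  shows "wpp p p (L * 8 + 2) (for_t (Reg reg_L) (load_key @ store_counter)) Q row R"
proof -
  define Inv where "Inv k row' R' \<longleftrightarrow> env R' \<and> R' reg_t = Word k \<and> keeps row row' \<and>
      (\<forall>v \<le> m. Z_row row' v = Word (key_count \<kappa> k v))" for k row' and R' :: "'a regs"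
  have "wpp p p (L * (6 + 2) + 2) (for_t (Reg reg_L) (load_key @ store_counter)) Q row R"
  proof (rule wpp_for_t[where Inv = Inv])
    show "Inv 0 row (R(reg_t := Word 0))" using R Z by (simp add: Inv_def env_def keeps_def)
  next
    fix k row' R' assume k: "k < L" and inv: "Inv k row' R'"
    define Post where "Post row R \<longleftrightarrow> R reg_t = Word k \<and> Inv (Suc k) row (R(reg_t := Word (Suc k)))"
      for row R
    let ?x = "S_row row k"
    let ?z = "key_count \<kappa> k (\<kappa> k)"
    have x: "label_key ?x = \<kappa> k" "\<kappa> k \<le> m" using \<kappa>[OF k] by auto
    have "Inv (Suc k) (row'(96 * m + \<kappa> k := Word (Suc ?z)))
        (R'(reg_v := ?x, reg_u := Word (\<kappa> k), reg_j := Word ?z, reg_j := Word (Suc ?z), reg_t := Word (Suc k)))"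
      using inv x keeps_Z by (auto simp: Inv_def env_def Z_row_upd key_count_Suc)
    moreover have "Suc ?z \<le> word_bound"
      using key_count_le[of \<kappa> k "\<kappa> k"] k L_le by (intro word_bound_ge) simp
    ultimately have "wpp p p 2 store_counter Post row' (R'(reg_v := ?x, reg_u := Word (label_key ?x), reg_j := Word ?z))"
      using inv p x m_pos by (auto simp: store_counter_def Post_def Inv_def Z_col_def intro!: usableI)
    then have "wpp p p (4 + 2) (load_key @ store_counter) Post row' R'"
      using inv x k by (intro wpp_load_key[OF p]) (auto simp: Inv_def keeps_def)
    then show "wpp p p 6 (load_key @ store_counter)
        (\<lambda>row R. R reg_t = Word k \<and> Inv (Suc k) row (R(reg_t := Word (Suc k)))) row' R'"
      unfolding Post_def by simp
  qed (use L_le Q in \<open>auto simp: Inv_def env_def\<close>)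
  then show ?thesis by simp
qed

text \<open>The counter of key \<open>v\<close> always holds the place for the next element with
  that key. At time \<open>k\<close> the counter of \<open>\<kappa> k\<close> is therefore
  \<open>stable_pos \<kappa> L k\<close>, and injectivity of \<open>stable_pos\<close> protects what
  has been placed.\<close>

lemma wpp_place:
  assumes p: "p < m" and R: "env R"
    and \<kappa>: "\<And>t. t < L \<Longrightarrow> \<kappa> t = label_key (S_row row t) \<and> \<kappa> t \<le> m"
    and Z: "\<And>v. v \<le> m \<Longrightarrow> Z_row row v = Word (key_below \<kappa> L v)"
    and Q: "\<And>row' R'. env R' \<Longrightarrow> keeps row row' \<Longrightarrow>
      (\<And>t. t < L \<Longrightarrow> X_row row' (stable_pos \<kappa> L t) = S_row row t) \<Longrightarrow> Q row' R'"
  shows "wpp p p (L * 9 + 2) (for_t (Reg reg_L)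
    (load_key @ Write Proc_Id (X_col (Reg reg_j)) reg_v # store_counter)) Q row R"
proof -
  define Inv where "Inv k row' R' \<longleftrightarrow> env R' \<and> R' reg_t = Word k \<and> keeps row row' \<and>
      (\<forall>v \<le> m. Z_row row' v = Word (key_below \<kappa> L v + key_count \<kappa> k v)) \<and>
      (\<forall>t < k. X_row row' (stable_pos \<kappa> L t) = S_row row t)" for k row' and R' :: "'a regs"
  let ?body = "load_key @ Write Proc_Id (X_col (Reg reg_j)) reg_v # store_counter"
  have pos: "stable_pos \<kappa> L t < L" if "t < L" for t
    using bij_betwE[OF bij_betw_stable_pos] that by blast
  have "wpp p p (L * (7 + 2) + 2) (for_t (Reg reg_L) ?body) Q row R"
  proof (rule wpp_for_t[where Inv = Inv])
    show "Inv 0 row (R(reg_t := Word 0))" using R Z by (simp add: Inv_def env_def keeps_def)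
  next
    fix k row' R' assume k: "k < L" and inv: "Inv k row' R'"
    define Post where "Post row R \<longleftrightarrow> R reg_t = Word k \<and> Inv (Suc k) row (R(reg_t := Word (Suc k)))"
      for row R
    let ?x = "S_row row k"
    let ?z = "stable_pos \<kappa> L k"
    have x: "label_key ?x = \<kappa> k" "\<kappa> k \<le> m" using \<kappa>[OF k] by auto
    have z: "?z = key_below \<kappa> L (\<kappa> k) + key_count \<kappa> k (\<kappa> k)" by (simp add: stable_pos_def)
    have new: "stable_pos \<kappa> L t \<noteq> ?z" if "t < k" for t
      using bij_betw_imp_inj_on[OF bij_betw_stable_pos[of \<kappa> L]] that k by (auto simp: inj_on_def)
    let ?row = "row'(32 * m + ?z := ?x, 96 * m + \<kappa> k := Word (Suc ?z))"
    have "X_row ?row (stable_pos \<kappa> L t) = S_row row t" if "t < Suc k" for t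
    proof -
      have "stable_pos \<kappa> L t < L" using that k by (intro pos) simp
      then show ?thesis
        using inv that new[of t] L_le m_pos by (auto simp: X_row_def Inv_def less_Suc_eq)
    qed
    moreover have "keeps row ?row" using inv k x by (intro keeps_Z keeps_X pos) (auto simp: Inv_def)
    moreover have "Z_row ?row v = Word (key_below \<kappa> L v + key_count \<kappa> (Suc k) v)" if "v \<le> m" for v
      using inv that z unfolding Z_row_upd Z_row_upd_X[OF pos[OF k]]
      by (auto simp: Inv_def key_count_Suc)
    ultimately have "Inv (Suc k) ?row
        (R'(reg_v := ?x, reg_u := Word (\<kappa> k), reg_j := Word ?z, reg_j := Word (Suc ?z), reg_t := Word (Suc k)))"
      using inv by (auto simp: Inv_def env_def)
    moreover have "Suc ?z \<le> word_bound"
      using pos[OF k] L_le by (intro word_bound_ge) simp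
    ultimately have "wpp p p 3 (Write Proc_Id (X_col (Reg reg_j)) reg_v # store_counter) Post row'
        (R'(reg_v := ?x, reg_u := Word (label_key ?x), reg_j := Word ?z))"
      using inv p x m_pos pos[OF k] L_le
      by (auto simp: store_counter_def Post_def Inv_def Z_col_def X_col_def intro!: usableI)
    then have "wpp p p (4 + 3) ?body Post row' R'"
      using inv x k z by (intro wpp_load_key[OF p]) (auto simp: Inv_def keeps_def)
    then show "wpp p p 7 ?body
        (\<lambda>row R. R reg_t = Word k \<and> Inv (Suc k) row (R(reg_t := Word (Suc k)))) row' R'"
      unfolding Post_def by simp
  qed (use L_le Q in \<open>auto simp: Inv_def env_def\<close>)
  then show ?thesis by simp
qed

lemma sorter_counting_sort:
  assumes I: "\<And>x. I x \<Longrightarrow> item_label D x < m"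
  shows "sorter (cell_le (item_label D)) counting_sort (17 * L + 9 * m + 18)"
  unfolding sorter_def
proof (intro allI impI)
  fix p and row :: "nat \<Rightarrow> 'a cell" and R
  assume p: "p < m" and R: "env R" and ok: "\<forall>j. cell_ok (row j)"
  let ?le = "cell_le (item_label D)"
  let ?post = "\<lambda>row' R'. env R' \<and> row_sorted ?le L (X_row row') \<and>
       row_mset L (X_row row') = row_mset L (S_row row) \<and> (\<forall>j < m. row' j = row j)"
  define \<kappa> where "\<kappa> t = label_key (S_row row t)" for t
  have label: "label_key (S_row row t) \<le> m" for t
    using ok[rule_format, of "64 * m + t"] I
    by (cases "row (64 * m + t)") (auto simp: label_key_def S_row_def intro: less_imp_le)
  let ?p1 = "for_t (Add Num_Cols (Const 1)) clear_body"
  let ?p2 = "for_t (Reg reg_L) (load_key @ store_counter)"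
  let ?p3 = "for_t (Add Num_Cols (Const 1)) prefix_body"
  let ?p4 = "for_t (Reg reg_L) (load_key @ Write Proc_Id (X_col (Reg reg_j)) reg_v # store_counter)"
  have keeps_\<kappa>: "\<kappa> t = label_key (S_row row' t) \<and> \<kappa> t \<le> m" if "keeps row row'" "t < L" for row' t
    using that label by (auto simp: \<kappa>_def keeps_def)
  have keeps_trans: "keeps row row1 \<Longrightarrow> keeps row1 row2 \<Longrightarrow> keeps row row2" for row1 row2
    by (simp add: keeps_def)
  \<comment> \<open>Labels of items are below \<open>m\<close>, the key of padding. So if the second
    cell is an item, a smaller or equal key makes the first one an item as well.\<close>
  have le: "?le (S_row row t) (S_row row t')" if "\<kappa> t \<le> \<kappa> t'" for t t'
  proof (cases "S_row row t'")
    case (Item y)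
    then have "I y" using ok[rule_format, of "64 * m + t'"] by (simp add: S_row_def)
    then show ?thesis using that I[of y] Item
      by (auto simp: \<kappa>_def label_key_def cell_le_def split: cell.splits)
  qed (simp add: cell_le_def)
  have 4: "wpp p p (L * 9 + 2) ?p4 ?post row3 R3"
    if R3: "env R3" and k: "keeps row row3" and Z: "\<And>v. v \<le> m \<Longrightarrow> Z_row row3 v = Word (key_below \<kappa> L v)"
    for row3 R3
  proof (rule wpp_place[OF p R3 keeps_\<kappa>[OF k] Z])
    fix row' R' assume 1: "env R'" "keeps row3 row'"
      "\<And>t. t < L \<Longrightarrow> X_row row' (stable_pos \<kappa> L t) = S_row row3 t"
    have "X_row row' (stable_pos \<kappa> L t) = S_row row t" if "t < L" for t
      using 1(3)[OF that] k that by (simp add: keeps_def)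
    with le have "row_sorted ?le L (X_row row')" "row_mset L (X_row row') = row_mset L (S_row row)"
      by (auto intro: stable_pos_sorts[where \<kappa> = \<kappa>])
    then show "?post row' R'" using 1 keeps_trans[OF k 1(2)] by (auto simp: keeps_def)
  qed
  have 3: "wpp p p (1 + ((m + 1) * 5 + 2 + (L * 9 + 2))) (Assign reg_w (Const 0) # ?p3 @ ?p4) ?post row2 R2"
    if R2: "env R2" and k: "keeps row row2" and Z: "\<And>v. v \<le> m \<Longrightarrow> Z_row row2 v = Word (key_count \<kappa> L v)"
    for row2 R2
  proof (rule wpp_append_cons)
    have "wpp p p ((m + 1) * 5 + 2) ?p3 (wpp p p (L * 9 + 2) ?p4 ?post) row2 (R2(reg_w := Word 0))"
      by (rule wpp_prefix[OF p _ _ Z]) (use R2 4 keeps_trans[OF k] in \<open>auto simp: env_def\<close>)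
    from wpp_append[OF this]
    show "wpp p p 1 [Assign reg_w (Const 0)]
        (wpp p p ((m + 1) * 5 + 2 + (L * 9 + 2)) (?p3 @ ?p4) ?post) row2 R2" by simp
  qed
  have 2: "wpp p p (L * 8 + 2 + (1 + ((m + 1) * 5 + 2 + (L * 9 + 2))))
      (?p2 @ Assign reg_w (Const 0) # ?p3 @ ?p4) ?post row1 R1"
    if R1: "env R1" and k: "keeps row row1" and Z: "\<And>v. v \<le> m \<Longrightarrow> Z_row row1 v = Word 0"
    for row1 R1
    by (rule wpp_append, rule wpp_count[OF p R1 keeps_\<kappa>[OF k] Z])
      (use 3 keeps_trans[OF k] in auto)
  have "wpp p p ((m + 1) * 4 + 2 + (L * 8 + 2 + (1 + ((m + 1) * 5 + 2 + (L * 9 + 2)))))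
      (?p1 @ ?p2 @ Assign reg_w (Const 0) # ?p3 @ ?p4) ?post row R"
    by (rule wpp_append, rule wpp_clear[OF p R]) (use 2 in auto)
  moreover have "(m + 1) * 4 + 2 + (L * 8 + 2 + (1 + ((m + 1) * 5 + 2 + (L * 9 + 2)))) = 17 * L + 9 * m + 18"
    by simp
  ultimately show "wpp p p (17 * L + 9 * m + 18) counting_sort ?post row R"
    unfolding counting_sort_def by metis
qed

end

section \<open>The routing phases\<close>

context dmm_machine
begin

lemma gwp_seq:
  assumes "gwp t xs P M Rs" "\<And>M' Rs'. state_ok M' Rs' \<Longrightarrow> P M' Rs' \<Longrightarrow> gwp u ys Q M' Rs'"
  shows "gwp (t + u) (xs @ ys) Q M Rs"
  by (rule gwp_append, rule gwp_mono[OF assms(1)], rule assms(2))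

end

definition W_exp :: exp where "W_exp = Mul (Const 16) (Reg reg_N)"
definition index_exp :: exp where "index_exp = Add (Mul Proc_Id (Reg reg_L)) (Reg reg_t)"
definition size_exp :: exp where "size_exp = Mul Num_Cols Num_Cols"

definition deal_route :: "exp \<Rightarrow> exp \<Rightarrow> instr list" where
  "deal_route g h = route (Less Proc_Id (Reg reg_N)) (X_col g) h (S_col (Reg reg_t))"

definition within_route :: "instr list" where
  "within_route = deal_route (Reg reg_t) (Add (Mul (Div Proc_Id (Reg reg_q)) (Reg reg_q))
     (Mod (Add (Mod Proc_Id (Reg reg_q)) (Reg reg_t)) (Reg reg_q)))"

definition across_route :: "instr list" where
  "across_route = deal_route (Reg reg_t) (Mod (Add Proc_Id (Mul (Reg reg_q) (Reg reg_t))) (Reg reg_N))"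

definition relayout_exp :: exp where
  "relayout_exp = Mod (Add (Mul (Const 32) Proc_Id) (Reg reg_t)) (Reg reg_L)"

definition relayout_route :: "instr list" where
  "relayout_route = deal_route relayout_exp (Div relayout_exp (Const 32))"

definition eq_test :: "exp \<Rightarrow> exp \<Rightarrow> test" where
  "eq_test a b = Conj (Neg (Less a b)) (Neg (Less b a))"

text \<open>The \<open>m\<close> rows are folded onto \<open>N\<close> rows in rounds of
  \<open>m\<close> steps. In one round the active processors share \<open>p div N\<close> and hence
  have distinct remainders modulo \<open>N\<close>. As \<open>m < 4 * N\<close>, four rounds
  suffice, and they fit into \<open>L\<close> steps. Cells that receive nothing keep the initial
  word 0, which is the padding.\<close>

definition load_route :: "instr list" where
  "load_route = route (eq_test (Div (Reg reg_t) Num_Cols) (Div Proc_Id (Reg reg_N)))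
     (Mod (Reg reg_t) Num_Cols) (Mod Proc_Id (Reg reg_N)) (S_col (Reg reg_t))"

definition shift_route :: "instr list" where
  "shift_route = route (Conj (Less Proc_Id (Reg reg_N)) (Neg (Less index_exp W_exp)))
     (X_col (Reg reg_t)) (Div (Sub index_exp W_exp) (Reg reg_L))
     (S_col (Mod (Sub index_exp W_exp) (Reg reg_L)))"

definition output_first_route :: "instr list" where
  "output_first_route = route (Conj (Less Proc_Id (Const 1)) (Conj (Less (Reg reg_t) W_exp) (Less (Reg reg_t) size_exp)))
     (X_col (Reg reg_t)) (Div (Reg reg_t) Num_Cols) (Mod (Reg reg_t) Num_Cols)"

definition output_shifted_route :: "instr list" where
  "output_shifted_route = route (Conj (Less Proc_Id (Reg reg_N)) (Less (Add index_exp W_exp) size_exp))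
     (X_col (Reg reg_t)) (Div (Add index_exp W_exp) Num_Cols) (Mod (Add index_exp W_exp) Num_Cols)"

definition preamble :: "instr list" where
  "preamble = [Assign reg_q (Const 1),
     While (Neg (Less Num_Cols (Mul (Const 4) (Mul (Reg reg_q) (Reg reg_q))))) [Assign reg_q (Mul (Const 2) (Reg reg_q))],
     Assign reg_N (Mul (Reg reg_q) (Reg reg_q)), Assign reg_L (Mul (Const 32) (Reg reg_N))]"

definition deal_round :: "instr list \<Rightarrow> instr list" where
  "deal_round srt = (srt @ within_route) @ (srt @ across_route) @ (srt @ relayout_route)"

text \<open>The first half of row 0 is output before the second sort, because that sort overwrites
  the \<open>X\<close> columns.\<close>

definition finish :: "instr list \<Rightarrow> instr list" where
  "finish srt = srt @ output_first_route @ shift_route @ srt @ output_shifted_route"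

definition mesh_sort :: "instr list \<Rightarrow> instr list" where
  "mesh_sort srt = preamble @ load_route @ (deal_round srt @ deal_round srt) @ finish srt"

fun real_item :: "'a cell \<Rightarrow> bool" where
  "real_item (Item _) = True" | "real_item (Word _) = False"

text \<open>At equal times the linear indices held by different processors are at least
  \<open>l \<ge> d\<close> apart, so they fall into different rows of length \<open>d\<close>. This
  makes the shift and the output of the shifted rows free of conflicts.\<close>

lemma div_add_multiple_less:
  assumes "0 < d" "d \<le> l" "p < (p'::nat)" "p * l + s \<ge> r"
  shows "(p * l + s - r) div d < (p' * l + s - r) div d"
proof -
  have "Suc p * l \<le> p' * l" using assms(3) by (intro mult_le_mono1) simp
  then have "p * l + s - r + d \<le> p' * l + s - r" using assms(2,4) by simp
  from div_le_mono[OF this, of d] show ?thesis using assms(1) by simp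
qed

lemma div_add_multiple_inj:
  assumes "0 < d" "d \<le> l" "p * l + s \<ge> r" "p' * l + s \<ge> (r::nat)"
    "(p * l + s - r) div d = (p' * l + s - r) div d"
  shows "p = p'"
  using div_add_multiple_less[OF assms(1,2) _ assms(3)] div_add_multiple_less[OF assms(1,2) _ assms(4)] assms(5)
  by (metis linorder_neqE_nat nat_neq_iff)

lemma index_eq_iff:
  assumes "t < l" "t' < l" "p * l + t = p' * l + (t'::nat)"
  shows "p = p' \<and> t = t'"
  using assms pair_eq_iff[of t l t' p p'] by simp

context dmm_square
begin

lemma gwp_sort:
  assumes srt: "sorter le srt u" and env0: "\<forall>p < m. env (Rs p)"
    and Q: "\<And>M' Rs'. state_ok M' Rs' \<Longrightarrow> \<forall>p < m. env (Rs' p) \<Longrightarrow>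
      (\<And>p. p < m \<Longrightarrow> row_sorted le L (X_row (M' p)) \<and>
        row_mset L (X_row (M' p)) = row_mset L (S_row (M p)) \<and> (\<forall>j < m. M' p j = M p j)) \<Longrightarrow> Q M' Rs'"
  shows "gwp u srt Q M Rs"
proof (rule gwp_ok)
  assume ok: "state_ok M Rs"
  show ?thesis
  proof (rule gwp_local[where Q = "\<lambda>p row' R'. env R' \<and> row_sorted le L (X_row row') \<and>
       row_mset L (X_row row') = row_mset L (S_row (M p)) \<and> (\<forall>j < m. row' j = M p j)"])
    fix p assume "p < banks D"
    then show "wpp p p u srt (\<lambda>row' R'. env R' \<and> row_sorted le L (X_row row') \<and>
       row_mset L (X_row row') = row_mset L (S_row (M p)) \<and> (\<forall>j < m. row' j = M p j)) (M p) (Rs p)"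
      using srt env0 ok unfolding sorter_def state_ok_def by simp
  qed (rule Q, auto)
qed

lemma gwp_deal_route:
  assumes env0: "\<forall>p < m. env (Rs p)"
    and sorted: "\<And>p. p < m \<Longrightarrow> row_sorted le L (X_row (M p)) \<and> row_mset L (X_row (M p)) = row_mset L (Y p)"
    and ev: "\<And>p t R. p < m \<Longrightarrow> t < L \<Longrightarrow> env R \<Longrightarrow> R reg_t = Word t \<Longrightarrow>
      eval D p R g = G p t \<and> eval D p R h = H p t \<and> G p t < L"
    and bij: "\<And>t. t < L \<Longrightarrow> bij_betw (\<lambda>p. H p t) {..<N} {..<N}"
    and Q: "\<And>M' Rs'. state_ok M' Rs' \<Longrightarrow> \<forall>p < m. env (Rs' p) \<Longrightarrow>
      dealt le N L H G Y (\<lambda>p. S_row (M' p)) \<Longrightarrow> Q M' Rs'"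
  shows "gwp (5 * L + 2) (deal_route g h) Q M Rs"
  unfolding deal_route_def
proof (rule gwp_route[where G = "\<lambda>p t. 32 * m + G p t" and act = "\<lambda>p t. p < N" and H = H
      and K = "\<lambda>p t. 64 * m + t"])
  fix p t and R :: "'a regs" assume "p < m" "t < L" "env R" "R reg_t = Word t"
  then show "eval D p R (X_col g) = 32 * m + G p t \<and> holds D p R (Less Proc_Id (Reg reg_N)) = (p < N) \<and>
      eval D p R h = H p t \<and> eval D p R (S_col (Reg reg_t)) = 64 * m + t"
    using ev by (simp add: X_col_def S_col_def env_def)
next
  have G: "G p t < L" if "p < m" "t < L" for p t
  proof -
    \<comment> \<open>The bound on \<open>G\<close> is available only through \<open>ev\<close>,
      which speaks about registers; some register contents satisfying \<open>env\<close> are needed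
      to extract it.\<close>
    define R :: "'a regs" where "R = (\<lambda>_. Word 0)(0 := Word q, 1 := Word N, 2 := Word L, 3 := Word t)"
    have "env R" "R reg_t = Word t" by (simp_all add: R_def env_def)
    from ev[OF that this] show ?thesis by simp
  qed
  have H: "H p t < N" if "p < N" "t < L" for p t
    using bij_betwE[OF bij[OF that(2)]] that(1) by blast
  {
    fix p t assume "p < m" "t < L"
    then show "32 * m + G p t < 200 * m" using G[of p t] L_le by simp
  }
  {
    fix p t assume "p < m" "t < L" "p < N"
    then show "H p t < m \<and> 64 * m + t < 200 * m" using H[of p t] N_le L_le by simp
  }
  {
    fix p p' t assume "t < L" "p < N" "p' < N" "H p t = H p' t"
    then show "p = p'" using bij_betw_imp_inj_on[OF bij[of t]] by (auto simp: inj_on_def)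
  }
  {
    fix p' t t' assume "p' < m" "t' < L"
    then show "64 * m + t \<noteq> 32 * m + G p' t'" using G[of p' t'] L_le by simp
  }
  {
    fix M' Rs'
    assume "state_ok M' Rs'" "\<forall>p<m. env (Rs' p)"
      and moved: "\<And>p t. p < m \<Longrightarrow> t < L \<Longrightarrow> p < N \<Longrightarrow> M' (H p t) (64 * m + t) = M p (32 * m + G p t)"
    moreover have "dealt le N L H G Y (\<lambda>p. S_row (M' p))"
      unfolding dealt_def S_row_def
      by (rule exI[of _ "\<lambda>p. X_row (M p)"]) (use moved sorted N_le in \<open>auto simp: X_row_def\<close>)
    ultimately show "Q M' Rs'" by (intro Q)
  }
qed (use env0 in auto)

lemma gwp_sort_deal:
  assumes srt: "sorter le srt u" and env0: "\<forall>p < m. env (Rs p)"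
    and ev: "\<And>p t R. p < m \<Longrightarrow> t < L \<Longrightarrow> env R \<Longrightarrow> R reg_t = Word t \<Longrightarrow>
      eval D p R g = G p t \<and> eval D p R h = H p t \<and> G p t < L"
    and bij: "\<And>t. t < L \<Longrightarrow> bij_betw (\<lambda>p. H p t) {..<N} {..<N}"
  shows "gwp (u + (5 * L + 2)) (srt @ deal_route g h)
    (\<lambda>M' Rs'. (\<forall>p < m. env (Rs' p)) \<and> dealt le N L H G (\<lambda>p. S_row (M p)) (\<lambda>p. S_row (M' p))) M Rs"
  by (rule gwp_append, rule gwp_sort[OF srt env0], rule gwp_deal_route[OF _ _ ev bij]) auto

lemma
  assumes srt: "sorter le srt u" and env0: "\<forall>p < m. env (Rs p)"
  shows gwp_within: "gwp (u + (5 * L + 2)) (srt @ within_route) (\<lambda>M' Rs'. (\<forall>p < m. env (Rs' p)) \<and>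
      dealt le N L (deal_within q) (\<lambda>p t. t) (\<lambda>p. S_row (M p)) (\<lambda>p. S_row (M' p))) M Rs"
    and gwp_across: "gwp (u + (5 * L + 2)) (srt @ across_route) (\<lambda>M' Rs'. (\<forall>p < m. env (Rs' p)) \<and>
      dealt le N L (deal_across q) (\<lambda>p t. t) (\<lambda>p. S_row (M p)) (\<lambda>p. S_row (M' p))) M Rs"
    and gwp_relayout: "gwp (u + (5 * L + 2)) (srt @ relayout_route) (\<lambda>M' Rs'. (\<forall>p < m. env (Rs' p)) \<and>
      dealt le N L (\<lambda>p t. relayout L p t div 32) (relayout L) (\<lambda>p. S_row (M p)) (\<lambda>p. S_row (M' p))) M Rs"
proof -
  show "gwp (u + (5 * L + 2)) (srt @ within_route) (\<lambda>M' Rs'. (\<forall>p < m. env (Rs' p)) \<and>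
      dealt le N L (deal_within q) (\<lambda>p t. t) (\<lambda>p. S_row (M p)) (\<lambda>p. S_row (M' p))) M Rs"
    unfolding within_route_def
    by (rule gwp_sort_deal[OF srt env0 _ bij_betw_deal_within[of q, folded N]])
      (simp add: env_def deal_within_def)
  show "gwp (u + (5 * L + 2)) (srt @ across_route) (\<lambda>M' Rs'. (\<forall>p < m. env (Rs' p)) \<and>
      dealt le N L (deal_across q) (\<lambda>p t. t) (\<lambda>p. S_row (M p)) (\<lambda>p. S_row (M' p))) M Rs"
    unfolding across_route_def
    by (rule gwp_sort_deal[OF srt env0 _ bij_betw_deal_across[of q, folded N]])
      (simp add: env_def deal_across_def flip: N)
  show "gwp (u + (5 * L + 2)) (srt @ relayout_route) (\<lambda>M' Rs'. (\<forall>p < m. env (Rs' p)) \<and>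
      dealt le N L (\<lambda>p t. relayout L p t div 32) (relayout L) (\<lambda>p. S_row (M p)) (\<lambda>p. S_row (M' p))) M Rs"
    unfolding relayout_route_def
    by (rule gwp_sort_deal[OF srt env0 _ bij_betw_relayout_div[OF N_pos, folded L]])
      (use L_pos in \<open>simp add: env_def relayout_def relayout_exp_def\<close>)
qed

definition dealt_round :: "('a cell \<Rightarrow> 'a cell \<Rightarrow> bool) \<Rightarrow> (nat \<Rightarrow> nat \<Rightarrow> 'a cell) \<Rightarrow>
    (nat \<Rightarrow> nat \<Rightarrow> 'a cell) \<Rightarrow> bool" where
  "dealt_round le Y Y3 \<longleftrightarrow> (\<exists>Y1 Y2. dealt le N L (deal_within q) (\<lambda>p t. t) Y Y1 \<and>
     dealt le N L (deal_across q) (\<lambda>p t. t) Y1 Y2 \<and>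
     dealt le N L (\<lambda>p t. relayout L p t div 32) (relayout L) Y2 Y3)"

lemma dealt_round_mset:
  assumes "dealt_round le Y Y3"
  shows "(\<Sum>p<N. row_mset L (Y3 p)) = (\<Sum>p<N. row_mset L (Y p))"
proof -
  obtain Y1 Y2 where Y: "dealt le N L (deal_within q) (\<lambda>p t. t) Y Y1"
    "dealt le N L (deal_across q) (\<lambda>p t. t) Y1 Y2"
    "dealt le N L (\<lambda>p t. relayout L p t div 32) (relayout L) Y2 Y3"
    using assms unfolding dealt_round_def by blast
  have id: "bij_betw (\<lambda>t. t) {..<L} {..<L}" by (simp add: bij_betw_def)
  show ?thesis
    using dealt_mset[OF Y(1) bij_betw_deal_within[of q, folded N] id]
      dealt_mset[OF Y(2) bij_betw_deal_across[of q, folded N] id]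
      dealt_mset[OF Y(3) bij_betw_relayout_div[OF N_pos, folded L] bij_betw_relayout[OF L_pos]]
    by simp
qed

lemma two_rounds_near_sorted:
  assumes "dealt_round le Y Y3" "dealt_round le Y3 Y6" "upward le f"
  shows "near_sorted N L (\<lambda>p. cnt f L (Y6 p))"
proof -
  from assms(1,2) obtain Y1 Y2 Y4 Y5 where Y: "dealt le N L (deal_within q) (\<lambda>p t. t) Y Y1"
    "dealt le N L (deal_across q) (\<lambda>p t. t) Y1 Y2"
    "dealt le N L (\<lambda>p t. relayout L p t div 32) (relayout L) Y2 Y3"
    "dealt le N L (deal_within q) (\<lambda>p t. t) Y3 Y4"
    "dealt le N L (deal_across q) (\<lambda>p t. t) Y4 Y5"
    "dealt le N L (\<lambda>p t. relayout L p t div 32) (relayout L) Y5 Y6"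
    unfolding dealt_round_def by blast
  show ?thesis
    using six_deals_near_sorted[OF q_pos L[unfolded N] Y[unfolded N] assms(3)] by (simp add: N)
qed

lemma gwp_deal_round:
  assumes srt: "sorter le srt u" and env0: "\<forall>p < m. env (Rs p)"
  shows "gwp (3 * (u + (5 * L + 2))) (deal_round srt) (\<lambda>M' Rs'. (\<forall>p < m. env (Rs' p)) \<and>
    dealt_round le (\<lambda>p. S_row (M p)) (\<lambda>p. S_row (M' p))) M Rs"
    (is "gwp _ _ ?Q M Rs")
proof -
  let ?v = "u + (5 * L + 2)"
  have "gwp (?v + (?v + ?v)) (deal_round srt) ?Q M Rs"
    unfolding deal_round_def
  proof (rule gwp_seq[OF gwp_within[OF srt env0]], elim conjE)
    fix M1 R1 assume 1: "\<forall>p<m. env (R1 p)"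
      "dealt le N L (deal_within q) (\<lambda>p t. t) (\<lambda>p. S_row (M p)) (\<lambda>p. S_row (M1 p))"
    show "gwp (?v + ?v) ((srt @ across_route) @ srt @ relayout_route) ?Q M1 R1"
    proof (rule gwp_seq[OF gwp_across[OF srt 1(1)]], elim conjE)
      fix M2 R2 assume 2: "\<forall>p<m. env (R2 p)"
        "dealt le N L (deal_across q) (\<lambda>p t. t) (\<lambda>p. S_row (M1 p)) (\<lambda>p. S_row (M2 p))"
      show "gwp ?v (srt @ relayout_route) ?Q M2 R2"
        by (rule gwp_mono[OF gwp_relayout[OF srt 2(1)]])
          (use 1(2) 2(2) in \<open>auto simp: dealt_round_def\<close>)
    qed
  qed
  moreover have "?v + (?v + ?v) = 3 * ?v" by simp
  ultimately show ?thesis by metis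
qed

lemma gwp_two_rounds:
  assumes srt: "sorter le srt u" and env0: "\<forall>p < m. env (Rs p)"
  shows "gwp (6 * (u + (5 * L + 2))) (deal_round srt @ deal_round srt) (\<lambda>M' Rs'. (\<forall>p < m. env (Rs' p)) \<and>
    (\<forall>f. upward le f \<longrightarrow> near_sorted N L (\<lambda>p. cnt f L (S_row (M' p)))) \<and>
    (\<Sum>p<N. row_mset L (S_row (M' p))) = (\<Sum>p<N. row_mset L (S_row (M p)))) M Rs"
    (is "gwp _ _ ?Q M Rs")
proof -
  let ?v = "3 * (u + (5 * L + 2))"
  have "gwp (?v + ?v) (deal_round srt @ deal_round srt) ?Q M Rs"
  proof (rule gwp_seq[OF gwp_deal_round[OF srt env0]], elim conjE)
    fix M1 R1 assume 1: "\<forall>p<m. env (R1 p)" "dealt_round le (\<lambda>p. S_row (M p)) (\<lambda>p. S_row (M1 p))"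
    show "gwp ?v (deal_round srt) ?Q M1 R1"
    proof (rule gwp_mono[OF gwp_deal_round[OF srt 1(1)]], elim conjE)
      fix M2 R2 assume 2: "\<forall>p<m. env (R2 p)" "dealt_round le (\<lambda>p. S_row (M1 p)) (\<lambda>p. S_row (M2 p))"
      show "?Q M2 R2"
        using 2(1) two_rounds_near_sorted[OF 1(2) 2(2)] dealt_round_mset[OF 1(2)] dealt_round_mset[OF 2(2)]
        by simp
    qed
  qed
  moreover have "?v + ?v = 6 * (u + (5 * L + 2))" by simp
  ultimately show ?thesis by metis
qed

end

section \<open>Loading, shifting and output\<close>

lemma eq_if_div_mod: "x div l = y div l \<Longrightarrow> x mod l = y mod l \<Longrightarrow> x = (y::nat)"
  by (metis div_mult_mod_eq)

context dmm_square
begin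

lemma div_mod_index: "j < m \<Longrightarrow> (i * m + j) div m = i \<and> (i * m + j) mod m = j"
  by simp

lemma gwp_load:
  assumes env0: "\<forall>p < m. env (Rs p)"
    and M: "\<And>i j. M i j = (if i < m \<and> j < m then Item (A i j) else Word 0)"
  shows "gwp (5 * L + 2) load_route (\<lambda>M' Rs'. (\<forall>p < m. env (Rs' p)) \<and>
    filter_mset real_item (\<Sum>p<N. row_mset L (S_row (M' p))) = (\<Sum>i<m. \<Sum>j<m. {#Item (A i j)#})) M Rs"
  unfolding load_route_def
proof (rule gwp_route[OF env0, where G = "\<lambda>p t. t mod m" and act = "\<lambda>p t. t div m = p div N"
      and H = "\<lambda>p t. p mod N" and K = "\<lambda>p t. 64 * m + t"])
  fix p t assume "p < m" "t < L"
  have "t mod m < m" using m_pos by simp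
  then show "t mod m < 200 * m" by linarith
next
  fix p t assume "t < L"
  have "p mod N < N" using N_pos by simp
  then show "p mod N < m \<and> 64 * m + t < 200 * m" using \<open>t < L\<close> L_le N_le by simp
next
  fix p p' t assume "t div m = p div N" "t div m = p' div N" "p mod N = p' mod N"
  then show "p = p'" by (intro eq_if_div_mod[of p N p']) simp_all
next
  fix p' t t' assume "p' < m"
  have "t' mod m < m" using m_pos by simp
  then show "64 * m + t \<noteq> t' mod m" by linarith
next
  fix M' Rs'
  assume env': "\<forall>p<m. env (Rs' p)"
    and moved: "\<And>p t. p < m \<Longrightarrow> t < L \<Longrightarrow> t div m = p div N \<Longrightarrow> M' (p mod N) (64 * m + t) = M p (t mod m)"
    and frame: "\<And>i j. (\<And>p t. p < m \<Longrightarrow> t < L \<Longrightarrow> t div m = p div N \<Longrightarrow> \<not> (p mod N = i \<and> 64 * m + t = j)) \<Longrightarrow> M' i j = M i j"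
  \<comment> \<open>The input matrix continued by empty rows, so that \<open>4 * N\<close> rows can
    be summed although only \<open>m\<close> exist.\<close>
  define h where "h p j = (if p < m then {#Item (A p j)#} else {#})" for p j
  have S: "filter_mset real_item {#S_row (M' r) t#} = h (t div m * N + r) (t mod m)" if "r < N" "t < L" for r t
  proof (cases "t div m * N + r < m")
    case True
    have "M' ((t div m * N + r) mod N) (64 * m + t) = M (t div m * N + r) (t mod m)"
      using moved[OF True that(2)] that(1) by simp
    then show ?thesis using True that m_pos by (simp add: S_row_def M h_def)
  next
    case False
    have "M' r (64 * m + t) = M r (64 * m + t)"
    proof (rule frame)
      fix p t' assume *: "p < m" "t' < L" "t' div m = p div N"
      show "\<not> (p mod N = r \<and> 64 * m + t' = 64 * m + t)"
      proof
        assume "p mod N = r \<and> 64 * m + t' = 64 * m + t"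
        then have "p = t div m * N + r" using * div_mult_mod_eq[of p N] by simp
        then show False using False * by simp
      qed
    qed
    then show ?thesis using False m_pos by (simp add: S_row_def M h_def)
  qed
  have filter_sum: "filter_mset real_item (sum g B) = (\<Sum>x\<in>B. filter_mset real_item (g x))"
    if "finite B" for g :: "nat \<Rightarrow> 'a cell multiset" and B
    using that by (induction B rule: finite_induct) auto
  have "filter_mset real_item (\<Sum>p<N. row_mset L (S_row (M' p))) =
      (\<Sum>r<N. \<Sum>t<L. h (t div m * N + r) (t mod m))"
    unfolding row_mset_def filter_sum[OF finite_lessThan] by (intro sum.cong refl S) simp_all
  \<comment> \<open>From the fifth round on, rows with index at least \<open>4 * N > m\<close> would
    be loaded, which are empty. The remaining sum is then regrouped by writing \<open>t\<close> as
    \<open>a * m + j\<close> and the source row as \<open>a * N + r\<close>.\<close>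
  also have "\<dots> = (\<Sum>r<N. \<Sum>t<4 * m. h (t div m * N + r) (t mod m))"
  proof (rule sum.cong[OF refl])
    fix r
    show "(\<Sum>t<L. h (t div m * N + r) (t mod m)) = (\<Sum>t<4 * m. h (t div m * N + r) (t mod m))"
    proof (rule sum.mono_neutral_right)
      show "{..<4 * m} \<subseteq> {..<L}" using less_N L by auto
      show "\<forall>t\<in>{..<L} - {..<4 * m}. h (t div m * N + r) (t mod m) = {#}"
      proof
        fix t assume "t \<in> {..<L} - {..<4 * m}"
        then have "4 \<le> t div m" using m_pos by (simp add: less_eq_div_iff_mult_less_eq)
        then have "4 * N \<le> t div m * N" by (rule mult_le_mono1)
        then have "\<not> t div m * N + r < m" using less_N by linarith
        then show "h (t div m * N + r) (t mod m) = {#}" by (simp add: h_def)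
      qed
    qed simp
  qed
  also have "\<dots> = (\<Sum>r<N. \<Sum>a<4. \<Sum>j<m. h (a * N + r) j)"
    unfolding sum_pairs by (simp cong: sum.cong_simp)
  also have "\<dots> = (\<Sum>a<4. \<Sum>r<N. \<Sum>j<m. h (a * N + r) j)"
    by (rule sum.swap)
  also have "\<dots> = (\<Sum>p<4 * N. \<Sum>j<m. h p j)"
    by (rule sum_pairs[symmetric])
  also have "\<dots> = (\<Sum>p<m. \<Sum>j<m. h p j)"
    by (rule sum.mono_neutral_right) (use less_N in \<open>auto simp: h_def\<close>)
  also have "\<dots> = (\<Sum>i<m. \<Sum>j<m. {#Item (A i j)#})"
    by (intro sum.cong refl) (simp add: h_def)
  finally show "(\<forall>p < m. env (Rs' p)) \<and>
    filter_mset real_item (\<Sum>p<N. row_mset L (S_row (M' p))) = (\<Sum>i<m. \<Sum>j<m. {#Item (A i j)#})"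
    using env' by blast
qed (auto simp: env_def S_col_def eq_test_def)

lemma gwp_output_first:
  assumes env0: "\<forall>p < m. env (Rs p)"
    and Q: "\<And>M' Rs'. state_ok M' Rs' \<Longrightarrow> \<forall>p < m. env (Rs' p) \<Longrightarrow>
      (\<And>p. X_row (M' p) = X_row (M p)) \<Longrightarrow>
      (\<And>i j. i < m \<Longrightarrow> j < m \<Longrightarrow> i * m + j < 16 * N \<Longrightarrow> M' i j = X_row (M 0) (i * m + j)) \<Longrightarrow> Q M' Rs'"
  shows "gwp (5 * L + 2) output_first_route Q M Rs"
  unfolding output_first_route_def
proof (rule gwp_route[OF env0, where G = "\<lambda>p t. 32 * m + t"
      and act = "\<lambda>p t. p < 1 \<and> t < 16 * N \<and> t < m * m" and H = "\<lambda>p t. t div m" and K = "\<lambda>p t. t mod m"])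
  fix p t assume "p < 1 \<and> t < 16 * N \<and> t < m * m"
  moreover have "t mod m < m" using m_pos by simp
  ultimately show "t div m < m \<and> t mod m < 200 * m" by (simp add: less_mult_imp_div_less)
next
  fix t t' assume "t div m = t' div m" "t mod m = t' mod m"
  then show "t = t'" by (rule eq_if_div_mod)
next
  fix t t'
  have "t mod m < m" using m_pos by simp
  then show "t mod m \<noteq> 32 * m + t'" by linarith
next
  fix M' Rs'
  assume ok: "state_ok M' Rs'" and env': "\<forall>p<m. env (Rs' p)"
    and moved: "\<And>p t. p < m \<Longrightarrow> t < L \<Longrightarrow> p < 1 \<and> t < 16 * N \<and> t < m * m \<Longrightarrow>
      M' (t div m) (t mod m) = M p (32 * m + t)"
    and frame: "\<And>i j. (\<And>p t. p < m \<Longrightarrow> t < L \<Longrightarrow> p < 1 \<and> t < 16 * N \<and> t < m * m \<Longrightarrow>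
      \<not> (t div m = i \<and> t mod m = j)) \<Longrightarrow> M' i j = M i j"
  show "Q M' Rs'"
  proof (rule Q[OF ok env'])
    fix p
    have "M' p (32 * m + j) = M p (32 * m + j)" for j
    proof (rule frame)
      fix t
      have "t mod m < m" using m_pos by simp
      then show "\<not> (t div m = p \<and> t mod m = 32 * m + j)" by auto
    qed
    then show "X_row (M' p) = X_row (M p)" by (auto simp: X_row_def)
  next
    fix i j assume *: "i < m" "j < m" "i * m + j < 16 * N"
    then have "i * m + j < m * m" by (intro pair_less)
    then show "M' i j = X_row (M 0) (i * m + j)"
      using moved[of 0 "i * m + j"] * m_pos L by (simp add: X_row_def)
  qed
qed (use L_le in \<open>auto simp: env_def X_col_def W_exp_def size_exp_def\<close>)

lemma gwp_shift:
  assumes env0: "\<forall>p < m. env (Rs p)"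
    and Q: "\<And>M' Rs'. state_ok M' Rs' \<Longrightarrow> \<forall>p < m. env (Rs' p) \<Longrightarrow>
      (\<And>p t. Suc p < N \<Longrightarrow> t < L \<Longrightarrow> S_row (M' p) t =
        (if t < 16 * N then X_row (M p) (16 * N + t) else X_row (M (Suc p)) (t - 16 * N))) \<Longrightarrow>
      (\<And>i j. j < m \<Longrightarrow> M' i j = M i j) \<Longrightarrow> Q M' Rs'"
  shows "gwp (5 * L + 2) shift_route Q M Rs"
  unfolding shift_route_def
proof (rule gwp_route[OF env0, where G = "\<lambda>p t. 32 * m + t"
      and act = "\<lambda>p t. p < N \<and> 16 * N \<le> p * L + t" and H = "\<lambda>p t. (p * L + t - 16 * N) div L"
      and K = "\<lambda>p t. 64 * m + (p * L + t - 16 * N) mod L"])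
  fix p t assume *: "t < L" "p < N \<and> 16 * N \<le> p * L + t"
  then have "p * L + t < N * L"
    by (intro pair_less) auto
  then have "(p * L + t - 16 * N) div L < N" by (intro less_mult_imp_div_less) simp
  moreover have "(p * L + t - 16 * N) mod L < L" using L_pos by simp
  ultimately show "(p * L + t - 16 * N) div L < m \<and> 64 * m + (p * L + t - 16 * N) mod L < 200 * m"
    using N_le L_le by linarith
next
  fix p p' t assume "p < N \<and> 16 * N \<le> p * L + t" "p' < N \<and> 16 * N \<le> p' * L + t"
    "(p * L + t - 16 * N) div L = (p' * L + t - 16 * N) div L"
  then show "p = p'" using L_pos div_add_multiple_inj[of L L "16 * N" p t p'] by blast
next
  fix p p' t t' assume *: "t < L" "t' < L" "p < N \<and> 16 * N \<le> p * L + t" "p' < N \<and> 16 * N \<le> p' * L + t'"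
    "(p * L + t - 16 * N) div L = (p' * L + t' - 16 * N) div L"
    "64 * m + (p * L + t - 16 * N) mod L = 64 * m + (p' * L + t' - 16 * N) mod L"
  have "(p * L + t - 16 * N) mod L = (p' * L + t' - 16 * N) mod L"
    using *(6) by (simp only: add_left_cancel)
  with *(5) have "p * L + t - 16 * N = p' * L + t' - 16 * N" by (rule eq_if_div_mod)
  then have "p * L + t = p' * L + t'" using *(3,4) by (simp only: eq_diff_iff)
  then show "t = t'" using index_eq_iff[OF *(1,2)] by blast
next
  fix p t t' assume "t' < L"
  then have "64 * m + x \<noteq> 32 * m + t'" for x using L_le by linarith
  then show "64 * m + (p * L + t - 16 * N) mod L \<noteq> 32 * m + t'" by blast
next
  fix M' Rs'
  assume ok: "state_ok M' Rs'" and env': "\<forall>p<m. env (Rs' p)"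
    and moved: "\<And>p t. p < m \<Longrightarrow> t < L \<Longrightarrow> p < N \<and> 16 * N \<le> p * L + t \<Longrightarrow>
      M' ((p * L + t - 16 * N) div L) (64 * m + (p * L + t - 16 * N) mod L) = M p (32 * m + t)"
    and frame: "\<And>i j. (\<And>p t. p < m \<Longrightarrow> t < L \<Longrightarrow> p < N \<and> 16 * N \<le> p * L + t \<Longrightarrow>
      \<not> ((p * L + t - 16 * N) div L = i \<and> 64 * m + (p * L + t - 16 * N) mod L = j)) \<Longrightarrow> M' i j = M i j"
  show "Q M' Rs'"
  proof (rule Q[OF ok env'])
    fix p t assume *: "Suc p < N" "t < L"
    show "S_row (M' p) t =
        (if t < 16 * N then X_row (M p) (16 * N + t) else X_row (M (Suc p)) (t - 16 * N))"
    proof (cases "t < 16 * N")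
      case True
      have "M' ((p * L + (16 * N + t) - 16 * N) div L) (64 * m + (p * L + (16 * N + t) - 16 * N) mod L) =
          M p (32 * m + (16 * N + t))"
        by (rule moved) (use * True N_le L in auto)
      moreover have "p * L + (16 * N + t) - 16 * N = p * L + t" by simp
      ultimately show ?thesis using * True by (simp add: S_row_def X_row_def)
    next
      case False
      have idx: "Suc p * L + (t - 16 * N) - 16 * N = p * L + t" using False L by simp
      have "M' ((Suc p * L + (t - 16 * N) - 16 * N) div L) (64 * m + (Suc p * L + (t - 16 * N) - 16 * N) mod L) =
          M (Suc p) (32 * m + (t - 16 * N))"
        by (rule moved) (use * False N_le L in auto)
      then show ?thesis using * False unfolding idx by (simp add: S_row_def X_row_def)
    qed
  next
    fix i j assume "j < m"
    then have "64 * m + x \<noteq> j" for x by linarith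
    then show "M' i j = M i j" by (intro frame) blast
  qed
qed (use L_le in \<open>auto simp: env_def X_col_def S_col_def W_exp_def index_exp_def\<close>)

lemma gwp_output_shifted:
  assumes env0: "\<forall>p < m. env (Rs p)"
    and Q: "\<And>M' Rs'. state_ok M' Rs' \<Longrightarrow>
      (\<And>i j. i < m \<Longrightarrow> j < m \<Longrightarrow> M' i j = (if i * m + j < 16 * N then M i j else
        X_row (M ((i * m + j - 16 * N) div L)) ((i * m + j - 16 * N) mod L))) \<Longrightarrow> Q M' Rs'"
  shows "gwp (5 * L + 2) output_shifted_route Q M Rs"
  unfolding output_shifted_route_def
proof (rule gwp_route[OF env0, where G = "\<lambda>p t. 32 * m + t"
      and act = "\<lambda>p t. p < N \<and> p * L + t + 16 * N < m * m" and H = "\<lambda>p t. (p * L + t + 16 * N) div m"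
      and K = "\<lambda>p t. (p * L + t + 16 * N) mod m"])
  fix p t assume *: "p < N \<and> p * L + t + 16 * N < m * m"
  have "(p * L + t + 16 * N) mod m < m" using m_pos by simp
  then show "(p * L + t + 16 * N) div m < m \<and> (p * L + t + 16 * N) mod m < 200 * m"
    using * by (simp add: less_mult_imp_div_less)
next
  fix p p' t assume "(p * L + t + 16 * N) div m = (p' * L + t + 16 * N) div m"
  moreover have "m \<le> L" using less_N L by simp
  ultimately show "p = p'"
    using m_pos div_add_multiple_inj[of m L 0 p "t + 16 * N" p'] by (simp add: add.assoc)
next
  fix p p' t t' assume *: "t < L" "t' < L"
    "(p * L + t + 16 * N) div m = (p' * L + t' + 16 * N) div m"
    "(p * L + t + 16 * N) mod m = (p' * L + t' + 16 * N) mod m"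
  from *(3,4) have "p * L + t + 16 * N = p' * L + t' + 16 * N" by (rule eq_if_div_mod)
  then have "p * L + t = p' * L + t'" by simp
  then show "t = t'" using index_eq_iff[OF *(1,2)] by blast
next
  fix p t t'
  have "(p * L + t + 16 * N) mod m < m" using m_pos by simp
  then show "(p * L + t + 16 * N) mod m \<noteq> 32 * m + t'" by linarith
next
  fix M' Rs'
  assume ok: "state_ok M' Rs'"
    and moved: "\<And>p t. p < m \<Longrightarrow> t < L \<Longrightarrow> p < N \<and> p * L + t + 16 * N < m * m \<Longrightarrow>
      M' ((p * L + t + 16 * N) div m) ((p * L + t + 16 * N) mod m) = M p (32 * m + t)"
    and frame: "\<And>i j. (\<And>p t. p < m \<Longrightarrow> t < L \<Longrightarrow> p < N \<and> p * L + t + 16 * N < m * m \<Longrightarrow>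
      \<not> ((p * L + t + 16 * N) div m = i \<and> (p * L + t + 16 * N) mod m = j)) \<Longrightarrow> M' i j = M i j"
  show "Q M' Rs'"
  proof (rule Q[OF ok])
    fix i j assume *: "i < m" "j < m"
    let ?k = "i * m + j"
    have k: "?k < m * m" using * by (intro pair_less)
    show "M' i j = (if ?k < 16 * N then M i j else X_row (M ((?k - 16 * N) div L)) ((?k - 16 * N) mod L))"
    proof (cases "?k < 16 * N")
      case True
      have "M' i j = M i j"
      proof (rule frame)
        fix p t
        show "\<not> ((p * L + t + 16 * N) div m = i \<and> (p * L + t + 16 * N) mod m = j)"
        proof
          assume eq: "(p * L + t + 16 * N) div m = i \<and> (p * L + t + 16 * N) mod m = j"
          have "?k = p * L + t + 16 * N"
            by (rule eq_if_div_mod[of _ m]) (simp_all only: eq div_mod_index[OF *(2)])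
          then show False using True by simp
        qed
      qed
      then show ?thesis using True by simp
    next
      case False
      define p where "p = (?k - 16 * N) div L"
      define t where "t = (?k - 16 * N) mod L"
      have idx: "p * L + t + 16 * N = ?k" using False by (simp add: p_def t_def)
      have "t < L" using L_pos by (simp add: t_def)
      have "m * m < 4 * N * (4 * N)" using less_N by (intro mult_strict_mono) auto
      then have "?k - 16 * N < N * L" using k L by simp
      then have "p < N" unfolding p_def by (rule less_mult_imp_div_less)
      then have "M' ((p * L + t + 16 * N) div m) ((p * L + t + 16 * N) mod m) = M p (32 * m + t)"
        by (intro moved) (use k N_le \<open>p < N\<close> \<open>t < L\<close> idx in simp_all)
      then show ?thesis using False *(2) unfolding idx by (simp add: p_def t_def X_row_def)
    qed
  qed
qed (use L_le in \<open>auto simp: env_def X_col_def W_exp_def index_exp_def size_exp_def\<close>)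

end

section \<open>The complete program\<close>

context dmm_machine
begin

lemma halted_step:
  assumes "at_code C M (\<lambda>_. []) Rs" "state_ok M Rs"
  shows "legal C" "at_code (step D C) M (\<lambda>_. []) Rs"
proof -
  have C: "fst C = M" "\<And>p. p < banks D \<Longrightarrow> snd C p = ([], Rs p)"
    using assms(1) by (auto simp: at_code_def)
  have "fold (\<lambda>p. write_proc D p (snd C p)) ps M = M" if "set ps \<subseteq> {..<banks D}" for ps
    using that by (induction ps) (auto simp: C(2))
  from this[of "[0..<banks D]"] show "at_code (step D C) M (\<lambda>_. []) Rs"
    using C by (auto simp: at_code_def step_def lessThan_atLeast0)
  show "legal C" by (rule legalI[OF assms, of "\<lambda>p. p"]) auto
qed

text \<open>\<open>computes_within\<close> demands legality at all times and the result at time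
  \<open>t\<close>, whereas the program halts at exactly \<open>T\<close>. A halted configuration
  accesses nothing and reproduces itself, which covers all times from \<open>T\<close> on.\<close>

lemma computes_within_gwp:
  assumes g: "gwp T P Q (fst (init D P A)) (\<lambda>_ _. Word 0)"
    and A: "\<And>i j. i < banks D \<Longrightarrow> j < cols D \<Longrightarrow> I (A i j)" and T: "T \<le> t"
  obtains M Rs where "Q M Rs"
    and "\<And>B. (\<And>i j. i < banks D \<Longrightarrow> j < cols D \<Longrightarrow> M i j = Item (B i j)) \<Longrightarrow> computes_within c D P t A B"
proof -
  let ?C = "init D P A"
  have ok: "state_ok (fst ?C) (\<lambda>_ _. Word 0)" using A by (auto simp: state_ok_def init_def)
  have "at_code ?C (fst ?C) (\<lambda>_. P @ []) (\<lambda>_ _. Word 0)" by (simp add: at_code_def init_def)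
  with g ok obtain M Rs where 1: "\<forall>s < T. legal ((step D ^^ s) ?C)"
    "at_code ((step D ^^ T) ?C) M (\<lambda>_. []) Rs" "state_ok M Rs" "Q M Rs"
    unfolding gwp_def by blast
  have halted: "at_code ((step D ^^ (T + s)) ?C) M (\<lambda>_. []) Rs" for s
    by (induction s) (use 1(2) halted_step(2)[OF _ 1(3)] in auto)
  have "legal ((step D ^^ s) ?C)" for s
  proof (cases "s < T")
    case False
    then show ?thesis using halted_step(1)[OF halted[of "s - T"] 1(3)] by simp
  qed (use 1(1) in blast)
  moreover have "at_code ((step D ^^ t) ?C) M (\<lambda>_. []) Rs" using halted[of "t - T"] T by simp
  ultimately have "computes_within c D P t A B"
    if "\<And>i j. i < banks D \<Longrightarrow> j < cols D \<Longrightarrow> M i j = Item (B i j)" for B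
    using that unfolding computes_within_def run_def legal_def at_code_def by auto
  then show thesis using that 1(4) by blast
qed

end

context dmm_square
begin

text \<open>The loop ends at the first power of two with \<open>m < 4 * (q * q)\<close>. That it
  does not end before round \<open>n\<close> follows from \<open>N \<le> m\<close>, that it ends
  there from \<open>m < 4 * N\<close>.\<close>

lemma gwp_preamble:
  "gwp (2 * n + 4) preamble (\<lambda>M' Rs'. M' = M \<and> (\<forall>p < m. env (Rs' p))) M Rs"
proof (rule gwp_local[where Q = "\<lambda>p row R. row = M p \<and> env R"])
  fix p assume p: "p < banks D"
  let ?w = "[While (Neg (Less Num_Cols (Mul (Const 4) (Mul (Reg reg_q) (Reg reg_q)))))
    [Assign reg_q (Mul (Const 2) (Reg reg_q))]]"
  let ?e = "[Assign reg_N (Mul (Reg reg_q) (Reg reg_q)), Assign reg_L (Mul (Const 32) (Reg reg_N))]"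
  have "q \<le> N" using N q_pos by simp
  have loop: "wpp p p (n * (1 + 1) + 1) ?w (wpp p p 2 ?e (\<lambda>row R. row = M p \<and> env R))
      (M p) ((Rs p)(reg_q := Word 1))"
  proof (rule wpp_while[where Inv = "\<lambda>k row R. row = M p \<and> R reg_q = Word (2 ^ k)"])
    fix k row and R :: "'a regs" assume k: "k < n" and inv: "row = M p \<and> R reg_q = Word (2 ^ k)"
    have "(2::nat) * 2 ^ k \<le> q" using k power_increasing[of "Suc k" n "2::nat"] by (simp add: q)
    then have "(2 * 2 ^ k) * (2 * 2 ^ k) \<le> N" unfolding N by (intro mult_le_mono)
    then have "4 * (2 ^ k * 2 ^ k) \<le> m" using N_le by (simp add: algebra_simps)
    moreover have "2 * 2 ^ k \<le> word_bound" using \<open>2 * 2 ^ k \<le> q\<close> \<open>q \<le> N\<close> N_le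
      by (intro word_bound_ge) linarith
    ultimately show "holds D p R (Neg (Less Num_Cols (Mul (Const 4) (Mul (Reg reg_q) (Reg reg_q))))) \<and>
      wpp p p 1 [Assign reg_q (Mul (Const 2) (Reg reg_q))] (\<lambda>row R. row = M p \<and> R reg_q = Word (2 ^ Suc k)) row R"
      using inv by simp
  next
    fix row and R :: "'a regs" assume inv: "row = M p \<and> R reg_q = Word (2 ^ n)"
    have "N \<le> word_bound" "L \<le> word_bound" using N_le L by (auto intro!: word_bound_ge)
    moreover have R: "R reg_q = Word q" using inv q by simp
    moreover have "env (R(reg_N := Word N, reg_L := Word L))" using R by (simp add: env_def)
    ultimately show "\<not> holds D p R (Neg (Less Num_Cols (Mul (Const 4) (Mul (Reg reg_q) (Reg reg_q))))) \<and>
      wpp p p 2 ?e (\<lambda>row R. row = M p \<and> env R) row R"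
      using inv less_N by (simp flip: N L)
  qed simp
  have "wpp p p 1 [Assign reg_q (Const 1)] (wpp p p (n * (1 + 1) + 1 + 2) (?w @ ?e) (\<lambda>row R. row = M p \<and> env R)) (M p) (Rs p)"
    using wpp_append[OF loop] m_pos by (auto intro!: word_bound_ge)
  note wpp_append[OF this]
  moreover have "1 + (n * (1 + 1) + 1 + 2) = 2 * n + 4" by simp
  moreover have "[Assign reg_q (Const 1)] @ ?w @ ?e = preamble" by (simp add: preamble_def)
  ultimately show "wpp p p (2 * n + 4) preamble (\<lambda>row R. row = M p \<and> env R) (M p) (Rs p)"
    by (simp only:)
next
  fix M' Rs'
  assume 1: "\<And>p. p < banks D \<Longrightarrow> M' p = M p \<and> env (Rs' p)" "\<And>i. \<not> i < banks D \<Longrightarrow> M' i = M i"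
  then have "M' = M" by (intro ext) metis
  then show "M' = M \<and> (\<forall>p < m. env (Rs' p))" using 1 by simp
qed

definition sorted_output :: "('a cell \<Rightarrow> 'a cell \<Rightarrow> bool) \<Rightarrow> 'a cell multiset \<Rightarrow> 'a memory \<Rightarrow> bool" where
  "sorted_output le items M \<longleftrightarrow> (\<exists>z. (\<forall>i<m. \<forall>j<m. M i j = z (i * m + j)) \<and>
     row_sorted le (m * m) z \<and> row_mset (m * m) z = items \<and> (\<forall>k<m * m. real_item (z k)))"

lemma gwp_finish:
  assumes srt: "sorter le srt u" and env0: "\<forall>p < m. env (Rs p)"
    and le: "reflp le" "transp le" "upward le (\<lambda>x. \<not> real_item x)"
    and near: "\<And>f. upward le f \<Longrightarrow> near_sorted N L (\<lambda>p. cnt f L (S_row (M p)))"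
    and items: "filter_mset real_item (\<Sum>p<N. row_mset L (S_row (M p))) = items" "size items = m * m"
  shows "gwp (2 * u + 3 * (5 * L + 2)) (finish srt) (\<lambda>M' Rs'. sorted_output le items M') M Rs"
proof -
  let ?r = "5 * L + 2"
  let ?Q = "\<lambda>M' Rs'. sorted_output le items M'"
  have "gwp (u + (?r + (?r + (u + ?r)))) (finish srt) ?Q M Rs"
    unfolding finish_def
  proof (rule gwp_append, rule gwp_sort[OF srt env0])
    fix M1 R1 assume env1: "\<forall>p<m. env (R1 p)" and s1: "\<And>p. p < m \<Longrightarrow> row_sorted le L (X_row (M1 p)) \<and>
        row_mset L (X_row (M1 p)) = row_mset L (S_row (M p)) \<and> (\<forall>j < m. M1 p j = M p j)"
    define X where "X p = X_row (M1 p)" for p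
    show "gwp (?r + (?r + (u + ?r))) (output_first_route @ shift_route @ srt @ output_shifted_route) ?Q M1 R1"
    proof (rule gwp_append, rule gwp_output_first[OF env1])
      fix M2 R2 assume env2: "\<forall>p<m. env (R2 p)" and X2: "\<And>p. X_row (M2 p) = X_row (M1 p)"
        and out2: "\<And>i j. i < m \<Longrightarrow> j < m \<Longrightarrow> i * m + j < 16 * N \<Longrightarrow> M2 i j = X_row (M1 0) (i * m + j)"
      show "gwp (?r + (u + ?r)) (shift_route @ srt @ output_shifted_route) ?Q M2 R2"
      proof (rule gwp_append, rule gwp_shift[OF env2])
        fix M3 R3 assume env3: "\<forall>p<m. env (R3 p)"
          and S3: "\<And>p t. Suc p < N \<Longrightarrow> t < L \<Longrightarrow> S_row (M3 p) t =
            (if t < 16 * N then X_row (M2 p) (16 * N + t) else X_row (M2 (Suc p)) (t - 16 * N))"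
          and out3: "\<And>i j. j < m \<Longrightarrow> M3 i j = M2 i j"
        show "gwp (u + ?r) (srt @ output_shifted_route) ?Q M3 R3"
        proof (rule gwp_append, rule gwp_sort[OF srt env3])
          fix M4 R4 assume env4: "\<forall>p<m. env (R4 p)" and s4: "\<And>p. p < m \<Longrightarrow> row_sorted le L (X_row (M4 p)) \<and>
            row_mset L (X_row (M4 p)) = row_mset L (S_row (M3 p)) \<and> (\<forall>j < m. M4 p j = M3 p j)"
          define X' where "X' p = X_row (M4 p)" for p
          show "gwp ?r output_shifted_route ?Q M4 R4"
          proof (rule gwp_output_shifted[OF env4])
            fix M5
            assume out5: "\<And>i j. i < m \<Longrightarrow> j < m \<Longrightarrow> M5 i j = (if i * m + j < 16 * N then M4 i j else
              X_row (M4 ((i * m + j - 16 * N) div L)) ((i * m + j - 16 * N) mod L))"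
            define W where "W = 16 * N"
            have Xs: "row_sorted le L (X p)" "row_mset L (X p) = row_mset L (S_row (M p))" if "p < N" for p
              using s1[of p] that N_le by (auto simp: X_def)
            have near': "near_sorted N L (\<lambda>p. cnt f L (X p))" if "upward le f" for f
            proof -
              have eq: "cnt f L (X p) = cnt f L (S_row (M p))" if "p < N" for p
                using Xs(2)[OF that] by (rule cnt_cong_mset)
              show ?thesis
                unfolding near_sorted_def
              proof (intro allI impI)
                fix r r' assume r: "r < r'" "r' < N"
                then have "r < N" by simp
                then show "cnt f L (X r) = 0 \<or> cnt f L (X r') = L \<or>
                    r' = Suc r \<and> 2 * cnt f L (X r) \<le> L \<and> L \<le> 2 * cnt f L (X r')"
                  using near[OF that] r unfolding near_sorted_def by (simp add: eq)
              qed
            qed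
            have X's: "row_sorted le L (X' p) \<and>
                row_mset L (X' p) = row_mset L (\<lambda>t. if t < W then X p (W + t) else X (Suc p) (t - W))"
              if "Suc p < N" for p
            proof -
              have "row_mset L (S_row (M3 p)) = row_mset L (\<lambda>t. if t < W then X p (W + t) else X (Suc p) (t - W))"
                by (rule row_mset_cong) (use S3[OF that] X2 in \<open>simp add: X_def W_def\<close>)
              then show ?thesis using s4[of p] that N_le by (simp add: X'_def)
            qed
            let ?z = "shift_merge L W X X'"
            \<comment> \<open>Here \<open>4 * N * (4 * N)\<close> is exactly \<open>N * W\<close>:
              the real items fill less than half of the padded matrix.\<close>
            have K: "m * m < N * W"
            proof -
              have "m * m < 4 * N * (4 * N)" using less_N by (intro mult_strict_mono) auto
              then show ?thesis by (simp add: W_def)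
            qed
            have sumX: "(\<Sum>p<N. row_mset L (X p)) = (\<Sum>p<N. row_mset L (S_row (M p)))"
              using Xs(2) by simp
            note hyps = N_pos L W_def Xs(1) near' X's
            have prefix: "row_mset (m * m) ?z = items" "\<And>k. k < m * m \<Longrightarrow> real_item (?z k)"
              using merged_prefix[where le = le and N = N and L = L and W = W and X = X and X' = X'
                  and real_item = real_item and K = "m * m", OF hyps le(3) _ K] items sumX
              by simp_all
            have "row_sorted le (N * L - W) ?z"
              by (rule merged_sorted[OF hyps le(1,2)])
            moreover have "m * m \<le> N * L - W"
            proof -
              have "N * L - W = N * W + (N * W - W)" using N_pos L W_def by (simp add: algebra_simps)
              then show ?thesis using K by linarith
            qed
            ultimately have "row_sorted le (m * m) ?z" unfolding row_sorted_def by auto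
            moreover have "M5 i j = ?z (i * m + j)" if "i < m" "j < m" for i j
            proof (cases "i * m + j < W")
              case True
              then have "M4 i j = X 0 (i * m + j)"
                using s4[OF that(1)] out3[of j i] out2[OF that] that(2) by (simp add: X_def W_def)
              then show ?thesis using out5[OF that] True by (simp add: shift_merge_def W_def)
            next
              case False
              then show ?thesis using out5[OF that] by (simp add: shift_merge_def W_def X'_def)
            qed
            ultimately show "sorted_output le items M5"
              unfolding sorted_output_def using prefix by blast
          qed
        qed
      qed
    qed
  qed
  moreover have "u + (?r + (?r + (u + ?r))) = 2 * u + 3 * ?r" by simp
  ultimately show ?thesis by metis
qed

text \<open>The time consists of the preamble, eight local sorts and ten routes: one for loading,
  six in the two rounds, and three at the end.\<close>

lemma gwp_mesh_sort:
  assumes srt: "sorter (cell_le key) srt u"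
    and M: "\<And>i j. M i j = (if i < m \<and> j < m then Item (A i j) else Word 0)"
  shows "gwp (2 * n + 4 + (8 * u + 10 * (5 * L + 2))) (mesh_sort srt)
    (\<lambda>M' Rs'. sorted_output (cell_le key) (\<Sum>i<m. \<Sum>j<m. {#Item (A i j)#}) M') M Rs"
proof -
  let ?r = "5 * L + 2" and ?items = "\<Sum>i<m. \<Sum>j<m. {#Item (A i j)#}"
  let ?Q = "\<lambda>M' Rs'. sorted_output (cell_le key) ?items M'"
  have up: "upward (cell_le key) (\<lambda>x. \<not> real_item x)"
    unfolding upward_def cell_le_def
  proof (intro allI impI)
    fix x y :: "'a cell"
    assume "case y of Item y \<Rightarrow> (case x of Item x \<Rightarrow> key x \<le> key y | Word _ \<Rightarrow> False) | Word _ \<Rightarrow> True"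
      "\<not> real_item x"
    then show "\<not> real_item y" by (cases x; cases y) auto
  qed
  have "gwp (2 * n + 4 + (?r + (6 * (u + ?r) + (2 * u + 3 * ?r)))) (mesh_sort srt) ?Q M Rs"
    unfolding mesh_sort_def
  proof (rule gwp_seq[OF gwp_preamble], elim conjE)
    fix M' R1 assume "M' = M" and env1: "\<forall>p<m. env (R1 p)"
    show "gwp (?r + (6 * (u + ?r) + (2 * u + 3 * ?r))) (load_route @ (deal_round srt @ deal_round srt) @ finish srt) ?Q M' R1"
      unfolding \<open>M' = M\<close>
    proof (rule gwp_seq[OF gwp_load[OF env1 M]], elim conjE)
      fix M2 R2 assume env2: "\<forall>p<m. env (R2 p)"
        and items: "filter_mset real_item (\<Sum>p<N. row_mset L (S_row (M2 p))) = ?items"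
      show "gwp (6 * (u + ?r) + (2 * u + 3 * ?r)) ((deal_round srt @ deal_round srt) @ finish srt) ?Q M2 R2"
      proof (rule gwp_seq[OF gwp_two_rounds[OF srt env2]], elim conjE)
        fix M3 R3 assume 3: "\<forall>p<m. env (R3 p)"
          "\<forall>f. upward (cell_le key) f \<longrightarrow> near_sorted N L (\<lambda>p. cnt f L (S_row (M3 p)))"
          "(\<Sum>p<N. row_mset L (S_row (M3 p))) = (\<Sum>p<N. row_mset L (S_row (M2 p)))"
        show "gwp (2 * u + 3 * ?r) (finish srt) ?Q M3 R3"
          by (rule gwp_finish[OF srt 3(1) cell_le_order(3,1) up])
            (use 3 items in \<open>simp_all add: size_multiset_sum\<close>)
      qed
    qed
  qed
  moreover have "2 * n + 4 + (?r + (6 * (u + ?r) + (2 * u + 3 * ?r))) = 2 * n + 4 + (8 * u + 10 * ?r)"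
    by simp
  ultimately show ?thesis by metis
qed

end

section \<open>From cells back to items and labels\<close>

lemma row_major_eq: "row_major w m A = map (\<lambda>k. A (k div m) (k mod m)) [0..<w * m]"
proof (induction w)
  case (Suc w)
  have "map (\<lambda>k. A (k div m) (k mod m)) [w * m..<w * m + m] = map (A w) [0..<m]"
    by (rule nth_equalityI) auto
  moreover have "[0..<Suc w * m] = [0..<w * m] @ [w * m..<w * m + m]"
    using upt_add_eq_append[of 0 "w * m" m] by (simp add: add.commute)
  ultimately show ?case using Suc by (simp add: row_major_def)
qed (simp add: row_major_def)

lemma mset_map_upt: "mset (map f [0..<k]) = (\<Sum>t<k. {#f t#})"
  by (induction k) simp_all

lemma mset_row_major: "mset (row_major w m A) = (\<Sum>i<w. \<Sum>j<m. {#A i j#})"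
proof -
  have "mset (row_major w m A) = (\<Sum>k<w * m. {#A (k div m) (k mod m)#})"
    by (simp only: row_major_eq mset_map_upt)
  also have "\<dots> = (\<Sum>i<w. \<Sum>j<m. {#A i j#})"
    unfolding sum_pairs by simp
  finally show ?thesis .
qed

lemma image_mset_sum: "finite S \<Longrightarrow> image_mset f (sum g S) = (\<Sum>x\<in>S. image_mset f (g x))"
  by (induction S rule: finite_induct) auto

fun item :: "'a cell \<Rightarrow> 'a" where
  "item (Item x) = x" | "item (Word _) = undefined"

context dmm_square
begin

lemma sorted_output_items:
  assumes "sorted_output (cell_le key) (\<Sum>i<m. \<Sum>j<m. {#Item (A i j)#}) M"
  obtains B where "\<And>i j. i < m \<Longrightarrow> j < m \<Longrightarrow> M i j = Item (B i j)"
    and "rearrangement m m A B" and "sorted (map key (row_major m m B))"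
proof -
  obtain z where z: "\<And>i j. i < m \<Longrightarrow> j < m \<Longrightarrow> M i j = z (i * m + j)"
    "row_sorted (cell_le key) (m * m) z" "row_mset (m * m) z = (\<Sum>i<m. \<Sum>j<m. {#Item (A i j)#})"
    "\<And>k. k < m * m \<Longrightarrow> real_item (z k)"
    using assms unfolding sorted_output_def by blast
  have zi: "z k = Item (item (z k))" if "k < m * m" for k
    using z(4)[OF that] by (cases "z k") auto
  define B where "B i j = item (z (i * m + j))" for i j
  have rm: "row_major m m B = map (\<lambda>k. item (z k)) [0..<m * m]"
    by (simp add: row_major_eq B_def)
  show thesis
  proof (rule that[of B])
    fix i j assume "i < m" "j < m"
    then show "M i j = Item (B i j)" using z(1) zi pair_less[of i m j m] by (simp add: B_def)
  next
    have "mset (row_major m m B) = image_mset item (row_mset (m * m) z)"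
      by (simp only: rm mset_map_upt row_mset_def image_mset_sum finite_lessThan image_mset_single)
    also have "\<dots> = mset (row_major m m A)"
      by (simp only: z(3) mset_row_major image_mset_sum finite_lessThan image_mset_single item.simps)
    finally show "rearrangement m m A B" by (simp add: rearrangement_def)
  next
    have "key (item (z k)) \<le> key (item (z k'))" if "k \<le> k'" "k' < m * m" for k k'
    proof -
      have "cell_le key (z k) (z k')" using z(2) that unfolding row_sorted_def by blast
      then have "cell_le key (Item (item (z k))) (Item (item (z k')))"
        using zi[of k] zi[of k'] that by simp
      then show ?thesis by (simp add: cell_le_def)
    qed
    then show "sorted (map key (row_major m m B))"
      by (auto simp: rm sorted_iff_nth_mono)
  qed
qed

lemma mesh_sort_computes:
  assumes srt: "sorter (cell_le key) srt u"
    and A: "\<And>i j. i < m \<Longrightarrow> j < m \<Longrightarrow> I (A i j)"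
    and T: "2 * n + 4 + (8 * u + 10 * (5 * L + 2)) \<le> T"
  obtains B where "computes_within c D (mesh_sort srt) T A B" "rearrangement m m A B"
    "sorted (map key (row_major m m B))"
proof -
  let ?P = "mesh_sort srt" and ?T = "2 * n + 4 + (8 * u + 10 * (5 * L + 2))"
  let ?M = "fst (init D ?P A)" and ?R = "\<lambda>_ _. Word 0"
  have M: "?M i j = (if i < m \<and> j < m then Item (A i j) else Word 0)" for i j
    by (simp add: init_def)
  obtain M' where M': "sorted_output (cell_le key) (\<Sum>i<m. \<Sum>j<m. {#Item (A i j)#}) M'"
    and comp: "\<And>B. (\<And>i j. i < banks D \<Longrightarrow> j < cols D \<Longrightarrow> M' i j = Item (B i j)) \<Longrightarrow>
      computes_within c D ?P T A B"
    by (rule computes_within_gwp[OF gwp_mesh_sort[OF srt M] _ T]) (use A in simp_all)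
  obtain B where "\<And>i j. i < m \<Longrightarrow> j < m \<Longrightarrow> M' i j = Item (B i j)"
    "rearrangement m m A B" "sorted (map key (row_major m m B))"
    using sorted_output_items[OF M'] by blast
  then show thesis using comp by (intro that) simp_all
qed

end

text \<open>The labels below \<open>v\<close> occur \<open>v * m\<close> times in total and, by
  monotonicity, occupy the first \<open>v * m\<close> places. So the label changes exactly at the
  row boundaries.\<close>

lemma balanced_labels:
  fixes l :: "nat \<Rightarrow> nat"
  assumes mono: "\<And>k k'. k \<le> k' \<Longrightarrow> k' < m * m \<Longrightarrow> l k \<le> l k'"
    and count: "\<And>v. v < m \<Longrightarrow> key_count l (m * m) v = m" and k: "k < m * m"
  shows "l k = k div m"
proof -
  have below: "v \<le> m \<Longrightarrow> key_below l (m * m) v = v * m" for v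
    by (induction v) (simp_all add: key_below_Suc count)
  have iff: "v \<le> l k \<longleftrightarrow> v * m \<le> k" if v: "v \<le> m" for v
  proof -
    have "{t. t < m * m \<and> v \<le> l t} = {..<m * m} - {t. t < m * m \<and> l t < v}" by auto
    then have "card {t. t < m * m \<and> v \<le> l t} = card ({..<m * m} - {t. t < m * m \<and> l t < v})"
      by (rule arg_cong)
    also have "\<dots> = m * m - v * m"
      using below[OF v] by (subst card_Diff_subset) (auto simp: key_below_def)
    finally have "card {t. t < m * m \<and> v \<le> l t} = m * m - v * m" .
    moreover have "v * m \<le> m * m" using v by simp
    ultimately show ?thesis
      using upper_set_eq[where P = "\<lambda>t. v \<le> l t", OF _ k] mono by (simp add: order_trans)
  qed
  have "k div m < m" using k by (simp add: less_mult_imp_div_less)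
  then have "k div m \<le> l k" using iff[of "k div m"] by simp
  moreover have "\<not> Suc (k div m) \<le> l k"
    using iff[of "Suc (k div m)"] \<open>k div m < m\<close> dividend_less_div_times[of m k] by simp
  ultimately show ?thesis by simp
qed

lemma key_count_label:
  assumes "partition_input m m label A" "v < m" "rearrangement m m A B"
  shows "key_count (\<lambda>k. label (B (k div m) (k mod m))) (m * m) v = m"
proof -
  have count: "size (filter_mset (\<lambda>x. label x = v) (mset (row_major m m C))) =
      key_count (\<lambda>k. label (C (k div m) (k mod m))) (m * m) v" for C
  proof -
    have "size (filter_mset (\<lambda>x. label x = v) (mset (row_major m m C))) =
        (\<Sum>k<m * m. of_bool (label (C (k div m) (k mod m)) = v))"
      unfolding row_major_eq mset_map_upt by (rule size_filter_sum) simp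
    then show ?thesis by (simp add: key_count_def Int_def lessThan_def)
  qed
  have "key_count (\<lambda>k. label (A (k div m) (k mod m))) (m * m) v = card {(i, j). i < m \<and> j < m \<and> label (A i j) = v}"
    unfolding key_count_def
  proof (rule bij_betw_same_card[of "\<lambda>k. (k div m, k mod m)"], rule bij_betw_byWitness[where f' = "\<lambda>(i, j). i * m + j"])
    show "(\<lambda>k. (k div m, k mod m)) ` {t. t < m * m \<and> label (A (t div m) (t mod m)) = v} \<subseteq>
        {(i, j). i < m \<and> j < m \<and> label (A i j) = v}"
      using assms(2) by (auto simp: less_mult_imp_div_less)
    show "(\<lambda>(i, j). i * m + j) ` {(i, j). i < m \<and> j < m \<and> label (A i j) = v} \<subseteq>
        {t. t < m * m \<and> label (A (t div m) (t mod m)) = v}"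
      by (auto intro: pair_less)
  qed auto
  then show ?thesis
    using count[of A] count[of B] assms unfolding partition_input_def rearrangement_def by simp
qed

section \<open>Choice of the parameters and asymptotic bounds\<close>

lemma ex_power_4:
  assumes "0 < (m::nat)"
  obtains n where "2 ^ n * 2 ^ n \<le> m" "m < 4 * (2 ^ n * 2 ^ n)"
proof -
  obtain n where "4 ^ n \<le> m" "m < 4 ^ (n + 1)"
    using ex_power_ivl1[of 4 m] assms by auto
  moreover have "(4::nat) ^ n = 2 ^ n * 2 ^ n" by (simp flip: power_mult_distrib)
  ultimately show thesis using that[of n] by simp
qed

text \<open>Since \<open>exp 1\<close> is at most 4, \<open>exp n\<close> is at most
  \<open>4 ^ n \<le> m\<close>; this avoids converting between bases of logarithms.\<close>

lemma exponent_le_ln: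
  assumes "2 ^ n * 2 ^ n \<le> (m::nat)"
  shows "real n \<le> ln (real m)"
proof -
  have "exp (real n) = exp 1 ^ n" by (simp add: exp_of_nat_mult[symmetric])
  also have "\<dots> \<le> 4 ^ n" using exp_le by (intro power_mono) auto
  also have "(4::real) ^ n = real (2 ^ n * 2 ^ n)" by (simp flip: power_mult_distrib)
  also have "\<dots> \<le> real m" using assms by (simp only: of_nat_le_iff)
  finally show ?thesis
    by (metis exp_gt_zero less_le_trans ln_exp ln_le_cancel_iff)
qed

theorem theorem1:
  "(\<exists>(P :: instr list) (c :: nat) (T :: nat \<Rightarrow> nat).
      (\<lambda>m. real (T m)) \<in> O(\<lambda>m. real m * ln (real m)) \<and>
      (\<forall>w m. \<forall>A :: nat \<Rightarrow> nat \<Rightarrow> 'a::linorder.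
         w = m \<and> m > 0 \<longrightarrow> sorts_within c P w m (T m) A)) \<and>
   (\<exists>(P :: instr list) (c :: nat) (T :: nat \<Rightarrow> nat).
      (\<lambda>m. real (T m)) \<in> O(\<lambda>m. real m) \<and>
      (\<forall>w m. \<forall>(label :: 'b \<Rightarrow> nat) (A :: nat \<Rightarrow> nat \<Rightarrow> 'b).
         w = m \<and> m > 0 \<and> partition_input w m label A
         \<longrightarrow> partitions_within c P w m (T m) label A))"
proof (intro conjI)
  \<comment> \<open>The step count is at most \<open>6000 * m * (2 * n + 5)\<close>, and
    \<open>n\<close> is bounded by \<open>ln m\<close>. The summand 5 keeps the bound valid for
    \<open>m = 1\<close>, where \<open>m * ln m\<close> vanishes.\<close>
  define T where "T m = nat \<lceil>6000 * real m * (2 * ln (real m) + 5)\<rceil>" for m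
  \<comment> \<open>From \<open>m = 3\<close> on \<open>ln m\<close> is at least 1 and absorbs the
    linear term and the rounding: 12000 + 30000 + 1.\<close>
  have "real (T m) \<le> 42001 * norm (real m * ln (real m))" if "3 \<le> m" for m
  proof -
    have "1 \<le> ln (real m)"
    proof -
      have "exp 1 \<le> real m" using exp_le that by linarith
      then show ?thesis using ln_ge_iff[of "real m" 1] that by simp
    qed
    then have "real m * 1 \<le> real m * ln (real m)" by (intro mult_left_mono) auto
    moreover have "real (T m) \<le> 6000 * real m * (2 * ln (real m) + 5) + 1"
    proof -
      have "0 \<le> 6000 * real m * (2 * ln (real m) + 5)" using \<open>1 \<le> ln (real m)\<close> by simp
      then show ?thesis
        using of_int_ceiling_le_add_one[of "6000 * real m * (2 * ln (real m) + 5)"]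
        unfolding T_def by (subst of_nat_nat) linarith+
    qed
    moreover have "6000 * real m * (2 * ln (real m) + 5) = 12000 * (real m * ln (real m)) + 30000 * real m"
      by (simp add: algebra_simps)
    moreover have "1 \<le> real m" using that by simp
    ultimately have "real (T m) \<le> 42001 * (real m * ln (real m))" by linarith
    also have "\<dots> \<le> 42001 * norm (real m * ln (real m))" by simp
    finally show ?thesis .
  qed
  then have "(\<lambda>m. real (T m)) \<in> O(\<lambda>m. real m * ln (real m))"
    by (intro bigoI[of _ 42001] eventually_sequentiallyI[of 3]) simp
  moreover have "sorts_within 200 (mesh_sort merge_sort) m m (T m) A" if m: "0 < m" for m and A :: "nat \<Rightarrow> nat \<Rightarrow> 'a"
  proof -
    obtain n where n: "2 ^ n * 2 ^ n \<le> m" "m < 4 * (2 ^ n * 2 ^ n)" using ex_power_4[OF m] .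
    interpret dmm_square "sort_dmm m m" 200 "\<lambda>_. True" m n "2 ^ n" "2 ^ n * 2 ^ n" "32 * (2 ^ n * 2 ^ n)"
      using n by unfold_locales (auto simp: sort_dmm_def)
    let ?L = "32 * (2 ^ n * 2 ^ n) :: nat"
    let ?u = "(2 * n + 5) * (14 * ?L + 6) + 2"
    have srt: "sorter (cell_le (\<lambda>x. x)) merge_sort ?u"
      by (rule sorter_merge_sort) (simp add: sort_dmm_def)
    have "2 * n + 4 + (8 * ?u + 10 * (5 * ?L + 2)) \<le> 6000 * m * (2 * n + 5)"
    proof -
      \<comment> \<open>The factor is \<open>14 * 32 + 6 = 454\<close>, using
        \<open>1 \<le> m\<close> for the constant term.\<close>
      have "(2 * n + 5) * (14 * ?L + 6) \<le> (2 * n + 5) * (454 * m)"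
        using L_le m by (intro mult_le_mono2) simp
      moreover have "m * 5 \<le> m * (2 * n + 5)" "2 * n + 5 \<le> m * (2 * n + 5)" using m by simp_all
      moreover have "?L \<le> 32 * m" by (rule L_le)
      ultimately show ?thesis using m by (simp add: algebra_simps)
    qed
    also have "\<dots> \<le> T m"
    proof -
      have "real (6000 * m * (2 * n + 5)) \<le> 6000 * real m * (2 * ln (real m) + 5)"
        using exponent_le_ln[OF n(1)] by (auto intro!: mult_left_mono)
      then show ?thesis unfolding T_def by linarith
    qed
    finally have T: "2 * n + 4 + (8 * ?u + 10 * (5 * ?L + 2)) \<le> T m" .
    obtain B where "computes_within 200 (sort_dmm m m) (mesh_sort merge_sort) (T m) A B"
      "rearrangement m m A B" "sorted (map (\<lambda>x. x) (row_major m m B))"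
      using mesh_sort_computes[OF srt _ T] by blast
    then show ?thesis unfolding sorts_within_def by auto
  qed
  ultimately show "\<exists>(P :: instr list) (c :: nat) (T :: nat \<Rightarrow> nat).
      (\<lambda>m. real (T m)) \<in> O(\<lambda>m. real m * ln (real m)) \<and>
      (\<forall>w m. \<forall>A :: nat \<Rightarrow> nat \<Rightarrow> 'a.
         w = m \<and> m > 0 \<longrightarrow> sorts_within c P w m (T m) A)"
    by blast
next
  have "(\<lambda>m. real (6200 * m)) \<in> O(\<lambda>m. real m)"
    by (intro bigoI[of _ 6200]) simp
  moreover have "partitions_within 200 (mesh_sort counting_sort) m m (6200 * m) label A"
    if m: "0 < m" and input: "partition_input m m label A" for m label and A :: "nat \<Rightarrow> nat \<Rightarrow> 'b"
  proof -
    obtain n where n: "2 ^ n * 2 ^ n \<le> m" "m < 4 * (2 ^ n * 2 ^ n)" using ex_power_4[OF m] .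
    interpret dmm_square "partition_dmm m m label" 200 "\<lambda>x. label x < m" m n "2 ^ n" "2 ^ n * 2 ^ n"
      "32 * (2 ^ n * 2 ^ n)"
      using n by unfold_locales (auto simp: partition_dmm_def)
    let ?L = "32 * (2 ^ n * 2 ^ n) :: nat"
    have label: "item_label (partition_dmm m m label) = label" by (simp add: partition_dmm_def)
    have srt: "sorter (cell_le label) counting_sort (17 * ?L + 9 * m + 18)"
      using sorter_counting_sort by (simp add: label)
    have "n \<le> m" using n(1) less_exp[of n] by (metis le_trans less_imp_le le_square)
    \<comment> \<open>With \<open>L \<le> 32 * m\<close>, \<open>n \<le> m\<close> and
      \<open>1 \<le> m\<close> the coefficient is at most
      \<open>8 * (17 * 32 + 9 + 18) + 10 * (5 * 32 + 2) + 6 = 6194\<close>.\<close>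
    then have T: "2 * n + 4 + (8 * (17 * ?L + 9 * m + 18) + 10 * (5 * ?L + 2)) \<le> 6200 * m"
      using L_le m by simp
    have "\<And>i j. i < m \<Longrightarrow> j < m \<Longrightarrow> label (A i j) < m"
      using input by (simp add: partition_input_def)
    then obtain B where B: "computes_within 200 (partition_dmm m m label) (mesh_sort counting_sort) (6200 * m) A B"
      "rearrangement m m A B" "sorted (map label (row_major m m B))"
      using mesh_sort_computes[OF srt _ T] by blast
    have "label (B i j) = i" if "i < m" "j < m" for i j
    proof -
      let ?l = "\<lambda>k. label (B (k div m) (k mod m))"
      have "?l k \<le> ?l k'" if "k \<le> k'" "k' < m * m" for k k'
        using B(3) that by (simp add: row_major_eq sorted_iff_nth_mono)
      then have "?l (i * m + j) = (i * m + j) div m"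
        using key_count_label[OF input _ B(2)] that by (intro balanced_labels pair_less)
      then show ?thesis using that by simp
    qed
    then show ?thesis using B(1,2) unfolding partitions_within_def by blast
  qed
  ultimately show "\<exists>(P :: instr list) (c :: nat) (T :: nat \<Rightarrow> nat).
      (\<lambda>m. real (T m)) \<in> O(\<lambda>m. real m) \<and>
      (\<forall>w m. \<forall>(label :: 'b \<Rightarrow> nat) (A :: nat \<Rightarrow> nat \<Rightarrow> 'b).
         w = m \<and> m > 0 \<and> partition_input w m label A
         \<longrightarrow> partitions_within c P w m (T m) label A)"
    by blast
qed

end
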